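(* Let $K=\mathbb{R}$ or $K=\mathbb{C}$, let $d\ge 1$ and $n\ge d$ be integers, and let $\Sigma\in\mathcal{P}_d(K)$. Then the Fréchet mean of the projective Wishart distribution $P\mathcal{W}(\Sigma,n)$ is unique and equals $\bar\Sigma$: $$F(P\mathcal{W}(\Sigma,n))=\bar\Sigma=\frac{1}{\det(\Sigma)^{1/d}}\,\Sigma .$$
   Context: $\mathcal{P}_d(K)$ is the set of $d\times d$ symmetric positive definite real matrices if $K=\mathbb{R}$, and of $d\times d$ Hermitian positive definite complex matrices if $K=\mathbb{C}$. $A^*$ denotes the transpose ($K=\mathbb{R}$) or conjugate transpose ($K=\mathbb{C}$) of $A$. Wishart distribution: for $\Sigma\in\mathcal{P}_d(K)$ and $n\ge d$, let $Y_1,\dots,Y_n$ be i.i.d. column vectors in $K^d$ with Gaussian law $\mathcal{N}_d(0,\Sigma)$ of mean $0$ and covariance $\Sigma$ (for $K=\mathbb{C}$, the circularly symmetric complex Gaussian with $E[YY^*]=\Sigma$). $\mathcal{W}(\Sigma,n)$ is the law of $X_n=\sum_{i=1}^n Y_iY_i^*$; for $n\ge d$ it is supported on $\mathcal{P}_d(K)$, i.e. $X_n\in\mathcal{P}_d(K)$ almost surely. Projective Wishart distribution: let $\mathcal{S}=\{X\in\mathcal{P}_d(K):\det(X)=1\}$ (identified with the quotient $\mathcal{P}_d(K)/\mathbb{R}_{>0}$) and let $\pi:\mathcal{P}_d(K)\to\mathcal{S}$, $\pi(X)=\det(X)^{-1/d}X$. Write $\bar X=\pi(X)$. $P\mathcal{W}(\Sigma,n)$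 is the law on $\mathcal{S}$ of $\pi(X)$ when $X\sim\mathcal{W}(\Sigma,n)$. Affine-invariant distance on $\mathcal{S}$: $\operatorname{dist}(x,y)=c\,\|\log(x^{-1/2}yx^{-1/2})\|$, where $\|\cdot\|$ is the Frobenius norm, $\log$ is the matrix logarithm, and $c>0$ is a fixed constant (the distance is defined up to this multiplicative constant). Fréchet mean: for a probability distribution $\mu$ on $\mathcal{S}$, $F(\mu)=\operatorname{argmin}_{x\in\mathcal{S}}\int_{\mathcal{S}}\operatorname{dist}(x,y)^2\,\mathrm{d}\mu(y)$. The statement asserts that the minimizer exists, is unique, and is $\bar\Sigma$. *)

theory Defs
  imports "HOL-Probability.Probability"
begin

text \<open>
  The scalars are the reals or the complex numbers. The class below has exactly these two
  models; \<open>kconj\<close> is the identity on the reals and complex conjugation on the complex numbers.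
  The inner product \<open>\<bullet>\<close> is always the real one of the library, so that for column vectors
  \<open>x \<bullet> y\<close> is the real part of the product of the conjugate transpose of \<open>x\<close> with \<open>y\<close>.
\<close>

class real_complex = real_normed_field + euclidean_space +
  fixes kconj :: "'a \<Rightarrow> 'a"
  assumes kconj_add: "kconj (x + y) = kconj x + kconj y"
    and kconj_mult: "kconj (x * y) = kconj x * kconj y"
    and kconj_kconj: "kconj (kconj x) = x"
    and kconj_scaleR_one: "kconj (r *\<^sub>R 1) = r *\<^sub>R 1"
    and kconj_inner: "kconj x * y + x * kconj y = (2 * (x \<bullet> y)) *\<^sub>R 1"

instantiation real :: real_complex
begin

definition kconj_real :: "real \<Rightarrow> real" where "kconj_real x = x"

instance by standard (auto simp: kconj_real_def)

end

instantiation complex :: real_complex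
begin

definition kconj_complex :: "complex \<Rightarrow> complex" where "kconj_complex = cnj"

instance by standard (auto simp: kconj_complex_def complex_eq_iff inner_complex_def)

end

text \<open>Real part, as the component along \<open>1\<close>.\<close>

definition kre :: "'a::real_complex \<Rightarrow> real" where
  "kre z = z \<bullet> 1"

lemma kre_real: "kre (x::real) = x"
  by (simp add: kre_def)

lemma kre_complex: "kre z = Re z"
  by (simp add: kre_def inner_complex_def)

definition conj_transpose :: "'a::real_complex^'n^'m \<Rightarrow> 'a^'m^'n" where
  "conj_transpose A = (\<chi> i j. kconj (A $ j $ i))"

definition hermitian :: "'a::real_complex^'d^'d \<Rightarrow> bool" where
  "hermitian A \<longleftrightarrow> conj_transpose A = A"

definition unitary :: "'a::real_complex^'d^'d \<Rightarrow> bool" where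
  "unitary U \<longleftrightarrow> conj_transpose U ** U = mat 1 \<and> U ** conj_transpose U = mat 1"

text \<open>For Hermitian \<open>A\<close> the quadratic form is real valued, hence equal to \<open>x \<bullet> (A *v x)\<close>.\<close>

definition pos_def :: "('a::real_complex^'d^'d) set" where
  "pos_def = {A. hermitian A \<and> (\<forall>x. x \<noteq> 0 \<longrightarrow> x \<bullet> (A *v x) > 0)}"

definition unit_det :: "('a::real_complex^'d^'d) set" where
  "unit_det = {A \<in> pos_def. det A = 1}"

text \<open>The determinant of a positive definite matrix is a positive real number.\<close>

definition proj_det :: "'a::real_complex^'d^'d \<Rightarrow> 'a^'d^'d" where
  "proj_det A = (kre (det A) powr (- 1 / real CARD('d))) *\<^sub>R A"

definition diag_mat :: "('d \<Rightarrow> real) \<Rightarrow> 'a::real_complex^'d^'d" where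
  "diag_mat l = (\<chi> i j. if i = j then of_real (l i) else 0)"

text \<open>
  Functional calculus: a function of a Hermitian matrix is obtained by applying it to the
  eigenvalues in a unitary diagonalisation. The result does not depend on the diagonalisation,
  see \<open>herm_fun_eqI\<close> below.
\<close>

definition herm_fun :: "(real \<Rightarrow> real) \<Rightarrow> 'a::real_complex^'d^'d \<Rightarrow> 'a^'d^'d" where
  "herm_fun f A = (THE B. \<exists>U l. unitary U \<and>
      A = U ** diag_mat l ** conj_transpose U \<and>
      B = U ** diag_mat (\<lambda>i. f (l i)) ** conj_transpose U)"

definition mat_log :: "'a::real_complex^'d^'d \<Rightarrow> 'a^'d^'d" where
  "mat_log = herm_fun ln"

definition mat_inv_sqrt :: "'a::real_complex^'d^'d \<Rightarrow> 'a^'d^'d" where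
  "mat_inv_sqrt = herm_fun (\<lambda>t. 1 / sqrt t)"

lemma diag_mat_mult_left: "(diag_mat l ** W) $ i $ j = of_real (l i) * W $ i $ j"
  by (simp add: matrix_matrix_mult_def diag_mat_def if_distrib[of "\<lambda>t. t * _"] cong: if_cong)

lemma diag_mat_mult_right: "(W ** diag_mat l) $ i $ j = W $ i $ j * of_real (l j)"
  by (simp add: matrix_matrix_mult_def diag_mat_def if_distrib[of "\<lambda>t. _ * t"] cong: if_cong)

lemma herm_fun_unique:
  assumes U: "unitary U" and V: "unitary V"
    and eq: "U ** diag_mat l ** conj_transpose U = V ** diag_mat m ** conj_transpose V"
  shows "U ** diag_mat (\<lambda>i. f (l i)) ** conj_transpose U =
         V ** diag_mat (\<lambda>i. f (m i)) ** conj_transpose V"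
proof -
  define W where "W = conj_transpose V ** U"
  have VV: "conj_transpose V ** V = mat 1" "V ** conj_transpose V = mat 1"
    and UU: "conj_transpose U ** U = mat 1" "U ** conj_transpose U = mat 1"
    using U V by (auto simp: unitary_def)
  have "conj_transpose V ** (U ** diag_mat l ** conj_transpose U) ** U =
        conj_transpose V ** (V ** diag_mat m ** conj_transpose V) ** U"
    by (simp add: eq)
  then have "W ** diag_mat l ** (conj_transpose U ** U) =
             (conj_transpose V ** V) ** diag_mat m ** W"
    by (simp add: W_def matrix_mul_assoc)
  then have comm: "W ** diag_mat l = diag_mat m ** W"
    by (simp add: UU VV)
  have "W $ i $ j * of_real (f (l j)) = of_real (f (m i)) * W $ i $ j" for i j
  proof (cases "W $ i $ j = 0")
    case False
    have "W $ i $ j * of_real (l j) = of_real (m i) * W $ i $ j"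
      using comm by (metis diag_mat_mult_left diag_mat_mult_right)
    then have "l j = m i" using False by simp
    then show ?thesis by simp
  qed simp
  then have "W ** diag_mat (\<lambda>i. f (l i)) = diag_mat (\<lambda>i. f (m i)) ** W"
    by (simp add: vec_eq_iff diag_mat_mult_left diag_mat_mult_right)
  then have "V ** (W ** diag_mat (\<lambda>i. f (l i))) ** conj_transpose U =
             V ** (diag_mat (\<lambda>i. f (m i)) ** W) ** conj_transpose U" by simp
  then have "(V ** conj_transpose V) ** U ** diag_mat (\<lambda>i. f (l i)) ** conj_transpose U =
        V ** diag_mat (\<lambda>i. f (m i)) ** conj_transpose V ** (U ** conj_transpose U)"
    by (simp add: W_def matrix_mul_assoc)
  then show ?thesis by (simp add: UU VV)
qed

lemma herm_fun_eqI:
  assumes "unitary U" and "A = U ** diag_mat l ** conj_transpose U"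
  shows "herm_fun f A = U ** diag_mat (\<lambda>i. f (l i)) ** conj_transpose U"
  unfolding herm_fun_def
proof (rule the_equality)
  show "\<exists>V m. unitary V \<and> A = V ** diag_mat m ** conj_transpose V \<and>
      U ** diag_mat (\<lambda>i. f (l i)) ** conj_transpose U =
      V ** diag_mat (\<lambda>i. f (m i)) ** conj_transpose V"
    using assms by blast
next
  fix B
  assume "\<exists>V m. unitary V \<and> A = V ** diag_mat m ** conj_transpose V \<and>
      B = V ** diag_mat (\<lambda>i. f (m i)) ** conj_transpose V"
  then show "B = U ** diag_mat (\<lambda>i. f (l i)) ** conj_transpose U"
    using assms herm_fun_unique by metis
qed

text \<open>The norm on \<open>'a^'d^'d\<close> is the Frobenius norm.\<close>

definition affine_dist :: "real \<Rightarrow> 'a::real_complex^'d^'d \<Rightarrow> 'a^'d^'d \<Rightarrow> real" where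
  "affine_dist c x y = c * norm (mat_log (mat_inv_sqrt x ** y ** mat_inv_sqrt x))"

text \<open>
  The centred Gaussian law with covariance matrix \<open>S\<close>, circularly symmetric in the complex case.
  Writing the density in terms of the real dimension \<open>b\<close> of the scalars covers both cases;
  the usual formulas are \<open>gaussian_real\<close> and \<open>gaussian_complex\<close> below.
\<close>

definition gaussian :: "'a::real_complex^'d^'d \<Rightarrow> ('a^'d) measure" where
  "gaussian S = (let b = real DIM('a) in
     density lborel (\<lambda>y. ennreal (
       (b / (2 * pi)) powr (b * real CARD('d) / 2) * kre (det S) powr (- b / 2) *
       exp (- (b / 2) * (y \<bullet> (matrix_inv S *v y))))))"

lemma gaussian_real:
  assumes "det S > 0"
  shows "gaussian (S :: real^'d^'d) = density lborel (\<lambda>y. ennreal (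
     exp (- (y \<bullet> (matrix_inv S *v y)) / 2) / sqrt ((2 * pi) ^ CARD('d) * det S)))"
proof -
  have "(1 / (2 * pi)) powr (real CARD('d) / 2) = 1 / sqrt ((2 * pi) ^ CARD('d))"
  proof -
    have "(1 / (2 * pi)) powr (real CARD('d) / 2) =
          ((1 / (2 * pi)) powr real CARD('d)) powr (1 / 2)"
      by (subst powr_powr) simp
    also have "\<dots> = sqrt ((1 / (2 * pi)) ^ CARD('d))"
      by (subst powr_realpow) (simp_all add: powr_half_sqrt)
    also have "\<dots> = 1 / sqrt ((2 * pi) ^ CARD('d))"
      by (simp only: power_one_over real_sqrt_divide real_sqrt_one)
    finally show ?thesis .
  qed
  moreover have "det S powr (- (1 / 2)) = 1 / sqrt (det S)"
    using assms by (subst powr_minus_divide) (simp add: powr_half_sqrt)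
  ultimately show ?thesis
    by (simp add: gaussian_def Let_def kre_real real_sqrt_mult)
qed

lemma gaussian_complex:
  assumes "Re (det S) > 0"
  shows "gaussian (S :: complex^'d^'d) = density lborel (\<lambda>y. ennreal (
     exp (- (y \<bullet> (matrix_inv S *v y))) / (pi ^ CARD('d) * Re (det S))))"
proof -
  have "(1 / pi) powr real CARD('d) = 1 / pi ^ CARD('d)"
    by (simp add: powr_realpow power_one_over)
  moreover have "Re (det S) powr (- 1) = 1 / Re (det S)"
    using assms by (subst powr_minus_divide) simp
  ultimately show ?thesis
    by (simp add: gaussian_def Let_def kre_complex)
qed

definition outer :: "'a::real_complex^'d \<Rightarrow> 'a^'d^'d" where
  "outer y = (\<chi> i j. y $ i * kconj (y $ j))"

definition wishart :: "'a::real_complex^'d^'d \<Rightarrow> nat \<Rightarrow> ('a^'d^'d) measure" where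
  "wishart S n = distr (PiM {..<n} (\<lambda>_. gaussian S)) borel (\<lambda>Y. \<Sum>i<n. outer (Y i))"

text \<open>
  For \<open>n \<ge> CARD('d)\<close> the complement of \<open>pos_def\<close> is a null set of \<open>wishart S n\<close>; it is discarded
  in order to obtain a law on \<open>unit_det\<close>.
\<close>

definition proj_wishart :: "'a::real_complex^'d^'d \<Rightarrow> nat \<Rightarrow> ('a^'d^'d) measure" where
  "proj_wishart S n =
     distr (restrict_space (wishart S n) pos_def) (restrict_space borel unit_det) proj_det"

text \<open>
  The set of all minimisers. The integral takes values in \<open>[0, \<infinity>]\<close>, so no integrability is
  presupposed.
\<close>

definition frechet_mean ::
  "real \<Rightarrow> ('a::real_complex^'d^'d) measure \<Rightarrow> ('a^'d^'d) set" where
  "frechet_mean c \<mu> =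
     {x. is_arg_min (\<lambda>x. \<integral>\<^sup>+ y. ennreal ((affine_dist c x y)\<^sup>2) \<partial>\<mu>) (\<lambda>x. x \<in> unit_det) x}"

end

theory Submission
  imports Defs "HOL-Real_Asymp.Real_Asymp" "HOL-Computational_Algebra.Fundamental_Theorem_Algebra"
begin

text \<open>
  Congruence by a matrix of determinant of modulus one is an isometry, so with \<open>H\<close> the inverse
  square root of the normalised covariance \<open>s\<close> one may work with \<open>L y = log (H y H)\<close>, for which
  \<open>dist (s, y) = c |L y|\<close>. The exponential map of the positive definite cone does not decrease
  distances, whence \<open>dist (x, y) \<ge> c |h - L y|\<close> with \<open>h = log (H x H)\<close>. The law of \<open>L y\<close> is
  invariant under unitary conjugation and concentrated on traceless matrices, so its mean is
  orthogonal to \<open>h\<close>, and expanding the square and integrating gives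
  \<open>E dist (x, y)\<^sup>2 \<ge> E dist (s, y)\<^sup>2 + c\<^sup>2 m |h|\<^sup>2\<close>, \<open>m\<close> being the total mass.

  This is conclusive only if \<open>E |L y|\<^sup>2\<close> is finite, which for \<open>n\<close> close to the dimension is a
  statement about the singularity of the law at the boundary of the cone. It follows from the
  square integrability of the logarithm of the determinant of a Gaussian matrix \<open>M\<close>: up to a constant
  the law of \<open>M\<close> is dominated by that of \<open>M' + t I\<close> for a wider Gaussian \<open>M'\<close> and every
  \<open>0 \<le> t \<le> 1\<close>, and \<open>det (M' + t I)\<close> is a monic polynomial in \<open>t\<close>.
\<close>

subsection \<open>Conjugate transposes and the Frobenius inner product\<close>

text \<open>The comparison of logarithms rests on tr (x y^(-1)) + tr (x^(-1) y) - 2 d. It is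
  invariant under congruence, agrees to second order with the squared distance for c = 1, and
  dominates |log x - log y|^2 because its scalar form a / b + b / a - 2 dominates (ln a - ln b)^2.
  On ever shorter steps of a geodesic it gives the expansion property from values of the logarithm
  alone.

  The symmetry of the law of L y comes from T = s^(1/2) V s^(-1/2) with V unitary: congruence by T
  fixes s, hence preserves the Gaussian law, while L turns it into conjugation by V.

  Square integrability is the obstacle because the cost takes values in [0, infinity]: an infinite
  cost at s would leave no strict inequality. The trace is controlled by Gaussian moments. For the
  negative part of ln det, d of the samples form a square matrix M with |det M|^2 below the Gram
  determinant, and the logarithm of a monic polynomial is square integrable on [0, 1] with a bound
  depending only on the degree, hence uniform in M.\<close>

lemma kconj_scaleR: "kconj (r *\<^sub>R x) = r *\<^sub>R kconj (x::'a::real_complex)"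
  by (metis kconj_mult kconj_scaleR_one mult_scaleR_left mult_1)

lemma kconj_of_real [simp]: "kconj (of_real r :: 'a::real_complex) = of_real r"
  by (simp add: of_real_def kconj_scaleR_one)

lemma kconj_0 [simp]: "kconj (0::'a::real_complex) = 0"
  using kconj_of_real[of 0, where 'a='a] by simp

lemma kconj_1 [simp]: "kconj (1::'a::real_complex) = 1"
  using kconj_of_real[of 1, where 'a='a] by simp

lemma kconj_sum: "kconj (sum f A) = (\<Sum>x\<in>A. kconj (f x :: 'a::real_complex))"
  by (induction A rule: infinite_finite_induct) (auto simp: kconj_add)

lemma kconj_prod: "kconj (prod f A) = (\<Prod>x\<in>A. kconj (f x :: 'a::real_complex))"
  by (induction A rule: infinite_finite_induct) (auto simp: kconj_mult)

lemma kconj_mult_self: "kconj x * x = of_real ((norm (x::'a::real_complex))\<^sup>2)"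
proof -
  have "2 *\<^sub>R (kconj x * x) = 2 *\<^sub>R of_real (x \<bullet> x)"
    using kconj_inner[of x x] by (simp add: mult.commute scaleR_2 of_real_def)
  then show ?thesis
    by (simp add: power2_norm_eq_inner)
qed

lemma norm_kconj [simp]: "norm (kconj x) = norm (x::'a::real_complex)"
proof -
  have "norm (kconj x) * norm x = (norm x)\<^sup>2"
    by (simp add: kconj_mult_self norm_power flip: norm_mult)
  then show ?thesis
    by (cases "x = 0") (auto simp: power2_eq_square)
qed

lemma bounded_linear_kconj: "bounded_linear (kconj :: 'a::real_complex \<Rightarrow> 'a)"
  by (rule bounded_linear_intro[where K = 1]) (auto simp: kconj_add kconj_scaleR)

lemma inner_one_one: "(1::'a::real_complex) \<bullet> 1 = 1"
  by (metis norm_one one_power2 power2_norm_eq_inner)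

lemma bounded_linear_kre: "bounded_linear (kre :: 'a::real_complex \<Rightarrow> real)"
  unfolding kre_def by (rule bounded_linear_inner_left)

lemma kre_sum: "kre (sum f A) = (\<Sum>x\<in>A. kre (f x :: 'a::real_complex))"
  by (simp add: kre_def inner_sum_left)

lemma kre_of_real_mult [simp]: "kre (of_real r * (x::'a::real_complex)) = r * kre x"
  by (simp add: kre_def of_real_def)

lemma kre_of_real [simp]: "kre (of_real r :: 'a::real_complex) = r"
  by (simp add: kre_def of_real_def inner_one_one)

text \<open>With z = conj(x) y, both sides are half the coefficient of z + conj(z): the axiom
  \<open>kconj_inner\<close> evaluates this sum once from the pair (x, y) and once from the pair (z,
  1).\<close>

lemma inner_eq_kre: "x \<bullet> y = kre (kconj x * (y::'a::real_complex))"
proof -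
  define z where "z = kconj x * y"
  have "z + kconj z = (2 * kre z) *\<^sub>R 1"
    using kconj_inner[of z 1] by (simp add: kre_def add.commute)
  moreover have "z + kconj z = (2 * (x \<bullet> y)) *\<^sub>R 1"
    using kconj_inner[of x y] by (simp add: z_def kconj_mult kconj_kconj)
  ultimately show ?thesis by (simp add: z_def)
qed

lemma conj_transpose_nth [simp]: "conj_transpose A $ i $ j = kconj (A $ j $ i)"
  by (simp add: conj_transpose_def)

lemma conj_transpose_conj_transpose [simp]: "conj_transpose (conj_transpose A) = A"
  by (simp add: vec_eq_iff kconj_kconj)

lemma conj_transpose_mult: "conj_transpose (A ** B) = conj_transpose B ** conj_transpose A"
  by (simp add: vec_eq_iff matrix_matrix_mult_def kconj_sum kconj_mult mult.commute)

lemma conj_transpose_mat_1 [simp]: "conj_transpose (mat 1) = mat 1"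
  by (simp add: vec_eq_iff mat_def)

lemma conj_transpose_diag_mat [simp]: "conj_transpose (diag_mat l) = diag_mat l"
  by (simp add: vec_eq_iff diag_mat_def)

lemma conj_transpose_scaleR: "conj_transpose (r *\<^sub>R A) = r *\<^sub>R conj_transpose A"
  by (simp add: vec_eq_iff kconj_scaleR)

lemma continuous_on_conj_transpose [continuous_intros]:
  "continuous_on S f \<Longrightarrow> continuous_on S (\<lambda>x. conj_transpose (f x :: 'a::real_complex^'n^'m))"
  unfolding conj_transpose_def
  by (intro continuous_on_vec_lambda bounded_linear.continuous_on[OF bounded_linear_kconj]
      continuous_on_component)

lemma matrix_mult_scaleR_left: "(r *\<^sub>R A) ** B = r *\<^sub>R (A ** (B::'a::real_complex^'n^'m))"
  by (simp add: vec_eq_iff matrix_matrix_mult_def scaleR_sum_right)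

lemma matrix_mult_scaleR_right: "A ** (r *\<^sub>R B) = r *\<^sub>R (A ** (B::'a::real_complex^'n^'m))"
  by (simp add: vec_eq_iff matrix_matrix_mult_def scaleR_sum_right)

lemma matrix_vector_mult_scaleR: "A *v (r *\<^sub>R x) = r *\<^sub>R (A *v (x::'a::real_complex^'n))"
  by (simp add: vec_eq_iff matrix_vector_mult_def scaleR_sum_right)

lemma scaleR_matrix_vector_mult: "(r *\<^sub>R A) *v x = r *\<^sub>R (A *v (x::'a::real_complex^'n))"
  by (simp add: vec_eq_iff matrix_vector_mult_def scaleR_sum_right)

lemma linear_matrix_vector_mult: "linear (\<lambda>x. A *v (x::'a::real_complex^'n))"
  by (intro linearI) (auto simp: matrix_vector_mult_scaleR matrix_vector_right_distrib)

lemma bounded_bilinear_matrix_mult: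
  "bounded_bilinear (\<lambda>(A::'a::real_complex^'n^'m) (B::'a^'k^'n). A ** B)"
  unfolding bilinear_conv_bounded_bilinear[symmetric] bilinear_def
  by (intro conjI allI linearI)
     (auto simp: matrix_mult_scaleR_left matrix_mult_scaleR_right vec_eq_iff
        matrix_matrix_mult_def sum.distrib scaleR_sum_right algebra_simps)

lemmas continuous_on_matrix_mult [continuous_intros] =
  bounded_bilinear.continuous_on[OF bounded_bilinear_matrix_mult]

text \<open>In trace form, multiplication by a matrix on either side has multiplication by its
  conjugate transpose as adjoint; norms of conjugated matrices are computed this way.\<close>

lemma inner_matrix_eq: "A \<bullet> B = kre (trace (conj_transpose A ** (B::'a::real_complex^'n^'m)))"
  unfolding inner_vec_def trace_def matrix_matrix_mult_def
  by (simp add: kre_sum inner_eq_kre) (rule sum.swap)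

lemma inner_matrix_mult_left:
  "(U ** A) \<bullet> B = A \<bullet> (conj_transpose U ** (B::'a::real_complex^'n^'m))"
  by (simp add: inner_matrix_eq conj_transpose_mult matrix_mul_assoc)

lemma inner_matrix_mult_right:
  fixes A :: "'a::real_complex^'n^'m" and U :: "'a^'k^'n"
  shows "(A ** U) \<bullet> B = A \<bullet> (B ** conj_transpose U)"
proof -
  have "trace (conj_transpose U ** (conj_transpose A ** B)) = trace ((conj_transpose A ** B) ** conj_transpose U)"
    by (rule trace_mul_sym)
  then show ?thesis
    by (simp add: inner_matrix_eq conj_transpose_mult matrix_mul_assoc)
qed

lemma unitaryD: "unitary U \<Longrightarrow> conj_transpose U ** U = mat 1" "unitary U \<Longrightarrow> U ** conj_transpose U = mat 1"
  by (auto simp: unitary_def)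

lemma unitaryI: "conj_transpose U ** U = mat 1 \<Longrightarrow> unitary U"
  by (simp add: unitary_def matrix_left_right_inverse)

lemma unitary_conj_transpose: "unitary U \<Longrightarrow> unitary (conj_transpose U)"
  by (simp add: unitary_def)

lemma unitary_mult: "unitary U \<Longrightarrow> unitary V \<Longrightarrow> unitary (U ** V)"
proof (rule unitaryI)
  assume U: "unitary U" and V: "unitary V"
  have "conj_transpose (U ** V) ** (U ** V) = conj_transpose V ** (conj_transpose U ** U) ** V"
    by (simp only: conj_transpose_mult matrix_mul_assoc)
  then show "conj_transpose (U ** V) ** (U ** V) = mat 1"
    by (simp add: unitaryD[OF U] unitaryD[OF V])
qed

lemma norm_unitary_conj:
  assumes "unitary (U::'a::real_complex^'d^'d)"
  shows "norm (U ** A ** conj_transpose U) = norm A"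
proof -
  have "(U ** A ** conj_transpose U) \<bullet> (U ** A ** conj_transpose U) =
      A \<bullet> (conj_transpose U ** (U ** A ** conj_transpose U) ** U)"
    by (subst inner_matrix_mult_right, subst matrix_mul_assoc[symmetric], subst inner_matrix_mult_left)
       (simp add: matrix_mul_assoc)
  also have "conj_transpose U ** (U ** A ** conj_transpose U) ** U
      = (conj_transpose U ** U) ** A ** (conj_transpose U ** U)"
    by (simp only: matrix_mul_assoc)
  finally show ?thesis
    by (simp add: unitaryD[OF assms] norm_eq_sqrt_inner)
qed

lemma inner_matrix_vector_mult:
  "x \<bullet> (A *v y) = (conj_transpose A *v x) \<bullet> (y::'a::real_complex^'n)"
proof -
  have "x \<bullet> (A *v y) = (\<Sum>i\<in>UNIV. \<Sum>j\<in>UNIV. kre (kconj (x $ i) * (A $ i $ j * y $ j)))"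
    by (simp add: inner_vec_def inner_eq_kre matrix_vector_mult_def sum_distrib_left kre_sum)
  also have "\<dots> = (\<Sum>j\<in>UNIV. \<Sum>i\<in>UNIV. kre (kconj (x $ i) * (A $ i $ j * y $ j)))"
    by (rule sum.swap)
  also have "\<dots> = (conj_transpose A *v x) \<bullet> y"
    by (simp add: inner_vec_def inner_eq_kre matrix_vector_mult_def kconj_sum kconj_mult
        kconj_kconj sum_distrib_right kre_sum mult.assoc mult.left_commute)
  finally show ?thesis .
qed

lemma diag_mat_1: "diag_mat (\<lambda>_. 1) = mat 1"
  by (simp add: vec_eq_iff diag_mat_def mat_def)

lemma diag_mat_scaleR: "r *\<^sub>R diag_mat l = diag_mat (\<lambda>i. r * l i)"
  by (simp add: vec_eq_iff diag_mat_def of_real_def)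

lemma diag_mat_mult: "diag_mat l ** diag_mat m = diag_mat (\<lambda>i. l i * m i)"
  by (simp add: vec_eq_iff diag_mat_mult_left) (simp add: diag_mat_def)

lemma trace_diag_mat: "trace (diag_mat l :: 'a::real_complex^'d^'d) = of_real (\<Sum>i\<in>UNIV. l i)"
  by (simp add: trace_def diag_mat_def)

lemma det_diag_mat: "det (diag_mat l :: 'a::real_complex^'d^'d) = of_real (\<Prod>i\<in>UNIV. l i)"
  by (subst det_diagonal) (auto simp: diag_mat_def)

lemma det_conj_transpose: "det (conj_transpose A) = kconj (det (A::'a::real_complex^'d^'d))"
proof -
  have [simp]: "kconj (of_int m) = (of_int m :: 'a)" for m
    by (metis kconj_of_real of_real_of_int_eq)
  have "det (conj_transpose A) = det (transpose (conj_transpose A))"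
    by simp
  also have "\<dots> = kconj (det A)"
    by (simp add: det_def transpose_def kconj_sum kconj_prod kconj_mult)
  finally show ?thesis .
qed

lemma norm_diag_mat: "(norm (diag_mat l :: 'a::real_complex^'d^'d))\<^sup>2 = (\<Sum>i\<in>UNIV. (l i)\<^sup>2)"
  by (simp add: power2_norm_eq_inner inner_matrix_eq diag_mat_mult trace_diag_mat kre_sum
      flip: power2_eq_square of_real_power)

subsection \<open>The spectral theorem\<close>

text \<open>The scalar-valued product, of which \<open>\<bullet>\<close> is only the real part. Over
  the complex numbers the columns of a unitary matrix must be orthogonal for this one.\<close>

definition cdot :: "'a::real_complex^'d \<Rightarrow> 'a^'d \<Rightarrow> 'a" where
  "cdot x y = (\<Sum>k\<in>UNIV. kconj (x $ k) * y $ k)"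

lemma cdot_commute: "cdot y x = kconj (cdot x y)"
  by (simp add: cdot_def kconj_sum kconj_mult kconj_kconj mult.commute)

lemma cdot_add: "cdot x (y + z) = cdot x y + cdot x z"
  by (simp add: cdot_def sum.distrib algebra_simps)

lemma cdot_scaleR: "cdot x (r *\<^sub>R y) = r *\<^sub>R cdot x y"
  by (simp add: cdot_def scaleR_sum_right)

lemma cdot_self: "cdot x x = of_real ((norm x)\<^sup>2)"
  by (simp add: cdot_def kconj_mult_self norm_vec_def L2_set_def sum_nonneg)

lemma cdot_matrix_vector: "cdot x (A *v y) = cdot (conj_transpose A *v x) (y::'a::real_complex^'d)"
proof -
  have "cdot x (A *v y) = (\<Sum>i\<in>UNIV. \<Sum>j\<in>UNIV. kconj (x $ i) * (A $ i $ j * y $ j))"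
    by (simp add: cdot_def matrix_vector_mult_def sum_distrib_left)
  also have "\<dots> = (\<Sum>j\<in>UNIV. \<Sum>i\<in>UNIV. kconj (x $ i) * (A $ i $ j * y $ j))"
    by (rule sum.swap)
  also have "\<dots> = cdot (conj_transpose A *v x) y"
    by (simp add: cdot_def matrix_vector_mult_def kconj_sum kconj_mult
        kconj_kconj sum_distrib_right mult.assoc mult.left_commute)
  finally show ?thesis .
qed

lemma continuous_on_cdot: "continuous_on S (cdot x)"
  unfolding cdot_def by (intro continuous_intros)

lemma hermitian_inner: "hermitian A \<Longrightarrow> x \<bullet> (A *v y) = (A *v x) \<bullet> y"
  by (simp add: hermitian_def inner_matrix_vector_mult)

text \<open>A maximiser of the quadratic form on the unit sphere of an invariant subspace is an
  eigenvector.\<close>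

lemma hermitian_eigenvector_in_subspace:
  fixes A :: "'a::real_complex^'d^'d"
  assumes A: "hermitian A" and S: "subspace S" "closed S" "\<And>x. x \<in> S \<Longrightarrow> A *v x \<in> S"
    and u: "u \<in> S" "u \<noteq> 0"
  obtains w l where "w \<in> S" "norm w = 1" "A *v w = l *\<^sub>R w"
proof -
  have "compact (sphere 0 1 \<inter> S)"
    using S by (intro compact_Int_closed) auto
  moreover have "u /\<^sub>R norm u \<in> sphere 0 1 \<inter> S"
    using u S by (auto simp: subspace_scale)
  moreover have "continuous_on (sphere 0 1 \<inter> S) (\<lambda>x. x \<bullet> (A *v x))"
    by (intro continuous_on_inner continuous_on_id linear_continuous_on
        linear_matrix_vector_mult[unfolded linear_conv_bounded_linear])
  ultimately obtain w where w: "w \<in> sphere 0 1 \<inter> S"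
    and max: "\<And>x. x \<in> sphere 0 1 \<inter> S \<Longrightarrow> x \<bullet> (A *v x) \<le> w \<bullet> (A *v w)"
    by (metis (lifting) continuous_attains_sup empty_iff)
  define l where "l = w \<bullet> (A *v w)"
  define B where "B x = l *\<^sub>R x - A *v x" for x
  have nw: "norm w = 1" and wS: "w \<in> S" using w by auto
  have psd: "x \<bullet> B x \<ge> 0" if "x \<in> S" for x
  proof (cases "x = 0")
    case False
    have "(x /\<^sub>R norm x) \<bullet> (A *v (x /\<^sub>R norm x)) \<le> l"
      unfolding l_def using False that S by (intro max) (auto simp: subspace_scale)
    then have "x \<bullet> (A *v x) / (norm x)\<^sup>2 \<le> l"
      by (simp add: matrix_vector_mult_scaleR divide_inverse power2_eq_square mult_ac)
    then show ?thesis
      using False by (simp add: B_def inner_diff_right divide_le_eq power2_norm_eq_inner)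
  qed simp
  have BS: "B x \<in> S" if "x \<in> S" for x
    using S that by (simp add: B_def subspace_diff subspace_scale)
  have Blin: "B (x - s *\<^sub>R y) = B x - s *\<^sub>R B y" for x y s
    by (simp add: B_def matrix_vector_mult_scaleR matrix_vector_mult_diff_distrib algebra_simps)
  have Bsym: "x \<bullet> B y = B x \<bullet> y" for x y
    by (simp add: B_def inner_diff_left inner_diff_right hermitian_inner[OF A])
  have Bw: "w \<bullet> B w = 0"
    using nw by (simp add: B_def inner_diff_right l_def flip: power2_norm_eq_inner)
  define m where "m = B w \<bullet> B w"
  define a where "a = B w \<bullet> B (B w)"
  \<comment> \<open>On S the form of B is positive semidefinite and w is a null vector. Moving from
    w by - s B w, the linear term - 2 s m would make the form negative for small s > 0 unless m =
    0.\<close>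
  have q: "s * s * a - 2 * s * m \<ge> 0" for s
  proof -
    have "0 \<le> (w - s *\<^sub>R B w) \<bullet> B (w - s *\<^sub>R B w)"
      using wS BS S by (intro psd) (simp add: subspace_diff subspace_scale)
    also have "\<dots> = s * s * a - 2 * s * m"
    proof -
      have "w \<bullet> B (B w) = m" by (simp add: Bsym m_def)
      then show ?thesis
        unfolding Blin inner_diff_left inner_diff_right
        by (simp add: Bw flip: a_def m_def)
    qed
    finally show ?thesis .
  qed
  have m0: "m \<ge> 0" by (simp add: m_def)
  have "m = 0"
  proof (rule ccontr)
    assume "m \<noteq> 0"
    then have mp: "m > 0" using m0 by simp
    \<comment> \<open>The value s = m / (|a| + 1) is small enough: s a <= m < 2 m, while s >
      0.\<close>
    have "0 \<le> (m / (\<bar>a\<bar> + 1)) * ((m / (\<bar>a\<bar> + 1)) * a - 2 * m)"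
      using q[of "m / (\<bar>a\<bar> + 1)"] by (simp add: algebra_simps)
    moreover have "m / (\<bar>a\<bar> + 1) > 0"
      using mp by (simp add: add_nonneg_pos)
    ultimately have "0 \<le> (m / (\<bar>a\<bar> + 1)) * a - 2 * m"
      using zero_le_mult_iff by (metis less_le_not_le)
    also have "(m / (\<bar>a\<bar> + 1)) * a \<le> m / (\<bar>a\<bar> + 1) * (\<bar>a\<bar> + 1)"
      using mp by (intro mult_left_mono) auto
    also have "\<dots> = m" by simp
    finally show False using mp by simp
  qed
  then have "A *v w = l *\<^sub>R w"
    by (simp add: m_def B_def)
  with that nw wS show ?thesis by blast
qed

text \<open>Induction over the set of indices: the new vector is taken in the orthogonal complement
  S of the earlier ones, which A leaves invariant because they are eigenvectors with real
  eigenvalues. With subsets of \<open>'d\<close> as index sets, a fresh index k is also a free row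
  of a square matrix, and this makes S nonzero.\<close>

lemma hermitian_orthonormal_eigenvectors:
  fixes A :: "'a::real_complex^'d^'d" and J :: "'d set"
  assumes A: "hermitian A"
  shows "\<exists>v l. (\<forall>i\<in>J. A *v v i = l i *\<^sub>R v i) \<and>
           (\<forall>i\<in>J. \<forall>j\<in>J. cdot (v i) (v j) = (if i = j then 1 else 0))"
  using finite[of J]
proof (induction J rule: finite_induct)
  case empty
  show ?case by simp
next
  case (insert k J)
  then obtain v l where v: "\<And>i. i \<in> J \<Longrightarrow> A *v v i = l i *\<^sub>R v i"
    "\<And>i j. i \<in> J \<Longrightarrow> j \<in> J \<Longrightarrow> cdot (v i) (v j) = (if i = j then 1 else 0)"
    by blast
  define S where "S = {x. \<forall>j\<in>J. cdot (v j) x = 0}"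
  \<comment> \<open>Rows in J carry the conjugated vectors, all other rows vanish. Row k is one of
    the latter, so M is singular, and a kernel vector is orthogonal to every
    \<open>v j\<close>.\<close>
  define M :: "'a^'d^'d" where "M = (\<chi> r s. if r \<in> J then kconj (v r $ s) else 0)"
  have "M ** B \<noteq> mat 1" for B
  proof
    assume "M ** B = mat 1"
    then have "(M ** B) $ k $ k = mat 1 $ k $ k" by simp
    then show False
      using \<open>k \<notin> J\<close> by (simp add: matrix_matrix_mult_def M_def mat_def)
  qed
  then have "\<not> (\<exists>B. B ** M = mat 1)"
    by (simp add: matrix_left_right_inverse)
  then obtain u where u: "M *v u = 0" "u \<noteq> 0"
    unfolding matrix_left_invertible_ker by blast
  have uS: "u \<in> S"
  proof -
    have "cdot (v j) u = 0" if "j \<in> J" for j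
    proof -
      have "cdot (v j) u = (M *v u) $ j"
        using that by (simp add: cdot_def matrix_vector_mult_def M_def)
      then show ?thesis using u by simp
    qed
    then show ?thesis by (simp add: S_def)
  qed
  have "subspace S"
    by (auto simp: subspace_def S_def cdot_add cdot_scaleR) (simp add: cdot_def)
  moreover have "closed S"
    unfolding S_def Ball_def
    by (intro closed_Collect_all closed_Collect_imp closed_Collect_eq continuous_on_cdot)
       (auto intro!: continuous_intros)
  moreover have "A *v x \<in> S" if x: "x \<in> S" for x
  proof -
    have "cdot (v j) (A *v x) = 0" if "j \<in> J" for j
    proof -
      have "cdot (v j) (A *v x) = cdot (A *v v j) x"
        using A by (simp add: cdot_matrix_vector hermitian_def)
      also have "\<dots> = kconj (cdot x (A *v v j))"
        by (rule cdot_commute)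
      also have "\<dots> = 0"
        using that x v(1)[OF that] cdot_commute[of x "v j"] by (simp add: cdot_scaleR S_def)
      finally show ?thesis .
    qed
    then show ?thesis by (simp add: S_def)
  qed
  ultimately obtain w m where w: "w \<in> S" "norm w = 1" "A *v w = m *\<^sub>R w"
    using hermitian_eigenvector_in_subspace[OF A, of S u] uS u(2) by blast
  have wv: "cdot (v j) w = 0" "cdot w (v j) = 0" if "j \<in> J" for j
    using w(1) that cdot_commute[of w "v j"] by (auto simp: S_def)
  have ww: "cdot w w = 1" using w(2) by (simp add: cdot_self)
  show ?case
  proof (intro exI conjI ballI)
    fix i assume "i \<in> insert k J"
    then show "A *v (v(k := w)) i = (l(k := m)) i *\<^sub>R (v(k := w)) i"
      using v(1) w(3) by (cases "i = k") auto
  next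
    fix i j assume ij: "i \<in> insert k J" "j \<in> insert k J"
    show "cdot ((v(k := w)) i) ((v(k := w)) j) = (if i = j then 1 else 0)"
      using ij v(2)[of i j] wv[of i] wv[of j] ww by (cases "i = k"; cases "j = k") simp_all
  qed
qed

theorem spectral_theorem:
  fixes A :: "'a::real_complex^'d^'d"
  assumes A: "hermitian A"
  obtains U l where "unitary U" "A = U ** diag_mat l ** conj_transpose U"
proof -
  obtain v :: "'d \<Rightarrow> 'a^'d" and l where *: "(\<forall>i\<in>UNIV. A *v v i = l i *\<^sub>R v i) \<and>
      (\<forall>i\<in>UNIV. \<forall>j\<in>UNIV. cdot (v i) (v j) = (if i = j then 1 else 0))"
    using hermitian_orthonormal_eigenvectors[OF A, of UNIV] by blast
  then have v: "A *v v i = l i *\<^sub>R v i" "cdot (v i) (v j) = (if i = j then 1 else 0)" for i j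
    by simp_all
  define U :: "'a^'d^'d" where "U = (\<chi> i j. v j $ i)"
  have U: "unitary U"
  proof (rule unitaryI)
    have "(conj_transpose U ** U) $ i $ j = cdot (v i) (v j)" for i j
      by (simp add: matrix_matrix_mult_def U_def cdot_def)
    then show "conj_transpose U ** U = mat 1"
      by (simp add: vec_eq_iff v mat_def)
  qed
  have "(A ** U) $ i $ j = (A *v v j) $ i" for i j
    by (simp add: matrix_matrix_mult_def matrix_vector_mult_def U_def)
  then have "A ** U = U ** diag_mat l"
    by (simp add: vec_eq_iff v diag_mat_mult_right)
       (simp add: U_def scaleR_conv_of_real mult.commute)
  then have "A ** (U ** conj_transpose U) = U ** diag_mat l ** conj_transpose U"
    by (simp add: matrix_mul_assoc)
  with U that show ?thesis by (simp add: unitaryD)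
qed

subsection \<open>Positive definite matrices\<close>

lemma pos_def_hermitian: "A \<in> pos_def \<Longrightarrow> hermitian A"
  by (simp add: pos_def_def)

text \<open>Here and below invertibility is recorded by an explicit inverse, so that the inverse is
  a term that can be multiplied with.\<close>

lemma pos_def_congruence:
  fixes P :: "'a::real_complex^'d^'d"
  assumes A: "A \<in> pos_def" and QP: "Q ** P = mat 1"
  shows "P ** A ** conj_transpose P \<in> pos_def"
proof -
  have PQ: "conj_transpose Q ** conj_transpose P = mat 1"
    using QP by (metis conj_transpose_mat_1 conj_transpose_mult matrix_left_right_inverse)
  have "x \<bullet> ((P ** A ** conj_transpose P) *v x) > 0" if "x \<noteq> 0" for x
  proof -
    have "conj_transpose P *v x \<noteq> 0"
      using PQ that by (metis matrix_vector_mul_assoc matrix_vector_mul_lid matrix_vector_mult_0_right)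
    then have "(conj_transpose P *v x) \<bullet> (A *v (conj_transpose P *v x)) > 0"
      using A by (simp add: pos_def_def)
    then show ?thesis
      by (simp add: inner_matrix_vector_mult[of _ P] flip: matrix_vector_mul_assoc)
  qed
  moreover have "hermitian (P ** A ** conj_transpose P)"
    using pos_def_hermitian[OF A]
    by (simp add: hermitian_def conj_transpose_mult matrix_mul_assoc)
  ultimately show ?thesis by (simp add: pos_def_def)
qed

lemma pos_def_congruence_iff:
  fixes P :: "'a::real_complex^'d^'d"
  assumes QP: "Q ** P = mat 1"
  shows "P ** A ** conj_transpose P \<in> pos_def \<longleftrightarrow> A \<in> pos_def"
proof
  assume L: "P ** A ** conj_transpose P \<in> pos_def"
  have PQ: "P ** Q = mat 1" using QP by (simp add: matrix_left_right_inverse)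
  have "Q ** (P ** A ** conj_transpose P) ** conj_transpose Q
      = (Q ** P) ** A ** conj_transpose (Q ** P)"
    by (simp add: conj_transpose_mult matrix_mul_assoc)
  then show "A \<in> pos_def"
    using pos_def_congruence[OF L PQ] QP by simp
qed (use assms pos_def_congruence in blast)

lemma diag_mat_vector_mult: "(diag_mat l *v x) $ i = l i *\<^sub>R (x $ i :: 'a::real_complex)"
  by (simp add: matrix_vector_mult_def diag_mat_def of_real_def
      if_distrib[of "\<lambda>t. t * _"] cong: if_cong)

lemma diag_mat_pos_def_iff:
  "(diag_mat l :: 'a::real_complex^'d^'d) \<in> pos_def \<longleftrightarrow> (\<forall>i. l i > 0)"
proof
  assume D: "(diag_mat l :: 'a^'d^'d) \<in> pos_def"
  show "\<forall>i. l i > 0"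
  proof
    fix i
    have "(diag_mat l *v axis i 1 :: 'a^'d) = l i *\<^sub>R axis i 1"
      by (simp add: vec_eq_iff diag_mat_vector_mult axis_def)
    moreover have "(axis i 1 :: 'a^'d) \<noteq> 0" by simp
    then have "axis i 1 \<bullet> (diag_mat l *v axis i 1 :: 'a^'d) > 0"
      using D unfolding pos_def_def by blast
    ultimately show "l i > 0"
      by (simp add: inner_axis_axis inner_one_one)
  qed
next
  assume l: "\<forall>i. l i > 0"
  have "x \<bullet> (diag_mat l *v x) > 0" if x: "x \<noteq> 0" for x :: "'a^'d"
  proof -
    obtain i where i: "x $ i \<noteq> 0" using x by (metis vec_eq_iff zero_index)
    have "x \<bullet> (diag_mat l *v x) = (\<Sum>i\<in>UNIV. l i * (x $ i \<bullet> x $ i))"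
      unfolding inner_vec_def
      by (simp add: diag_mat_vector_mult)
    also have "\<dots> > 0"
      using l i by (intro sum_pos2[of _ i]) (auto simp: less_imp_le)
    finally show ?thesis .
  qed
  then show "(diag_mat l :: 'a^'d^'d) \<in> pos_def"
    by (simp add: pos_def_def hermitian_def)
qed

lemma unitary_diag_pos_def_iff:
  assumes "unitary (U :: 'a::real_complex^'d^'d)"
  shows "U ** diag_mat l ** conj_transpose U \<in> pos_def \<longleftrightarrow> (\<forall>i. l i > 0)"
  using pos_def_congruence_iff[OF unitaryD(1)[OF assms]] diag_mat_pos_def_iff by blast

lemma pos_def_spectral:
  fixes A :: "'a::real_complex^'d^'d"
  assumes "A \<in> pos_def"
  obtains U l where "unitary U" "\<And>i. l i > 0" "A = U ** diag_mat l ** conj_transpose U"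
  using spectral_theorem[OF pos_def_hermitian[OF assms]] unitary_diag_pos_def_iff assms
  by metis

lemma unitary_diag_mult:
  assumes "unitary U"
  shows "(U ** diag_mat l ** conj_transpose U) ** (U ** diag_mat m ** conj_transpose U)
    = U ** diag_mat (\<lambda>i. l i * m i) ** conj_transpose U"
proof -
  have "(U ** diag_mat l ** conj_transpose U) ** (U ** diag_mat m ** conj_transpose U)
     = U ** diag_mat l ** (conj_transpose U ** U) ** diag_mat m ** conj_transpose U"
    by (simp only: matrix_mul_assoc)
  also have "\<dots> = U ** (diag_mat l ** diag_mat m) ** conj_transpose U"
    by (simp add: unitaryD[OF assms] matrix_mul_assoc)
  finally show ?thesis by (simp add: diag_mat_mult)
qed

lemma hermitian_unitary_diag: "hermitian (U ** diag_mat l ** conj_transpose U)"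
  by (simp add: hermitian_def conj_transpose_mult matrix_mul_assoc)

text \<open>S is x^(1/2). Exposing it together with the inverse root reduces later identities to
  reassociating products.\<close>

lemma mat_inv_sqrt_pos_def:
  fixes x :: "'a::real_complex^'d^'d"
  assumes x: "x \<in> pos_def"
  obtains S where "hermitian (mat_inv_sqrt x)" "hermitian S" "mat_inv_sqrt x ** S = mat 1"
    "S ** mat_inv_sqrt x = mat 1" "S ** S = x"
proof -
  obtain U l where U: "unitary U" "\<And>i. l i > 0" "x = U ** diag_mat l ** conj_transpose U"
    using pos_def_spectral[OF x] by blast
  define S where "S = U ** diag_mat (\<lambda>i. sqrt (l i)) ** conj_transpose U"
  have R: "mat_inv_sqrt x = U ** diag_mat (\<lambda>i. 1 / sqrt (l i)) ** conj_transpose U"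
    unfolding mat_inv_sqrt_def using herm_fun_eqI[OF U(1,3)] .
  have l: "l i \<noteq> 0" "\<bar>l i\<bar> = l i" for i using U(2)[of i] by auto
  have "U ** mat 1 ** conj_transpose U = mat 1"
    by (simp add: unitaryD[OF U(1)])
  then have "mat_inv_sqrt x ** S = mat 1" "S ** mat_inv_sqrt x = mat 1" "S ** S = x"
    unfolding R S_def unitary_diag_mult[OF U(1)] by (simp_all add: l diag_mat_1 U(3)[symmetric])
  moreover have "hermitian (mat_inv_sqrt x)" "hermitian S"
    unfolding R S_def by (rule hermitian_unitary_diag)+
  ultimately show ?thesis using that by blast
qed

text \<open>With S = x^(1/2) and R = x^(-1/2), diagonalise R y R by V and put P = S V, with inverse
  V* R. V is exported as well because the continuity proof for \<open>mat_log\<close> must know that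
  the numbers l are the eigenvalues of R y R.\<close>

lemma simultaneous_diag_root:
  fixes x y :: "'a::real_complex^'d^'d"
  assumes x: "x \<in> pos_def" and y: "y \<in> pos_def"
  obtains P Q V and l :: "'d \<Rightarrow> real" where "Q ** P = mat 1" "P ** Q = mat 1" "x = P ** conj_transpose P"
    "y = P ** diag_mat l ** conj_transpose P" "\<forall>i. l i > 0" "unitary V"
    "mat_inv_sqrt x ** y ** mat_inv_sqrt x = V ** diag_mat l ** conj_transpose V"
proof -
  define R where "R = mat_inv_sqrt x"
  obtain S where S: "hermitian R" "hermitian S" "R ** S = mat 1" "S ** R = mat 1" "S ** S = x"
    using mat_inv_sqrt_pos_def[OF x] unfolding R_def by metis
  have "R ** y ** conj_transpose R \<in> pos_def"
    using pos_def_congruence[OF y S(4)] .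
  then have "R ** y ** R \<in> pos_def"
    using S(1) by (simp add: hermitian_def)
  then obtain V l where V: "unitary V" "\<forall>i. l i > 0"
    "R ** y ** R = V ** diag_mat l ** conj_transpose V"
    using pos_def_spectral by blast
  have S': "conj_transpose S = S" using S(2) by (simp add: hermitian_def)
  have 1: "(conj_transpose V ** R) ** (S ** V) = conj_transpose V ** (R ** S) ** V"
    "(S ** V) ** (conj_transpose V ** R) = S ** (V ** conj_transpose V) ** R"
    "(S ** V) ** conj_transpose (S ** V) = S ** (V ** conj_transpose V) ** S"
    "(S ** V) ** diag_mat l ** conj_transpose (S ** V) = S ** (V ** diag_mat l ** conj_transpose V) ** S"
    by (simp_all only: matrix_mul_assoc conj_transpose_mult S')
  have "S ** (R ** y ** R) ** S = (S ** R) ** y ** (R ** S)"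
    by (simp only: matrix_mul_assoc)
  then have "y = S ** V ** diag_mat l ** conj_transpose (S ** V)"
    unfolding 1 V(3)[symmetric] by (simp add: S)
  moreover have "conj_transpose V ** R ** (S ** V) = mat 1" "S ** V ** (conj_transpose V ** R) = mat 1"
    "S ** V ** conj_transpose (S ** V) = x"
    unfolding 1 by (simp_all add: S unitaryD[OF V(1)])
  ultimately show ?thesis
    using that[of "conj_transpose V ** R" "S ** V" l V, folded R_def] V by metis
qed

lemma simultaneous_diag:
  fixes x y :: "'a::real_complex^'d^'d"
  assumes x: "x \<in> pos_def" and y: "y \<in> pos_def"
  obtains P Q and l :: "'d \<Rightarrow> real" where "Q ** P = mat 1" "P ** Q = mat 1" "x = P ** conj_transpose P"
    "y = P ** diag_mat l ** conj_transpose P" "\<forall>i. l i > 0"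
proof (rule simultaneous_diag_root[OF assms])
  fix P Q V :: "'a^'d^'d" and l :: "'d \<Rightarrow> real"
  assume "Q ** P = mat 1" "P ** Q = mat 1" "x = P ** conj_transpose P"
    "y = P ** diag_mat l ** conj_transpose P" "\<forall>i. l i > 0"
  then show thesis by (rule that)
qed

lemma inverse_conj_transpose:
  fixes P :: "'a::real_complex^'d^'d"
  assumes "Q ** P = mat 1"
  shows "P ** Q = mat 1" "conj_transpose P ** conj_transpose Q = mat 1"
    "conj_transpose Q ** conj_transpose P = mat 1"
  using assms matrix_left_right_inverse conj_transpose_mult conj_transpose_mat_1 by metis+

lemma congruence_1_pos_def:
  fixes P :: "'a::real_complex^'d^'d"
  assumes "Q ** P = mat 1"
  shows "P ** conj_transpose P \<in> pos_def"
  using pos_def_congruence[OF _ assms, of "mat 1"] diag_mat_pos_def_iff[of "\<lambda>_. 1"]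
  by (simp add: diag_mat_1)

text \<open>A factor P of x differs from the square root of x by a unitary: R P is unitary for R =
  x^(-1/2). Hence the numbers l are the eigenvalues of R y R, and the distance can be read off from
  any simultaneous diagonalisation.\<close>

lemma affine_dist_eq:
  fixes P :: "'a::real_complex^'d^'d"
    and l :: "'d \<Rightarrow> real"
  assumes QP: "Q ** P = mat 1" and l: "\<forall>i. l i > 0"
  shows "affine_dist k (P ** conj_transpose P) (P ** diag_mat l ** conj_transpose P)
     = k * sqrt (\<Sum>i\<in>UNIV. (ln (l i))\<^sup>2)"
proof -
  define x where "x = P ** conj_transpose P"
  define y where "y = P ** diag_mat l ** conj_transpose P"
  have x: "x \<in> pos_def"
    unfolding x_def by (rule congruence_1_pos_def[OF QP])
  define R where "R = mat_inv_sqrt x"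
  obtain S where S: "hermitian R" "hermitian S" "R ** S = mat 1" "S ** R = mat 1" "S ** S = x"
    using mat_inv_sqrt_pos_def[OF x] unfolding R_def by metis
  have R': "conj_transpose R = R" using S(1) by (simp add: hermitian_def)
  have "unitary (R ** P)"
  proof -
    have "(R ** P) ** conj_transpose (R ** P) = R ** x ** R"
      by (simp only: x_def conj_transpose_mult matrix_mul_assoc R')
    also have "\<dots> = (R ** S) ** (S ** R)"
      unfolding S(5)[symmetric] by (simp only: matrix_mul_assoc)
    finally show ?thesis
      by (simp add: S unitary_def matrix_left_right_inverse)
  qed
  moreover have "R ** y ** R = (R ** P) ** diag_mat l ** conj_transpose (R ** P)"
    by (simp only: y_def conj_transpose_mult matrix_mul_assoc R')
  ultimately have "norm (mat_log (R ** y ** R)) = norm (diag_mat (\<lambda>i. ln (l i)) :: 'a^'d^'d)"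
    unfolding mat_log_def using herm_fun_eqI norm_unitary_conj by metis
  also have "\<dots> = sqrt (\<Sum>i\<in>UNIV. (ln (l i))\<^sup>2)"
    by (metis norm_diag_mat norm_ge_zero real_sqrt_unique)
  finally show ?thesis
    by (simp add: affine_dist_def flip: x_def y_def R_def)
qed

text \<open>If P diagonalises the pair x, y simultaneously, then g P diagonalises the moved pair
  with the same l.\<close>

lemma affine_dist_congruence:
  fixes x y g h :: "'a::real_complex^'d^'d"
  assumes "x \<in> pos_def" "y \<in> pos_def" "h ** g = mat 1"
  shows "affine_dist k (g ** x ** conj_transpose g) (g ** y ** conj_transpose g) = affine_dist k x y"
proof -
  obtain P Q and l :: "'d \<Rightarrow> real" where P: "Q ** P = mat 1" "P ** Q = mat 1" "x = P ** conj_transpose P"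
    "y = P ** diag_mat l ** conj_transpose P" "\<forall>i. l i > 0"
    by (rule simultaneous_diag[OF assms(1,2)])
  have "(Q ** h) ** (g ** P) = Q ** (h ** g) ** P"
    by (simp only: matrix_mul_assoc)
  then have QP: "(Q ** h) ** (g ** P) = mat 1"
    by (simp add: assms P)
  have "g ** x ** conj_transpose g = (g ** P) ** conj_transpose (g ** P)"
    "g ** y ** conj_transpose g = (g ** P) ** diag_mat l ** conj_transpose (g ** P)"
    unfolding P(3,4) by (simp_all only: conj_transpose_mult matrix_mul_assoc)
  then show ?thesis
    using affine_dist_eq[OF QP P(5), of k] affine_dist_eq[OF P(1,5), of k] P(3,4) by simp
qed

subsection \<open>The exponential map does not decrease distances\<close>

lemma inner_congruence:
  fixes P :: "'a::real_complex^'d^'d"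
  shows "(P ** D ** conj_transpose P) \<bullet> B = D \<bullet> (conj_transpose P ** B ** P)"
  by (subst inner_matrix_mult_right, subst inner_matrix_mult_left) (simp add: matrix_mul_assoc)

lemma inner_diag_mat: "diag_mat l \<bullet> B = (\<Sum>i\<in>UNIV. l i * kre ((B::'a::real_complex^'d^'d) $ i $ i))"
  by (simp add: inner_matrix_eq trace_def diag_mat_mult_left kre_sum)

text \<open>The weights |W i j|^2 depend on the two eigenbases only, not on f and g. A scalar
  inequality between functions of pairs of eigenvalues therefore passes to the corresponding
  traces.\<close>

lemma inner_unitary_diag:
  fixes U V :: "'a::real_complex^'d^'d"
  defines "W \<equiv> conj_transpose U ** V"
  shows "(U ** diag_mat f ** conj_transpose U) \<bullet> (V ** diag_mat g ** conj_transpose V)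
     = (\<Sum>i\<in>UNIV. \<Sum>j\<in>UNIV. (norm (W $ i $ j))\<^sup>2 * f i * g j)"
proof -
  have "conj_transpose U ** (V ** diag_mat g ** conj_transpose V) ** U
      = W ** diag_mat g ** conj_transpose W"
    by (simp only: W_def matrix_mul_assoc conj_transpose_mult conj_transpose_conj_transpose)
  moreover have "kre ((W ** diag_mat g ** conj_transpose W) $ i $ i)
      = (\<Sum>j\<in>UNIV. (norm (W $ i $ j))\<^sup>2 * g j)" for i
  proof -
    have "W $ i $ j * of_real (g j) * kconj (W $ i $ j) = of_real ((norm (W $ i $ j))\<^sup>2 * g j)" for j
      using kconj_mult_self[of "W $ i $ j"] by (simp add: mult_ac)
    then show ?thesis
      by (simp add: matrix_matrix_mult_def[of "W ** _"] diag_mat_mult_right kre_sum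
          del: of_real_mult of_real_power)
  qed
  ultimately show ?thesis
    by (simp add: inner_congruence inner_diag_mat sum_distrib_left mult_ac)
qed

text \<open>With t = sqrt (a / b) >= 1 the right side is (t - 1/t)^2 and the left side (2 ln t)^2,
  so the claim is 2 ln t <= t - 1/t. The difference vanishes at 1 and has derivative (1 - 1/s)^2 at
  s.\<close>

lemma ln_diff_le:
  assumes "a > 0" "b > (0::real)"
  shows "(ln a - ln b)\<^sup>2 \<le> a / b + b / a - 2"
proof -
  have *: "(ln a - ln b)\<^sup>2 \<le> a / b + b / a - 2" if "0 < b" "b \<le> a" for a b :: real
  proof -
    define t where "t = sqrt (a / b)"
    have t: "t \<ge> 1" "t\<^sup>2 = a / b" using that by (auto simp: t_def)
    have "2 * ln t \<le> t - 1 / t"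
    proof -
      have "(\<lambda>t. t - 1 / t - 2 * ln t) 1 \<le> (\<lambda>t. t - 1 / t - 2 * ln t) t"
      proof (rule DERIV_nonneg_imp_nondecreasing[OF t(1)])
        fix s :: real assume s: "1 \<le> s" "s \<le> t"
        show "\<exists>y. ((\<lambda>t. t - 1 / t - 2 * ln t) has_real_derivative y) (at s) \<and> y \<ge> 0"
        proof (intro exI conjI)
          show "((\<lambda>t. t - 1 / t - 2 * ln t) has_real_derivative ((1 - 1 / s)\<^sup>2)) (at s)"
            using s by (auto intro!: derivative_eq_intros simp: power2_eq_square field_simps)
        qed simp
      qed
      then show ?thesis by simp
    qed
    moreover have "2 * ln t = ln a - ln b"
      using that t by (simp add: t_def ln_sqrt ln_div)
    ultimately have "(ln a - ln b)\<^sup>2 \<le> (t - 1 / t)\<^sup>2"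
      using that by (intro power_mono) auto
    also have "\<dots> = t\<^sup>2 + 1 / t\<^sup>2 - 2"
      using t(1) by (simp add: power2_diff power_divide)
    finally show ?thesis by (simp add: t(2))
  qed
  show ?thesis
    using *[of a b] *[of b a] assms by (cases "a \<le> b") (auto simp: power2_commute)
qed

text \<open>In the eigenbases of x and y the left side is a weighted sum of the terms (ln (a i) - ln
  (b j))^2. The majorant of \<open>ln_diff_le\<close> turns it into tr (x y^(-1)) + tr (x^(-1) y) -
  2 d, which is invariant under congruence and can be evaluated in the coordinates of P.\<close>

lemma norm_mat_log_diff_le:
  fixes P :: "'a::real_complex^'d^'d"
    and \<alpha> \<beta> :: "'d \<Rightarrow> real"
  assumes QP: "Q ** P = mat 1" and \<alpha>: "\<forall>i. \<alpha> i > 0" and \<beta>: "\<forall>i. \<beta> i > 0"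
  shows "(norm (mat_log (P ** diag_mat \<alpha> ** conj_transpose P)
            - mat_log (P ** diag_mat \<beta> ** conj_transpose P)))\<^sup>2
     \<le> (\<Sum>i\<in>UNIV. \<alpha> i / \<beta> i + \<beta> i / \<alpha> i - 2)"
proof -
  define x y where "x = P ** diag_mat \<alpha> ** conj_transpose P" and "y = P ** diag_mat \<beta> ** conj_transpose P"
  \<comment> \<open>The inverses of x and y in the coordinates of P. Their form in the eigenbases
    follows from the uniqueness of right inverses.\<close>
  define x' y' where "x' = conj_transpose Q ** diag_mat (\<lambda>i. 1 / \<alpha> i) ** conj_transpose (conj_transpose Q)"
    and "y' = conj_transpose Q ** diag_mat (\<lambda>i. 1 / \<beta> i) ** conj_transpose (conj_transpose Q)"
  have [simp]: "\<alpha> i \<noteq> 0" "\<beta> i \<noteq> 0" for i using \<alpha> \<beta> by (metis less_irrefl)+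
  have inv: "P ** diag_mat f ** conj_transpose P
     ** (conj_transpose Q ** diag_mat (\<lambda>i. 1 / f i) ** conj_transpose (conj_transpose Q)) = mat 1"
    if "\<And>i. f i > 0" for f :: "'d \<Rightarrow> real"
  proof -
    have [simp]: "f i \<noteq> 0" for i using that[of i] by auto
    have "P ** diag_mat f ** conj_transpose P
     ** (conj_transpose Q ** diag_mat (\<lambda>i. 1 / f i) ** conj_transpose (conj_transpose Q))
     = P ** (diag_mat f ** (conj_transpose P ** conj_transpose Q) ** diag_mat (\<lambda>i. 1 / f i)) ** Q"
      by (simp only: matrix_mul_assoc conj_transpose_conj_transpose)
    also have "\<dots> = mat 1"
      by (simp add: inverse_conj_transpose[OF QP] diag_mat_mult diag_mat_1)
    finally show ?thesis .
  qed
  have pd: "x \<in> pos_def" "y \<in> pos_def"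
    using pos_def_congruence[OF _ QP] diag_mat_pos_def_iff \<alpha> \<beta> unfolding x_def y_def by blast+
  obtain U a where U: "unitary U" "\<And>i. a i > 0" "x = U ** diag_mat a ** conj_transpose U"
    using pos_def_spectral[OF pd(1)] by blast
  obtain V b where V: "unitary V" "\<And>i. b i > 0" "y = V ** diag_mat b ** conj_transpose V"
    using pos_def_spectral[OF pd(2)] by blast
  have [simp]: "a i \<noteq> 0" "b i \<noteq> 0" for i using U(2)[of i] V(2)[of i] by auto
  have uniq: "C = B" if "A ** B = mat 1" "A ** C = mat 1" for A B C :: "'a^'d^'d"
    using that by (metis matrix_left_right_inverse matrix_mul_assoc matrix_mul_lid matrix_mul_rid)
  have x': "x' = U ** diag_mat (\<lambda>i. 1 / a i) ** conj_transpose U"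
  proof (rule uniq[of x])
    show "x ** x' = mat 1" unfolding x_def x'_def using inv \<alpha> by simp
    show "x ** (U ** diag_mat (\<lambda>i. 1 / a i) ** conj_transpose U) = mat 1"
      unfolding U(3) by (simp add: unitary_diag_mult[OF U(1)] diag_mat_1 unitaryD[OF U(1)])
  qed
  have y': "y' = V ** diag_mat (\<lambda>i. 1 / b i) ** conj_transpose V"
  proof (rule uniq[of y])
    show "y ** y' = mat 1" unfolding y_def y'_def using inv \<beta> by simp
    show "y ** (V ** diag_mat (\<lambda>i. 1 / b i) ** conj_transpose V) = mat 1"
      unfolding V(3) by (simp add: unitary_diag_mult[OF V(1)] diag_mat_1 unitaryD[OF V(1)])
  qed
  define W where "W = conj_transpose U ** V"
  define w where "w i j = (norm (W $ i $ j))\<^sup>2" for i j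
  note I = inner_unitary_diag[of U _ V, folded W_def, folded w_def]
  have lx: "mat_log x = U ** diag_mat (\<lambda>i. ln (a i)) ** conj_transpose U"
    unfolding mat_log_def by (rule herm_fun_eqI[OF U(1,3)])
  have ly: "mat_log y = V ** diag_mat (\<lambda>i. ln (b i)) ** conj_transpose V"
    unfolding mat_log_def by (rule herm_fun_eqI[OF V(1,3)])
  have sq: "(norm (X ** diag_mat f ** conj_transpose X))\<^sup>2 = (X ** diag_mat (\<lambda>i. (f i)\<^sup>2) ** conj_transpose X) \<bullet> mat 1"
    if X: "unitary X" for X :: "'a^'d^'d" and f
  proof -
    have "(X ** diag_mat (\<lambda>i. (f i)\<^sup>2) ** conj_transpose X) \<bullet> mat 1
        = diag_mat (\<lambda>i. (f i)\<^sup>2) \<bullet> (mat 1 :: 'a^'d^'d)"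
      by (simp add: inner_congruence unitaryD[OF X])
    also have "\<dots> = (\<Sum>i\<in>UNIV. (f i)\<^sup>2)"
      by (simp add: inner_diag_mat mat_def kre_of_real[of 1, simplified])
    finally show ?thesis by (simp add: norm_unitary_conj[OF X] norm_diag_mat)
  qed
  have one: "mat 1 = U ** diag_mat (\<lambda>_. 1) ** conj_transpose U" "mat 1 = V ** diag_mat (\<lambda>_. 1) ** conj_transpose V"
    by (simp_all add: diag_mat_1 unitaryD[OF U(1)] unitaryD[OF V(1)])
  have nx: "(norm (mat_log x))\<^sup>2 = (\<Sum>i\<in>UNIV. \<Sum>j\<in>UNIV. w i j * (ln (a i))\<^sup>2)"
    unfolding lx sq[OF U(1)] unfolding one(2) I by simp
  have ny: "(norm (mat_log y))\<^sup>2 = (\<Sum>i\<in>UNIV. \<Sum>j\<in>UNIV. w i j * (ln (b j))\<^sup>2)"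
    unfolding ly sq[OF V(1)] by (subst inner_commute, unfold one(1) I) simp
  have dd: "real CARD('d) = (\<Sum>i\<in>UNIV. \<Sum>j\<in>UNIV. w i j)"
  proof -
    have "real CARD('d) = diag_mat (\<lambda>_. 1) \<bullet> (mat 1 :: 'a^'d^'d)"
      by (simp add: inner_diag_mat mat_def kre_of_real[of 1, simplified])
    also have "\<dots> = (U ** diag_mat (\<lambda>_. 1) ** conj_transpose U) \<bullet> (V ** diag_mat (\<lambda>_. 1) ** conj_transpose V)"
      unfolding one[symmetric] by (simp add: diag_mat_1)
    also have "\<dots> = (\<Sum>i\<in>UNIV. \<Sum>j\<in>UNIV. w i j)"
      unfolding I by simp
    finally show ?thesis .
  qed
  \<comment> \<open>P and Q cancel, so the pairing sees the diagonal parts only.\<close>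
  have cross: "(P ** diag_mat f ** conj_transpose P) \<bullet> (conj_transpose Q ** diag_mat g ** conj_transpose (conj_transpose Q))
      = (\<Sum>i\<in>UNIV. f i * g i)" for f g
  proof -
    have "conj_transpose P ** (conj_transpose Q ** diag_mat g ** conj_transpose (conj_transpose Q)) ** P
       = (conj_transpose P ** conj_transpose Q) ** diag_mat g ** (Q ** P)"
      by (simp only: matrix_mul_assoc conj_transpose_conj_transpose)
    also have "\<dots> = diag_mat g"
      by (simp add: inverse_conj_transpose[OF QP] QP)
    finally show ?thesis
      unfolding inner_congruence by (simp add: inner_diag_mat) (simp add: diag_mat_def)
  qed
  have "(norm (mat_log x - mat_log y))\<^sup>2 = (norm (mat_log x))\<^sup>2 - 2 * (mat_log x \<bullet> mat_log y) + (norm (mat_log y))\<^sup>2"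
    by (simp add: power2_norm_eq_inner inner_diff_left inner_diff_right inner_commute)
  also have "\<dots> = (\<Sum>i\<in>UNIV. \<Sum>j\<in>UNIV. w i j * (ln (a i) - ln (b j))\<^sup>2)"
    unfolding nx ny unfolding lx ly I
    by (simp add: sum_distrib_left power2_diff algebra_simps flip: sum_subtractf sum.distrib)
  also have "\<dots> \<le> (\<Sum>i\<in>UNIV. \<Sum>j\<in>UNIV. w i j * (a i / b j + b j / a i - 2))"
    by (intro sum_mono mult_left_mono ln_diff_le U V) (simp add: w_def)
  also have "\<dots> = x \<bullet> y' + x' \<bullet> y - 2 * real CARD('d)"
    unfolding dd x' y' unfolding U(3) V(3) I
    by (simp add: sum_distrib_left algebra_simps flip: sum_subtractf sum.distrib)
  also have "x \<bullet> y' = (\<Sum>i\<in>UNIV. \<alpha> i / \<beta> i)"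
    unfolding x_def y'_def cross by simp
  also have "x' \<bullet> y = (\<Sum>i\<in>UNIV. \<beta> i / \<alpha> i)"
    unfolding y_def x'_def by (subst inner_commute, unfold cross) simp
  finally show ?thesis
    by (simp add: x_def y_def sum.distrib sum_subtractf)
qed

text \<open>Apply the previous bound between \<open>N\<close> equidistant points of the geodesic and let \<open>N\<close> tend to
  infinity.\<close>

lemma norm_mat_log_diff_le_dist:
  fixes P :: "'a::real_complex^'d^'d"
    and l :: "'d \<Rightarrow> real"
  assumes QP: "Q ** P = mat 1" and l: "\<forall>i. l i > 0"
  shows "(norm (mat_log (P ** conj_transpose P) - mat_log (P ** diag_mat l ** conj_transpose P)))\<^sup>2
     \<le> (\<Sum>i\<in>UNIV. (ln (l i))\<^sup>2)"
proof -
  \<comment> \<open>\<open>\<gamma> N k\<close> is the logarithm of the geodesic point at parameter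
    k / N. Consecutive points have eigenvalue ratios exp (ln (l i) / N), whence the bound
    \<open>s N\<close> for the square of one step.\<close>
  define \<gamma> where "\<gamma> N k = mat_log (P ** diag_mat (\<lambda>i. exp (real k / real N * ln (l i))) ** conj_transpose P)" for N k
  define s where "s N = (\<Sum>i\<in>UNIV. exp (ln (l i) / real N) + exp (- ln (l i) / real N) - 2)" for N
  have step: "norm (\<gamma> N k - \<gamma> N (Suc k)) \<le> sqrt (s N)" if "N > 0" for N k
  proof -
    have "(norm (\<gamma> N k - \<gamma> N (Suc k)))\<^sup>2 \<le> s N"
      unfolding \<gamma>_def s_def
      by (rule order_trans[OF norm_mat_log_diff_le[OF QP]])
         (use that in \<open>auto intro!: sum_mono simp: field_simps simp flip: exp_diff\<close>)
    then show ?thesis by (simp add: real_le_rsqrt)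
  qed
  have "norm (\<gamma> N 0 - \<gamma> N k) \<le> real k * sqrt (s N)" if "N > 0" for N k
  proof (induction k)
    case (Suc k)
    have "norm (\<gamma> N 0 - \<gamma> N (Suc k)) \<le> norm (\<gamma> N 0 - \<gamma> N k) + norm (\<gamma> N k - \<gamma> N (Suc k))"
      by (rule norm_diff_triangle_ineq[of _ "\<gamma> N k", simplified] norm_triangle_le_diff
          order_trans[OF _ norm_triangle_ineq]) simp
    then show ?case using Suc step[OF that, of k] by (simp add: algebra_simps)
  qed simp
  then have *: "norm (\<gamma> N 0 - \<gamma> N N) \<le> real N * sqrt (s N)" if "N > 0" for N
    using that by blast
  have s0: "s N \<ge> 0" if "N > 0" for N
    using order_trans[OF norm_ge_zero step[OF that, of 0]] by simp
  have bound: "(norm (mat_log (P ** conj_transpose P) - mat_log (P ** diag_mat l ** conj_transpose P)))\<^sup>2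
     \<le> (real N)\<^sup>2 * s N" if N: "N > 0" for N
  proof -
    have "\<gamma> N 0 = mat_log (P ** conj_transpose P)"
      by (simp add: \<gamma>_def diag_mat_1)
    moreover have "\<gamma> N N = mat_log (P ** diag_mat l ** conj_transpose P)"
      using N l by (simp add: \<gamma>_def)
    ultimately have "(norm (mat_log (P ** conj_transpose P) - mat_log (P ** diag_mat l ** conj_transpose P)))\<^sup>2
       \<le> (real N * sqrt (s N))\<^sup>2"
      using *[OF N] by (intro power_mono) auto
    also have "\<dots> = (real N)\<^sup>2 * s N"
      using s0[OF N] by (simp add: power_mult_distrib)
    finally show ?thesis .
  qed
  \<comment> \<open>N steps of length at most sqrt (s N) give N^2 (s N) after squaring, and exp v +
    exp (- v) - 2 behaves like v^2 for v = u / N.\<close>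
  have lim1: "(\<lambda>N::nat. (real N)\<^sup>2 * (exp (u / real N) + exp (- u / real N) - 2)) \<longlonglongrightarrow> u\<^sup>2" for u
  proof (cases "u = 0")
    case False
    then show ?thesis by real_asymp (simp add: power2_eq_square)
  qed simp
  have "(\<lambda>N. (real N)\<^sup>2 * s N) \<longlonglongrightarrow> (\<Sum>i\<in>UNIV. (ln (l i))\<^sup>2)"
    unfolding s_def sum_distrib_left by (intro tendsto_sum lim1)
  then show ?thesis
    by (rule LIMSEQ_le_const) (use bound in \<open>auto intro!: exI[of _ 1]\<close>)
qed

lemma norm_mat_log_diff_le_affine_dist:
  fixes x y :: "'a::real_complex^'d^'d"
  assumes "x \<in> pos_def" "y \<in> pos_def"
  shows "k\<^sup>2 * (norm (mat_log x - mat_log y))\<^sup>2 \<le> (affine_dist k x y)\<^sup>2"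
proof -
  obtain P Q and l :: "'d \<Rightarrow> real" where P: "Q ** P = mat 1" "P ** Q = mat 1" "x = P ** conj_transpose P"
    "y = P ** diag_mat l ** conj_transpose P" "\<forall>i. l i > 0"
    by (rule simultaneous_diag[OF assms])
  have "(affine_dist k x y)\<^sup>2 = k\<^sup>2 * (\<Sum>i\<in>UNIV. (ln (l i))\<^sup>2)"
    unfolding P(3,4) affine_dist_eq[OF P(1,5)] by (simp add: power_mult_distrib sum_nonneg)
  then show ?thesis
    using norm_mat_log_diff_le_dist[OF P(1,5)] unfolding P(3,4) by (simp add: mult_left_mono)
qed

text \<open>\<open>norm_mat_log_diff_le\<close> with \<beta> = 1 controls the logarithm near x by
  the eigenvalues l of R y R: l + 1/l - 2 = (l - 1)^2 / l <= 2 (l - 1)^2 once l >= 1/2, and the sum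
  of the (l - 1)^2 is the square of \<open>\<delta> y\<close>.\<close>

lemma continuous_on_mat_log: "continuous_on pos_def (mat_log :: 'a::real_complex^'d^'d \<Rightarrow> _)"
  unfolding continuous_on_def
proof
  fix x :: "'a^'d^'d" assume x: "x \<in> pos_def"
  define R where "R = mat_inv_sqrt x"
  define \<delta> where "\<delta> y = norm (R ** y ** R - mat 1)" for y
  obtain S where S: "hermitian R" "hermitian S" "R ** S = mat 1" "S ** R = mat 1" "S ** S = x"
    using mat_inv_sqrt_pos_def[OF x] unfolding R_def by metis
  have "R ** x ** R = (R ** S) ** (S ** R)"
    unfolding S(5)[symmetric] by (simp only: matrix_mul_assoc)
  then have "\<delta> x = 0" by (simp add: \<delta>_def S)
  moreover have "continuous_on UNIV \<delta>"
    unfolding \<delta>_def by (intro continuous_intros)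
  ultimately have \<delta>: "(\<delta> \<longlongrightarrow> 0) (at x within pos_def)"
    by (metis UNIV_I continuous_on_def tendsto_within_subset subset_UNIV)
  then have ev: "eventually (\<lambda>y. \<delta> y < 1 / 2) (at x within pos_def)"
    by (rule order_tendstoD) simp
  have bound: "norm (mat_log y - mat_log x) \<le> 2 * \<delta> y" if y: "y \<in> pos_def" and s: "\<delta> y < 1 / 2" for y
  proof -
    obtain P Q V and l :: "'d \<Rightarrow> real" where P: "Q ** P = mat 1" "P ** Q = mat 1" "x = P ** conj_transpose P"
      "y = P ** diag_mat l ** conj_transpose P" "\<forall>i. l i > 0" "unitary V"
      "mat_inv_sqrt x ** y ** mat_inv_sqrt x = V ** diag_mat l ** conj_transpose V"
      by (rule simultaneous_diag_root[OF x y])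
    have "R ** y ** R - mat 1 = V ** diag_mat (\<lambda>i. l i - 1) ** conj_transpose V"
    proof -
      have "diag_mat (\<lambda>i. l i - 1) = (diag_mat l - mat 1 :: 'a^'d^'d)"
        by (simp add: vec_eq_iff diag_mat_def mat_def)
      then show ?thesis
        unfolding R_def P(7)
        by (simp add: bounded_bilinear.diff_left[OF bounded_bilinear_matrix_mult]
            bounded_bilinear.diff_right[OF bounded_bilinear_matrix_mult] unitaryD[OF P(6)])
    qed
    then have \<delta>2: "(\<delta> y)\<^sup>2 = (\<Sum>i\<in>UNIV. (l i - 1)\<^sup>2)"
      by (simp add: \<delta>_def norm_unitary_conj[OF P(6)] norm_diag_mat)
    have l: "l i \<ge> 1 / 2" for i
    proof -
      have "(l i - 1)\<^sup>2 \<le> (\<delta> y)\<^sup>2"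
        unfolding \<delta>2 by (rule member_le_sum) auto
      then have "\<bar>l i - 1\<bar> \<le> \<delta> y"
        using abs_le_square_iff[of "l i - 1" "\<delta> y"] by (simp add: \<delta>_def)
      then show ?thesis using s by linarith
    qed
    have "(norm (mat_log y - mat_log x))\<^sup>2 \<le> (\<Sum>i\<in>UNIV. l i / 1 + 1 / l i - 2)"
      using norm_mat_log_diff_le[OF P(1), of l "\<lambda>_. 1"] P(5) unfolding P(3,4) by (simp add: diag_mat_1)
    also have "\<dots> \<le> (\<Sum>i\<in>UNIV. 2 * (l i - 1)\<^sup>2)"
    proof (rule sum_mono)
      fix i
      have "l i / 1 + 1 / l i - 2 = (l i - 1)\<^sup>2 / l i"
        using P(5)[rule_format, of i] by (simp add: field_simps power2_eq_square)
      also have "\<dots> \<le> (l i - 1)\<^sup>2 / (1 / 2)"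
        using l[of i] by (intro divide_left_mono) auto
      finally show "l i / 1 + 1 / l i - 2 \<le> 2 * (l i - 1)\<^sup>2" by simp
    qed
    also have "\<dots> \<le> (2 * \<delta> y)\<^sup>2"
      by (simp add: \<delta>2 power_mult_distrib sum_distrib_left[symmetric] sum_nonneg)
    finally show ?thesis
      by (rule power2_le_imp_le) (simp add: \<delta>_def)
  qed
  have "((\<lambda>y. mat_log y - mat_log x) \<longlongrightarrow> 0) (at x within pos_def)"
  proof (rule Lim_null_comparison)
    show "eventually (\<lambda>y. norm (mat_log y - mat_log x) \<le> 2 * \<delta> y) (at x within pos_def)"
      using ev bound by (auto simp: eventually_at_filter elim!: eventually_mono)
    show "((\<lambda>y. 2 * \<delta> y) \<longlongrightarrow> 0) (at x within pos_def)"
      using tendsto_mult_right_zero[OF \<delta>, of 2] by simp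
  qed
  then show "(mat_log \<longlongrightarrow> mat_log x) (at x within pos_def)"
    by (simp add: LIM_zero_cancel)
qed

subsection \<open>Determinants and the normalisation\<close>

lemma det_unitary_diag:
  assumes U: "unitary (U::'a::real_complex^'d^'d)"
  shows "det (U ** diag_mat l ** conj_transpose U) = of_real (\<Prod>i\<in>UNIV. l i)"
proof -
  have "det U * det (conj_transpose U) = 1"
    by (simp add: unitaryD[OF U] flip: det_mul)
  moreover have "det (U ** diag_mat l ** conj_transpose U)
      = of_real (\<Prod>i\<in>UNIV. l i) * (det U * det (conj_transpose U))"
    by (simp add: det_mul det_diag_mat mult_ac)
  ultimately show ?thesis by simp
qed

lemma det_pos_def:
  fixes A :: "'a::real_complex^'d^'d"
  assumes "A \<in> pos_def"
  shows "det A = of_real (kre (det A))" "kre (det A) > 0"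
proof -
  obtain U l where U: "unitary U" "\<And>i. l i > 0" "A = U ** diag_mat l ** conj_transpose U"
    using pos_def_spectral[OF assms] by blast
  have *: "det A = of_real (\<Prod>i\<in>UNIV. l i)"
    unfolding U(3) det_unitary_diag[OF U(1)] ..
  show "det A = of_real (kre (det A))"
    unfolding * kre_of_real ..
  show "kre (det A) > 0"
    unfolding * kre_of_real using U(2) by (simp add: prod_pos)
qed

lemma det_congruence:
  "det (g ** A ** conj_transpose g) = of_real ((norm (det g))\<^sup>2) * det (A::'a::real_complex^'d^'d)"
proof -
  have "det (g ** A ** conj_transpose g) = (kconj (det g) * det g) * det A"
    by (simp add: det_mul det_conj_transpose mult_ac)
  then show ?thesis unfolding kconj_mult_self .
qed

lemma scaleR_eq_diag_mat_mult: "r *\<^sub>R A = diag_mat (\<lambda>_. r) ** (A::'a::real_complex^'d^'d)"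
  by (simp add: vec_eq_iff diag_mat_mult_left of_real_def)

lemma det_scaleR: "det (r *\<^sub>R A) = of_real (r ^ CARD('d)) * det (A::'a::real_complex^'d^'d)"
  unfolding scaleR_eq_diag_mat_mult det_mul det_diag_mat by simp

lemma pos_def_scaleR: "r > 0 \<Longrightarrow> A \<in> pos_def \<Longrightarrow> r *\<^sub>R A \<in> (pos_def :: ('a::real_complex^'d^'d) set)"
  by (simp add: pos_def_def hermitian_def conj_transpose_scaleR scaleR_matrix_vector_mult)

lemma proj_det_unit_det:
  fixes A :: "'a::real_complex^'d^'d"
  assumes A: "A \<in> pos_def"
  shows "proj_det A \<in> unit_det"
proof -
  define D where "D = kre (det A)"
  have D: "D > 0" "det A = of_real D" using det_pos_def[OF A] by (auto simp: D_def)
  have "(D powr (- 1 / real CARD('d))) ^ CARD('d) = D powr (- 1)"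
    using D by (simp add: powr_powr flip: powr_realpow)
  then have "det (proj_det A) = of_real (D powr (- 1)) * of_real D"
    unfolding proj_det_def det_scaleR D_def[symmetric] by (simp add: D(2))
  also have "\<dots> = of_real (D powr (- 1) * D)" by simp
  also have "D powr (- 1) * D = 1" using D by (simp add: powr_minus_divide)
  finally show ?thesis
    using A D by (auto simp: unit_det_def proj_det_def D_def[symmetric] intro!: pos_def_scaleR)
qed

lemma proj_det_congruence:
  fixes A g :: "'a::real_complex^'d^'d"
  assumes "norm (det g) = 1"
  shows "proj_det (g ** A ** conj_transpose g) = g ** proj_det A ** conj_transpose g"
  by (simp add: proj_det_def det_congruence assms matrix_mult_scaleR_left matrix_mult_scaleR_right)

lemma unit_det_congruence:
  fixes A g :: "'a::real_complex^'d^'d"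
  assumes A: "A \<in> unit_det" and "h ** g = mat 1" and "norm (det g) = 1"
  shows "g ** A ** conj_transpose g \<in> unit_det"
  using assms pos_def_congruence[OF _ assms(2), of A] by (simp add: unit_det_def det_congruence)

lemma norm_det_unitary:
  assumes U: "unitary (U::'a::real_complex^'d^'d)"
  shows "norm (det U) = 1"
proof -
  have "of_real ((norm (det U))\<^sup>2) = (1 :: 'a)"
    using det_congruence[of U "mat 1"] by (simp add: unitaryD[OF U])
  then have "(norm (det U))\<^sup>2 = 1"
    by (metis of_real_eq_1_iff)
  then show ?thesis by (simp add: power2_eq_1_iff) (smt norm_ge_zero)
qed

lemma mat_log_unitary_diag:
  "unitary U \<Longrightarrow> mat_log (U ** diag_mat l ** conj_transpose U)
     = U ** diag_mat (\<lambda>i. ln (l i)) ** conj_transpose U"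
  unfolding mat_log_def by (rule herm_fun_eqI) auto

lemma mat_log_unitary_conj:
  fixes x :: "'a::real_complex^'d^'d"
  assumes x: "x \<in> pos_def" and V: "unitary V"
  shows "mat_log (V ** x ** conj_transpose V) = V ** mat_log x ** conj_transpose V"
proof -
  obtain U l where U: "unitary U" "\<And>i. l i > 0" "x = U ** diag_mat l ** conj_transpose U"
    using pos_def_spectral[OF x] by blast
  have *: "V ** (U ** D ** conj_transpose U) ** conj_transpose V = (V ** U) ** D ** conj_transpose (V ** U)" for D
    by (simp only: conj_transpose_mult matrix_mul_assoc)
  show ?thesis
    unfolding U(3) * mat_log_unitary_diag[OF U(1)] mat_log_unitary_diag[OF unitary_mult[OF V U(1)]] ..
qed

text \<open>The logarithms of the eigenvalues sum to ln 1 = 0. Tracelessness is stated through a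
  diagonalisation because \<open>unitary_invariant_inner_traceless\<close> uses it in this
  form.\<close>

lemma mat_log_unit_det:
  fixes x :: "'a::real_complex^'d^'d"
  assumes x: "x \<in> unit_det"
  obtains U l where "unitary U" "mat_log x = U ** diag_mat l ** conj_transpose U" "(\<Sum>i\<in>UNIV. l i) = 0"
proof -
  obtain U l where U: "unitary U" "\<And>i. l i > 0" "x = U ** diag_mat l ** conj_transpose U"
    using pos_def_spectral x unfolding unit_det_def by blast
  have l0: "l i \<noteq> 0" for i using U(2)[of i] by simp
  have "of_real (\<Prod>i\<in>UNIV. l i) = (1 :: 'a)"
    using x det_unitary_diag[OF U(1), of l] by (simp add: unit_det_def U(3))
  then have "(\<Prod>i\<in>UNIV. l i) = 1"
    by (metis of_real_eq_1_iff)
  moreover have "ln (\<Prod>i\<in>UNIV. l i) = (\<Sum>i\<in>UNIV. ln (l i))"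
    using l0 by (intro ln_prod) auto
  ultimately have "(\<Sum>i\<in>UNIV. ln (l i)) = 0" by simp
  with that[OF U(1), of "\<lambda>i. ln (l i)"] show ?thesis
    unfolding U(3) mat_log_unitary_diag[OF U(1)] by blast
qed

lemma mat_log_eq_0:
  fixes x :: "'a::real_complex^'d^'d"
  assumes x: "x \<in> pos_def" and "mat_log x = 0"
  shows "x = mat 1"
proof -
  obtain U l where U: "unitary U" "\<And>i. l i > 0" "x = U ** diag_mat l ** conj_transpose U"
    using pos_def_spectral[OF x] by blast
  have "(norm (mat_log x))\<^sup>2 = (\<Sum>i\<in>UNIV. (ln (l i))\<^sup>2)"
    unfolding U(3) mat_log_unitary_diag[OF U(1)] norm_unitary_conj[OF U(1)] norm_diag_mat ..
  then have "\<forall>i. ln (l i) = 0"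
    using assms(2) by (simp add: sum_nonneg_eq_0_iff)
  then have "l = (\<lambda>_. 1)"
    using U(2) by (auto intro!: ext)
  then show ?thesis
    by (simp add: U(3) diag_mat_1 unitaryD[OF U(1)])
qed

text \<open>Each ln (l i) is at most the trace t, and together they sum to ln D, so each is also at
  least ln D - (d - 1) t. Thus all are bounded by B = m + d t, where only the negative part m of ln
  D enters. Normalising subtracts ln D / d, again at most B in modulus; then (2 B)^2 <= 8 (m^2 + (d
  t)^2), once for each of the d eigenvalues.\<close>

lemma norm_mat_log_proj_det_le:
  fixes x :: "'a::real_complex^'d^'d"
  assumes x: "x \<in> pos_def"
  shows "(norm (mat_log (proj_det x)))\<^sup>2
    \<le> 8 * real CARD('d) * ((max 0 (- ln (kre (det x))))\<^sup>2 + (real CARD('d) * kre (trace x))\<^sup>2)"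
proof -
  obtain U l where U: "unitary U" "\<And>i. l i > 0" "x = U ** diag_mat l ** conj_transpose U"
    using pos_def_spectral[OF x] by blast
  define D where "D = (\<Prod>i\<in>UNIV. l i)"
  define t where "t = (\<Sum>i\<in>UNIV. l i)"
  define m where "m = max 0 (- ln D)"
  define B where "B = m + real CARD('d) * t"
  have l0: "l i \<noteq> 0" for i using U(2)[of i] by simp
  have detx: "kre (det x) = D"
    unfolding U(3) det_unitary_diag[OF U(1)] D_def by (rule kre_of_real)
  have "trace (U ** (diag_mat l ** conj_transpose U)) = trace ((diag_mat l ** conj_transpose U) ** U)"
    by (rule trace_mul_sym)
  also have "\<dots> = of_real t"
    by (simp add: unitaryD[OF U(1)] trace_diag_mat t_def flip: matrix_mul_assoc)
  finally have tr: "kre (trace x) = t"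
    by (simp add: U(3) matrix_mul_assoc)
  have D0: "D > 0" using U(2) by (simp add: D_def prod_pos)
  have t0: "t \<ge> 0" using U(2) by (simp add: t_def sum_nonneg less_imp_le)
  have m0: "m \<ge> 0" by (simp add: m_def)
  define r where "r = D powr (- 1 / real CARD('d))"
  have r0: "r > 0" using D0 by (simp add: r_def)
  have lnD: "ln D = (\<Sum>i\<in>UNIV. ln (l i))"
    unfolding D_def using l0 by (intro ln_prod) auto
  have up: "ln (l i) \<le> t" for i
  proof -
    have "ln (l i) \<le> l i" using ln_le_minus_one[OF U(2)[of i]] by simp
    also have "\<dots> \<le> t" unfolding t_def using U(2) by (intro member_le_sum) (auto simp: less_imp_le)
    finally show ?thesis .
  qed
  have d1: "real CARD('d) \<ge> 1" by (simp add: Suc_leI)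
  have abs_ln: "\<bar>ln (l i)\<bar> \<le> B" for i
  proof -
    have "ln D = ln (l i) + (\<Sum>j\<in>UNIV - {i}. ln (l j))"
      unfolding lnD by (rule sum.remove) auto
    moreover have "(\<Sum>j\<in>UNIV - {i}. ln (l j)) \<le> (\<Sum>j\<in>UNIV - {i}. t)"
      using up by (intro sum_mono) auto
    moreover have "(\<Sum>j\<in>UNIV - {i}. t) \<le> (\<Sum>j\<in>(UNIV::'d set). t)"
      using t0 by (intro sum_mono2) auto
    moreover have "(\<Sum>j\<in>(UNIV::'d set). t) = real CARD('d) * t" by simp
    ultimately have "- ln (l i) \<le> B" by (auto simp: B_def m_def)
    moreover have "t \<le> real CARD('d) * t" using d1 t0 by (simp add: mult_le_cancel_right1)
    then have "ln (l i) \<le> B" using up[of i] m0 by (simp add: B_def)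
    ultimately show ?thesis by linarith
  qed
  have "\<bar>ln D\<bar> \<le> (\<Sum>i\<in>(UNIV::'d set). B)"
    unfolding lnD by (rule order_trans[OF sum_abs]) (intro sum_mono abs_ln)
  then have lnD': "\<bar>ln D\<bar> / real CARD('d) \<le> B"
    by (simp add: divide_le_eq mult.commute)
  have lr: "(ln (r * l i))\<^sup>2 \<le> 8 * (m\<^sup>2 + (real CARD('d) * t)\<^sup>2)" for i
  proof -
    have "ln (r * l i) = ln (l i) - ln D / real CARD('d)"
      using r0 D0 U(2)[of i] by (simp add: ln_mult r_def ln_powr)
    then have "\<bar>ln (r * l i)\<bar> \<le> \<bar>ln (l i)\<bar> + \<bar>ln D\<bar> / real CARD('d)"
      by (simp add: order_trans[OF abs_triangle_ineq4])
    also have "\<dots> \<le> 2 * B" using abs_ln[of i] lnD' by linarith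
    finally have "\<bar>ln (r * l i)\<bar>\<^sup>2 \<le> (2 * B)\<^sup>2" by (rule power_mono) simp
    also have "\<dots> \<le> 8 * (m\<^sup>2 + (real CARD('d) * t)\<^sup>2)"
    proof -
      have "8 * (m\<^sup>2 + u\<^sup>2) - (2 * (m + u))\<^sup>2 = 4 * (m - u)\<^sup>2" for u
        by (simp add: power2_eq_square algebra_simps)
      then show ?thesis
        unfolding B_def by (metis diff_ge_0_iff_ge mult_nonneg_nonneg zero_le_numeral zero_le_power2)
    qed
    finally show ?thesis by simp
  qed
  have "r *\<^sub>R x = U ** diag_mat (\<lambda>i. r * l i) ** conj_transpose U"
    unfolding U(3) by (simp add: matrix_mult_scaleR_left matrix_mult_scaleR_right flip: diag_mat_scaleR)
  then have "proj_det x = U ** diag_mat (\<lambda>i. r * l i) ** conj_transpose U"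
    by (simp add: proj_det_def detx r_def)
  then have "(norm (mat_log (proj_det x)))\<^sup>2 = (\<Sum>i\<in>UNIV. (ln (r * l i))\<^sup>2)"
    by (simp add: mat_log_unitary_diag[OF U(1)] norm_unitary_conj[OF U(1)] norm_diag_mat)
  also have "\<dots> \<le> (\<Sum>i\<in>(UNIV::'d set). 8 * (m\<^sup>2 + (real CARD('d) * t)\<^sup>2))"
    by (intro sum_mono lr)
  finally show ?thesis by (simp add: detx tr m_def algebra_simps)
qed

text \<open>Diagonalise both forms by one P. The vector v that the conjugate transpose of P sends to
  the i-th unit vector takes the values 1 on z and l i on x, so l i >= 1; the determinants differ by
  the product of the l i.\<close>

lemma kre_det_mono:
  fixes z x :: "'a::real_complex^'d^'d"
  assumes z: "z \<in> pos_def" and x: "x \<in> pos_def" and le: "\<And>v. v \<bullet> (z *v v) \<le> v \<bullet> (x *v v)"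
  shows "kre (det z) \<le> kre (det x)"
proof -
  obtain P Q and l :: "'d \<Rightarrow> real" where P: "Q ** P = mat 1" "P ** Q = mat 1" "z = P ** conj_transpose P"
    "x = P ** diag_mat l ** conj_transpose P" "\<forall>i. l i > 0"
    by (rule simultaneous_diag[OF z x])
  have "l i \<ge> 1" for i
  proof -
    define v where "v = conj_transpose Q *v axis i (1::'a)"
    have Pv: "conj_transpose P *v v = axis i 1"
      unfolding v_def by (simp add: matrix_vector_mul_assoc inverse_conj_transpose[OF P(1)])
    have *: "v \<bullet> ((P ** diag_mat k ** conj_transpose P) *v v) = k i" for k
    proof -
      have "v \<bullet> ((P ** diag_mat k ** conj_transpose P) *v v)
          = (conj_transpose P *v v) \<bullet> (diag_mat k *v (conj_transpose P *v v))"
        by (simp only: matrix_vector_mul_assoc[symmetric] inner_matrix_vector_mult[of v P])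
      also have "\<dots> = k i"
      proof -
        have "(diag_mat k *v axis i 1 :: 'a^'d) = k i *\<^sub>R axis i 1"
          by (simp add: vec_eq_iff diag_mat_vector_mult axis_def)
        then show ?thesis unfolding Pv by (simp add: inner_axis_axis inner_one_one)
      qed
      finally show ?thesis .
    qed
    show ?thesis
      using le[of v] *[of "\<lambda>_. 1"] *[of l] by (simp add: P(3,4) diag_mat_1)
  qed
  then have "(\<Prod>i\<in>UNIV. l i) \<ge> 1" by (intro prod_ge_1) auto
  moreover have "kre (det z) = (norm (det P))\<^sup>2"
    using det_congruence[of P "mat 1"] kre_of_real[where 'a='a] by (simp add: P(3) del: of_real_power)
  moreover have "kre (det x) = (norm (det P))\<^sup>2 * (\<Prod>i\<in>UNIV. l i)"
    unfolding P(4) det_congruence det_diag_mat by (simp only: kre_of_real_mult kre_of_real)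
  ultimately show ?thesis by (simp add: mult_le_cancel_left1)
qed

subsection \<open>Sums of outer products\<close>

lemma inner_outer: "v \<bullet> (outer y *v v) = (norm (cdot y v))\<^sup>2"
proof -
  have "(outer y *v v) $ i = y $ i * cdot y v" for i
    by (simp add: outer_def matrix_vector_mult_def cdot_def sum_distrib_left mult_ac)
  then have "v \<bullet> (outer y *v v) = kre (\<Sum>i\<in>UNIV. kconj (v $ i) * (y $ i * cdot y v))"
    by (simp add: inner_vec_def inner_eq_kre kre_sum)
  also have "(\<Sum>i\<in>UNIV. kconj (v $ i) * (y $ i * cdot y v)) = kconj (cdot y v) * cdot y v"
    by (simp add: cdot_commute[of v y, symmetric] cdot_def[of v] sum_distrib_left mult_ac)
  finally show ?thesis
    unfolding kconj_mult_self kre_of_real .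
qed

lemma conj_transpose_outer: "conj_transpose (outer y) = outer y"
  by (simp add: vec_eq_iff outer_def kconj_mult kconj_kconj mult.commute)

lemma conj_transpose_sum: "conj_transpose (sum f A) = (\<Sum>i\<in>A. conj_transpose (f i))"
  by (simp add: vec_eq_iff kconj_sum)

lemma sum_matrix_vector_mult: "sum f A *v v = (\<Sum>i\<in>A. f i *v (v::'a::real_complex^'d))"
proof (induction A rule: infinite_finite_induct)
  case (insert a A)
  then show ?case by (simp add: matrix_vector_mult_add_rdistrib)
qed (simp_all add: vec_eq_iff matrix_vector_mult_def)

lemma outer_matrix_vector_mult:
  "outer (T *v y) = T ** outer y ** conj_transpose (T::'a::real_complex^'d^'d)"
proof -
  have "(T ** outer y) $ i $ k = (T *v y) $ i * kconj (y $ k)" for i k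
    by (simp add: matrix_matrix_mult_def matrix_vector_mult_def outer_def sum_distrib_right mult.assoc)
  then show ?thesis
    by (simp add: vec_eq_iff matrix_matrix_mult_def[of "T ** outer y"])
       (simp add: outer_def matrix_vector_mult_def kconj_sum kconj_mult sum_distrib_left mult_ac)
qed

lemma continuous_on_outer [continuous_intros]:
  "continuous_on S f \<Longrightarrow> continuous_on S (\<lambda>x. outer (f x :: 'a::real_complex^'d))"
  unfolding outer_def
  by (intro continuous_on_vec_lambda continuous_on_mult continuous_on_component
      bounded_linear.continuous_on[OF bounded_linear_kconj])

lemma kre_trace_outer: "kre (trace (outer y)) = (norm y)\<^sup>2"
proof -
  have "kre (trace (outer y)) = (\<Sum>i\<in>UNIV. kre (kconj (y $ i) * y $ i))"
    by (simp add: trace_def outer_def kre_sum mult.commute)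
  also have "\<dots> = (norm y)\<^sup>2"
    unfolding kconj_mult_self kre_of_real by (simp add: norm_vec_def L2_set_def sum_nonneg)
  finally show ?thesis .
qed

definition gram :: "nat \<Rightarrow> (nat \<Rightarrow> 'a::real_complex^'d) \<Rightarrow> 'a^'d^'d" where
  "gram n Y = (\<Sum>i<n. outer (Y i))"

definition columns_mat :: "('d \<Rightarrow> nat) \<Rightarrow> (nat \<Rightarrow> 'a::real_complex^'d) \<Rightarrow> 'a^'d^'d" where
  "columns_mat f Y = (\<chi> i j. Y (f j) $ i)"

lemma hermitian_gram: "hermitian (gram n Y)"
  by (simp add: hermitian_def gram_def conj_transpose_sum conj_transpose_outer)

lemma inner_gram: "v \<bullet> (gram n Y *v v) = (\<Sum>i<n. (norm (cdot (Y i) v))\<^sup>2)"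
  by (simp add: gram_def sum_matrix_vector_mult inner_sum_right inner_outer)

lemma gram_congruence:
  "gram n (\<lambda>i. T *v Y i) = T ** gram n Y ** conj_transpose (T::'a::real_complex^'d^'d)"
  unfolding gram_def outer_matrix_vector_mult
  by (simp add: bounded_bilinear.sum_left[OF bounded_bilinear_matrix_mult]
      bounded_bilinear.sum_right[OF bounded_bilinear_matrix_mult])

lemma kre_trace_gram: "kre (trace (gram n Y)) = (\<Sum>i<n. (norm (Y i))\<^sup>2)"
proof -
  have "trace (gram n Y) = (\<Sum>i<n. trace (outer (Y i)))"
    unfolding gram_def by (induction n) (auto simp: trace_add trace_0[unfolded mat_0] )
  then show ?thesis by (simp add: kre_sum kre_trace_outer)
qed

lemma gram_ge_columns_mat:
  fixes Y :: "nat \<Rightarrow> 'a::real_complex^'d"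
  assumes f: "inj f" "range f \<subseteq> {..<n}"
  shows "v \<bullet> ((columns_mat f Y ** conj_transpose (columns_mat f Y)) *v v) \<le> v \<bullet> (gram n Y *v v)"
proof -
  define M where "M = columns_mat f Y"
  have "v \<bullet> ((M ** conj_transpose M) *v v) = (conj_transpose M *v v) \<bullet> (conj_transpose M *v v)"
    by (simp only: matrix_vector_mul_assoc[symmetric] inner_matrix_vector_mult[of v M])
  also have "\<dots> = (\<Sum>j\<in>UNIV. (norm (cdot (Y (f j)) v))\<^sup>2)"
    by (simp add: inner_vec_def matrix_vector_mult_def M_def columns_mat_def cdot_def power2_norm_eq_inner)
  also have "\<dots> = (\<Sum>i\<in>range f. (norm (cdot (Y i) v))\<^sup>2)"
    using f by (subst sum.reindex) auto
  also have "\<dots> \<le> v \<bullet> (gram n Y *v v)"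
    unfolding inner_gram using f by (intro sum_mono2) auto
  finally show ?thesis unfolding M_def .
qed

text \<open>The outer products outside the selection are positive semidefinite, so the Gram matrix
  dominates that of the selected samples. Positivity and a lower bound for the determinant are
  thereby reduced to one square matrix.\<close>

lemma gram_pos_def:
  fixes Y :: "nat \<Rightarrow> 'a::real_complex^'d"
  assumes f: "inj f" "range f \<subseteq> {..<n}" and det: "det (columns_mat f Y) \<noteq> 0"
  shows "gram n Y \<in> pos_def" "(norm (det (columns_mat f Y)))\<^sup>2 \<le> kre (det (gram n Y))"
proof -
  define M where "M = columns_mat f Y"
  obtain N where "N ** M = mat 1"
    using det unfolding M_def by (metis invertible_det_nz invertible_def)
  then have M: "M ** conj_transpose M \<in> pos_def"
    by (rule congruence_1_pos_def)
  then show G: "gram n Y \<in> pos_def"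
    using gram_ge_columns_mat[OF f, of _ Y] hermitian_gram
    unfolding pos_def_def M_def by (fastforce intro: less_le_trans)
  have "det (M ** conj_transpose M) = of_real ((norm (det M))\<^sup>2)"
    using det_congruence[of M "mat 1"] by simp
  then have "kre (det (M ** conj_transpose M)) = (norm (det M))\<^sup>2"
    by (simp only: kre_of_real)
  then show "(norm (det (columns_mat f Y)))\<^sup>2 \<le> kre (det (gram n Y))"
    using kre_det_mono[OF M G] gram_ge_columns_mat[OF f, of _ Y] by (simp add: M_def)
qed

subsection \<open>Logarithmic integrability of determinants\<close>

text \<open>The value at \<open>0\<close> is \<open>\<infinity>\<close>, so that finite integrals exclude zeros.\<close>

definition log_cost :: "real \<Rightarrow> ennreal" where
  "log_cost x = (if x = 0 then \<infinity> else ennreal ((max 0 (- ln \<bar>x\<bar>))\<^sup>2))"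

lemma measurable_log_cost [measurable]: "log_cost \<in> borel_measurable borel"
  unfolding log_cost_def[abs_def] by measurable

lemma log_cost_1 [simp]: "log_cost 1 = 0"
  by (simp add: log_cost_def)

lemma log_cost_antimono:
  assumes "\<bar>x\<bar> \<le> \<bar>y\<bar>"
  shows "log_cost y \<le> log_cost x"
proof (cases "x = 0")
  case False
  then have "max 0 (- ln \<bar>y\<bar>) \<le> max 0 (- ln \<bar>x\<bar>)"
    using assms by (intro max.mono) auto
  then have "(max 0 (- ln \<bar>y\<bar>))\<^sup>2 \<le> (max 0 (- ln \<bar>x\<bar>))\<^sup>2"
    by (intro power_mono) auto
  moreover have "y \<noteq> 0" using False assms by auto
  ultimately show ?thesis
    using False unfolding log_cost_def by (simp add: ennreal_leI del: max_less_iff_conj)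
qed (simp add: log_cost_def)

lemma log_cost_mult: "log_cost (x * y) \<le> 2 * (log_cost x + log_cost y)"
proof (cases "x = 0 \<or> y = 0")
  case True
  then show ?thesis by (auto simp: log_cost_def ennreal_mult_top)
next
  case False
  define a b where "a = max 0 (- ln \<bar>x\<bar>)" and "b = max 0 (- ln \<bar>y\<bar>)"
  have "max 0 (- ln \<bar>x * y\<bar>) \<le> a + b"
    using False by (auto simp: a_def b_def abs_mult ln_mult)
  then have "(max 0 (- ln \<bar>x * y\<bar>))\<^sup>2 \<le> (a + b)\<^sup>2"
    by (intro power_mono) auto
  also have "\<dots> \<le> 2 * (a\<^sup>2 + b\<^sup>2)"
    using sum_squares_bound[of a b] by (simp add: power2_sum)
  finally have le: "(max 0 (- ln \<bar>x * y\<bar>))\<^sup>2 \<le> 2 * (a\<^sup>2 + b\<^sup>2)" .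
  have "log_cost (x * y) = ennreal ((max 0 (- ln \<bar>x * y\<bar>))\<^sup>2)"
    using False by (simp add: log_cost_def)
  also have "\<dots> \<le> ennreal (2 * (a\<^sup>2 + b\<^sup>2))"
    by (rule ennreal_leI[OF le])
  also have "\<dots> = 2 * (log_cost x + log_cost y)"
    using False by (simp add: log_cost_def ennreal_mult flip: a_def b_def)
  finally show ?thesis .
qed

text \<open>The power of 2 is one doubling per factor, coming from (a + b)^2 <= 2 (a^2 + b^2) in
  \<open>log_cost_mult\<close>.\<close>

lemma log_cost_prod: "log_cost (\<Prod>i<n. f i) \<le> 2 ^ n * (\<Sum>i<n. log_cost (f i))"
proof (induction n)
  case (Suc n)
  have "log_cost (\<Prod>i<Suc n. f i) \<le> 2 * (log_cost (\<Prod>i<n. f i) + log_cost (f n))"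
    using log_cost_mult[of "\<Prod>i<n. f i" "f n"] by simp
  also have "\<dots> \<le> 2 * (2 ^ n * (\<Sum>i<n. log_cost (f i)) + 2 ^ n * log_cost (f n))"
  proof (intro mult_left_mono add_mono Suc)
    have "1 * log_cost (f n) \<le> 2 ^ n * log_cost (f n)"
      by (intro mult_right_mono one_le_power) auto
    then show "log_cost (f n) \<le> 2 ^ n * log_cost (f n)" by simp
  qed auto
  finally show ?case by (simp add: algebra_simps)
qed simp

text \<open>Allows passing from |det| to its square, which is a real polynomial in the
  shift.\<close>

lemma log_cost_le_power2: "log_cost x \<le> log_cost (x\<^sup>2)"
proof (cases "x = 0")
  case False
  have "max 0 (- ln \<bar>x\<bar>) \<le> max 0 (- (2 * ln \<bar>x\<bar>))" by auto
  also have "2 * ln \<bar>x\<bar> = ln (x\<^sup>2)" using False by (metis ln_realpow power2_abs zero_less_abs_iff of_nat_numeral)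
  finally show ?thesis
    using False by (auto simp: log_cost_def intro!: ennreal_leI power_mono)
qed (simp add: log_cost_def)

lemma nn_integral_log_cost: "(\<integral>\<^sup>+ t. log_cost t \<partial>lborel) < \<infinity>"
proof -
  \<comment> \<open>On (0, 1), - ln u = 4 ln (u^(-1/4)) <= 4 u^(-1/4), so the squared logarithm is
    at most 16 u^(-1/2), which is integrable at 0.\<close>
  define g where "g u = ennreal (16 * u powr (- 1 / 2)) * indicator {0..1} u" for u :: real
  have [measurable]: "g \<in> borel_measurable borel"
    unfolding g_def by measurable
  have half: "log_cost u \<le> g u" if u: "u > 0" for u
  proof (cases "u < 1")
    case True
    have "- ln u / 4 = ln (u powr (- 1 / 4))" using u by (simp add: ln_powr)
    also have "\<dots> \<le> u powr (- 1 / 4)"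
      using ln_le_minus_one[of "u powr (- 1 / 4)"] u by simp
    finally have "- ln u \<le> 4 * u powr (- 1 / 4)" by simp
    then have "(max 0 (- ln u))\<^sup>2 \<le> (4 * u powr (- 1 / 4))\<^sup>2"
      by (intro power_mono) auto
    also have "\<dots> = 16 * u powr (- 1 / 2)"
      using u by (simp add: power2_eq_square flip: powr_add)
    finally show ?thesis
      using u True by (auto simp: log_cost_def g_def intro!: ennreal_leI)
  qed (use u in \<open>auto simp: log_cost_def\<close>)
  have "((\<lambda>u. u powr (- 1 / 2)) has_integral (1 powr (- 1 / 2 + 1) / (- 1 / 2 + 1))) {0..1::real}"
    by (rule has_integral_powr_from_0) auto
  then have "((\<lambda>u. 16 * u powr (- 1 / 2)) has_integral (16 * (1 powr (- 1 / 2 + 1) / (- 1 / 2 + 1)))) {0..1::real}"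
    by (rule has_integral_mult_right)
  then have "(\<integral>\<^sup>+ u. g u \<partial>lborel) = ennreal (16 * (1 powr (- 1 / 2 + 1) / (- 1 / 2 + 1)))"
    unfolding g_def by (intro nn_integral_has_integral_lebesgue') auto
  then have fin: "(\<integral>\<^sup>+ u. g u \<partial>lborel) < \<infinity>"
    by (metis ennreal_less_top infinity_ennreal_def)
  have minus: "(\<integral>\<^sup>+ u. g (- u) \<partial>lborel) = (\<integral>\<^sup>+ u. g u \<partial>lborel)"
    using nn_integral_real_affine[of g "-1" 0] by simp
  have "AE u in lborel. log_cost u \<le> g u + g (- u)"
  proof (rule AE_mp[OF AE_lborel_singleton[of 0]], rule AE_I2, rule impI)
    fix u :: real assume "u \<noteq> 0"
    then consider "u > 0" | "- u > 0" by linarith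
    then show "log_cost u \<le> g u + g (- u)"
    proof cases
      case 1 then show ?thesis using half[of u] by (simp add: add_increasing2)
    next
      case 2
      then have "log_cost u \<le> g (- u)" using half[of "- u"] by (simp add: log_cost_def)
      then show ?thesis by (simp add: add_increasing)
    qed
  qed
  then have "(\<integral>\<^sup>+ t. log_cost t \<partial>lborel) \<le> (\<integral>\<^sup>+ t. g t + g (- t) \<partial>lborel)"
    by (rule nn_integral_mono_AE)
  also have "\<dots> = (\<integral>\<^sup>+ t. g t \<partial>lborel) + (\<integral>\<^sup>+ t. g (- t) \<partial>lborel)"
    by (rule nn_integral_add) auto
  also have "\<dots> < \<infinity>" using fin minus by (simp add: ennreal_add_less_top)
  finally show ?thesis .
qed

section \<open>Monic polynomials and determinants of shifted matrices\<close>

lemma nn_integral_log_cost_shift: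
  "(\<integral>\<^sup>+ t. log_cost (t - r) \<partial>lborel) = (\<integral>\<^sup>+ t. log_cost t \<partial>lborel)"
  using nn_integral_real_affine[of log_cost 1 "- r"] by simp

text \<open>Over the complex numbers q is a product of factors t - z i, each of modulus at least |t
  - Re (z i)| for real t. Enlarging [0, 1] to the whole line removes the root by translation, so the
  bound depends on the degree alone. Leading coefficient 1 is what prevents q from being uniformly
  small.\<close>

lemma nn_integral_log_cost_poly:
  fixes q :: "real poly"
  assumes "lead_coeff q = 1"
  shows "(\<integral>\<^sup>+ t. log_cost (poly q t) * indicator {0..1} t \<partial>lborel)
    \<le> 2 ^ degree q * (of_nat (degree q) * (\<integral>\<^sup>+ t. log_cost t \<partial>lborel))"
proof -
  define p where "p = map_poly complex_of_real q"
  have "lead_coeff p = 1" "degree p = degree q"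
    using assms by (auto simp: p_def coeff_map_poly degree_map_poly)
  then obtain z where "(\<Prod>i<degree q. [:- z i, 1:]) = p"
    using complex_poly_decompose'[of p] by (metis smult_1_left)
  then have z: "poly p x = (\<Prod>i<degree q. x - z i)" for x
    by (metis (no_types, lifting) add_uminus_conv_diff mult.right_neutral poly_0 poly_pCons poly_prod
        add.commute mult_zero_right add.right_neutral prod.cong)
  have eval: "poly p (of_real t) = of_real (poly q t)" for t
    unfolding p_def by (simp add: poly_altdef degree_map_poly coeff_map_poly)
  have "log_cost (poly q t) \<le> 2 ^ degree q * (\<Sum>i<degree q. log_cost (t - Re (z i)))" for t
  proof -
    have "\<bar>\<Prod>i<degree q. t - Re (z i)\<bar> \<le> norm (\<Prod>i<degree q. of_real t - z i)"
      unfolding abs_prod prod_norm[symmetric]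
    proof (rule prod_mono)
      fix i
      show "0 \<le> \<bar>t - Re (z i)\<bar> \<and> \<bar>t - Re (z i)\<bar> \<le> norm (of_real t - z i)"
        using abs_Re_le_cmod[of "of_real t - z i"] by simp
    qed
    also have "\<dots> = \<bar>poly q t\<bar>"
      using z[of "of_real t"] eval[of t] by (metis norm_of_real)
    finally have "log_cost (poly q t) \<le> log_cost (\<Prod>i<degree q. t - Re (z i))"
      by (rule log_cost_antimono)
    also have "\<dots> \<le> 2 ^ degree q * (\<Sum>i<degree q. log_cost (t - Re (z i)))"
      by (rule log_cost_prod)
    finally show ?thesis .
  qed
  then have "(\<integral>\<^sup>+ t. log_cost (poly q t) * indicator {0..1} t \<partial>lborel)
     \<le> (\<integral>\<^sup>+ t. 2 ^ degree q * (\<Sum>i<degree q. log_cost (t - Re (z i))) \<partial>lborel)"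
    by (intro nn_integral_mono) (auto split: split_indicator)
  also have "\<dots> = 2 ^ degree q * (\<integral>\<^sup>+ t. (\<Sum>i<degree q. log_cost (t - Re (z i))) \<partial>lborel)"
    by (rule nn_integral_cmult) measurable
  also have "(\<integral>\<^sup>+ t. (\<Sum>i<degree q. log_cost (t - Re (z i))) \<partial>lborel)
      = of_nat (degree q) * (\<integral>\<^sup>+ t. log_cost t \<partial>lborel)"
    by (subst nn_integral_sum) (auto simp: nn_integral_log_cost_shift)
  finally show ?thesis .
qed

text \<open>A polynomial over the scalars need not split; its squared modulus on the real line is a
  real polynomial, to which the complex factorisation applies uniformly in both cases. The top
  coefficient is the inner product of 1 with itself.\<close>

lemma poly_norm_square:
  fixes p :: "'a::real_complex poly"
  assumes "lead_coeff p = 1"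
  obtains q :: "real poly" where "lead_coeff q = 1" "degree q = 2 * degree p"
    "\<forall>t. poly q t = (norm (poly p (of_real t)))\<^sup>2"
proof -
  define d where "d = degree p"
  define q :: "real poly" where
    "q = (\<Sum>i\<le>d. \<Sum>j\<le>d. monom (coeff p i \<bullet> coeff p j) (i + j))"
  have ev: "poly q t = (norm (poly p (of_real t)))\<^sup>2" for t
  proof -
    have "poly p (of_real t) = (\<Sum>i\<le>d. t ^ i *\<^sub>R coeff p i)"
      unfolding poly_altdef d_def by (simp add: scaleR_conv_of_real mult.commute)
    then have "(norm (poly p (of_real t)))\<^sup>2 = (\<Sum>i\<le>d. \<Sum>j\<le>d. t ^ i * (t ^ j * (coeff p i \<bullet> coeff p j)))"
      by (simp only: power2_norm_eq_inner inner_sum_left inner_sum_right)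
         (simp add: sum_distrib_left inner_commute mult.left_commute)
    then show ?thesis
      by (simp add: q_def poly_sum poly_monom power_add mult_ac)
  qed
  have "degree q \<le> 2 * d"
    unfolding q_def
    by (intro degree_sum_le) (auto intro!: degree_sum_le order_trans[OF degree_monom_le])
  moreover have "coeff q (2 * d) = 1"
  proof -
    have "coeff q (2 * d) = (\<Sum>i\<le>d. \<Sum>j\<le>d. if i = d \<and> j = d then coeff p d \<bullet> coeff p d else 0)"
      unfolding q_def coeff_sum by (intro sum.cong refl) auto
    also have "\<dots> = (\<Sum>i\<le>d. if i = d then coeff p d \<bullet> coeff p d else 0)"
      by (intro sum.cong) auto
    also have "\<dots> = 1"
      using assms by (simp add: d_def inner_one_one)
    finally show ?thesis .
  qed
  moreover from this have "degree q \<ge> 2 * d"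
    by (intro le_degree) simp
  ultimately have "degree q = 2 * d" by simp
  with that[of q] ev \<open>coeff q (2 * d) = 1\<close> show ?thesis by (simp add: d_def)
qed

text \<open>The characteristic polynomial of - M, written as the determinant of a matrix of
  polynomials. Only the identity permutation reaches degree d: any other one moves an index and
  picks up a constant entry off the diagonal.\<close>

lemma det_shift_poly:
  fixes M :: "'a::real_complex^'d^'d"
  obtains p :: "'a poly" where "lead_coeff p = 1" "degree p = CARD('d)"
    "\<forall>t. poly p t = det (\<chi> i j. M $ i $ j + (if i = j then t else 0))"
proof -
  define A where "A = (\<chi> i j. [:M $ i $ j, (if i = j then 1 else 0):])"
  define T where "T \<sigma> = (\<Prod>i\<in>UNIV. A $ i $ \<sigma> i)" for \<sigma> :: "'d \<Rightarrow> 'd"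
  have detA: "det A = (\<Sum>\<sigma> | \<sigma> permutes UNIV. of_int (sign \<sigma>) * T \<sigma>)"
    by (simp add: det_def T_def)
  have ev: "poly (det A) t = det (\<chi> i j. M $ i $ j + (if i = j then t else 0))" for t
  proof -
    have [simp]: "poly (of_int k) t = of_int k" for k
      by (metis of_int_poly poly_const_conv)
    show ?thesis
      unfolding det_def
      by (simp add: poly_sum poly_prod A_def if_distrib[of "\<lambda>x. t * x"] cong: if_cong)
  qed
  have degT: "degree (T \<sigma>) < CARD('d)" if \<sigma>: "\<sigma> \<noteq> id" for \<sigma>
  proof -
    obtain i where i: "\<sigma> i \<noteq> i" using \<sigma> by (auto simp: fun_eq_iff)
    have "degree (T \<sigma>) \<le> (\<Sum>j\<in>UNIV. degree (A $ j $ \<sigma> j))"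
      unfolding T_def using degree_prod_sum_le[of UNIV "\<lambda>j. A $ j $ \<sigma> j"] by (simp add: o_def)
    also have "\<dots> < (\<Sum>j\<in>(UNIV::'d set). 1)"
      by (rule sum_strict_mono_ex1) (use i i[symmetric] in \<open>auto simp: A_def\<close>)
    finally show ?thesis by simp
  qed
  have T_id: "lead_coeff (T id) = 1" "degree (T id) = CARD('d)"
  proof -
    show "lead_coeff (T id) = 1"
      by (simp add: T_def lead_coeff_prod A_def)
    show "degree (T id) = CARD('d)"
      unfolding T_def by (subst degree_prod_eq_sum_degree) (auto simp: A_def)
  qed
  define R where "R = (\<Sum>\<sigma> \<in> {\<sigma>. \<sigma> permutes (UNIV::'d set)} - {id}. of_int (sign \<sigma>) * T \<sigma>)"
  have "det A = T id + R"
    unfolding detA R_def by (subst sum.remove[of _ id]) (auto simp: permutes_id)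
  moreover have "degree R < CARD('d)"
  proof -
    have "degree (of_int (sign \<sigma>) * T \<sigma>) \<le> CARD('d) - 1" if "\<sigma> \<noteq> id" for \<sigma>
    proof -
      have "degree (of_int (sign \<sigma>) * T \<sigma>) \<le> degree (of_int (sign \<sigma>) :: 'a poly) + degree (T \<sigma>)"
        by (rule degree_mult_le)
      also have "degree (of_int (sign \<sigma>) :: 'a poly) = 0"
        by (simp add: of_int_poly)
      finally show ?thesis using degT[OF that] by simp
    qed
    then have "degree R \<le> CARD('d) - 1"
      unfolding R_def by (intro degree_sum_le) auto
    then show ?thesis by (simp add: less_eq_Suc_le[symmetric] le_less_trans)
  qed
  ultimately have "lead_coeff (det A) = 1" "degree (det A) = CARD('d)"
    using T_id by (auto simp: degree_add_eq_left lead_coeff_add_le coeff_eq_0)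
  with that ev show ?thesis by blast
qed

text \<open>The point is that C is uniform in M, since M will be random and the integral over t is
  then taken first. The degree m = 2 d is that of |det|^2.\<close>

lemma nn_integral_log_cost_det_shift:
  obtains C where "C < \<infinity>"
    "\<And>M :: 'a::real_complex^'d^'d.
      (\<integral>\<^sup>+ t. log_cost (norm (det (M + t *\<^sub>R mat 1))) * indicator {0..1} t \<partial>lborel) \<le> C"
proof
  define m where "m = 2 * CARD('d)"
  define C where "C = 2 ^ m * (of_nat m * (\<integral>\<^sup>+ t. log_cost t \<partial>lborel))"
  show "C < \<infinity>"
    unfolding C_def using nn_integral_log_cost
    by (auto intro!: ennreal_mult_less_top[THEN iffD2] simp: power_less_top_ennreal of_nat_less_top)
  fix M :: "'a^'d^'d"
  obtain p :: "'a poly" where p: "lead_coeff p = 1" "degree p = CARD('d)"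
    "\<forall>t. poly p t = det (\<chi> i j. M $ i $ j + (if i = j then t else 0))"
    by (rule det_shift_poly[of M])
  obtain q :: "real poly" where q: "lead_coeff q = 1" "degree q = 2 * degree p"
    "\<forall>t. poly q t = (norm (poly p (of_real t)))\<^sup>2"
    by (rule poly_norm_square[OF p(1)])
  have "M + t *\<^sub>R mat 1 = (\<chi> i j. M $ i $ j + (if i = j then of_real t else 0))" for t
    by (simp add: vec_eq_iff mat_def of_real_def)
  then have "log_cost (norm (det (M + t *\<^sub>R mat 1))) \<le> log_cost (poly q t)" for t
    using log_cost_le_power2 by (simp add: q(3) p(3))
  then have "(\<integral>\<^sup>+ t. log_cost (norm (det (M + t *\<^sub>R mat 1))) * indicator {0..1} t \<partial>lborel)
      \<le> (\<integral>\<^sup>+ t. log_cost (poly q t) * indicator {0..1} t \<partial>lborel)"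
    by (intro nn_integral_mono mult_right_mono) auto
  also have "\<dots> \<le> C"
    using nn_integral_log_cost_poly[OF q(1)] by (simp add: C_def m_def q(2) p(2))
  finally show "(\<integral>\<^sup>+ t. log_cost (norm (det (M + t *\<^sub>R mat 1))) * indicator {0..1} t \<partial>lborel) \<le> C" .
qed

subsection \<open>Centred Gaussian measures\<close>

lemma pos_def_matrix_inv:
  fixes x :: "'a::real_complex^'d^'d"
  assumes x: "x \<in> pos_def"
  shows "x ** matrix_inv x = mat 1" "matrix_inv x ** x = mat 1" "matrix_inv x \<in> pos_def"
proof -
  obtain U l where U: "unitary U" "\<And>i. l i > 0" "x = U ** diag_mat l ** conj_transpose U"
    using pos_def_spectral[OF x] by blast
  have l: "l i \<noteq> 0" for i using U(2)[of i] by simp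
  define y where "y = U ** diag_mat (\<lambda>i. 1 / l i) ** conj_transpose U"
  have y: "x ** y = mat 1" "y ** x = mat 1"
    unfolding U(3) y_def
    by (simp_all add: unitary_diag_mult[OF U(1)] l diag_mat_1 unitaryD[OF U(1)])
  have *: "x ** matrix_inv x = mat 1 \<and> matrix_inv x ** x = mat 1"
    unfolding matrix_inv_def by (rule someI[of _ y]) (use y in simp)
  have "y = y ** (x ** matrix_inv x)" using * by simp
  also have "\<dots> = matrix_inv x" by (simp add: matrix_mul_assoc y)
  finally have "matrix_inv x = y" ..
  moreover have "y \<in> pos_def"
    unfolding y_def unitary_diag_pos_def_iff[OF U(1)] using U(2) by simp
  ultimately show "x ** matrix_inv x = mat 1" "matrix_inv x ** x = mat 1" "matrix_inv x \<in> pos_def"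
    using * by simp_all
qed

lemma pos_def_lower_bound:
  fixes A :: "'a::real_complex^'d^'d"
  assumes A: "A \<in> pos_def"
  obtains e where "e > 0" "\<And>y. e * (norm y)\<^sup>2 \<le> y \<bullet> (A *v y)"
proof -
  obtain U l where U: "unitary U" "\<And>i. l i > 0" "A = U ** diag_mat l ** conj_transpose U"
    using pos_def_spectral[OF A] by blast
  define e where "e = Min (range l)"
  have e: "e > 0" "\<And>i. e \<le> l i" using U(2) by (auto simp: e_def)
  have "e * (norm y)\<^sup>2 \<le> y \<bullet> (A *v y)" for y
  proof -
    define z where "z = conj_transpose U *v y"
    have "z \<bullet> z = y \<bullet> ((U ** conj_transpose U) *v y)"
      by (simp only: matrix_vector_mul_assoc[symmetric] inner_matrix_vector_mult[of y U] z_def)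
    then have z: "(norm y)\<^sup>2 = z \<bullet> z"
      by (simp add: unitaryD[OF U(1)] power2_norm_eq_inner)
    have "y \<bullet> (A *v y) = z \<bullet> (diag_mat l *v z)"
      by (simp only: U(3) matrix_vector_mul_assoc[symmetric] inner_matrix_vector_mult[of y U] z_def)
    also have "\<dots> = (\<Sum>i\<in>UNIV. l i * (z $ i \<bullet> z $ i))"
      by (simp add: inner_vec_def diag_mat_vector_mult)
    also have "\<dots> \<ge> (\<Sum>i\<in>UNIV. e * (z $ i \<bullet> z $ i))"
      by (intro sum_mono mult_right_mono e) auto
    also have "(\<Sum>i\<in>UNIV. e * (z $ i \<bullet> z $ i)) = e * (z \<bullet> z)"
      by (simp add: inner_vec_def sum_distrib_left)
    finally show ?thesis by (simp add: z)
  qed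
  with e that show ?thesis by blast
qed

lemma nn_integral_exp_neg_norm_square:
  assumes e: "e > 0"
  shows "(\<integral>\<^sup>+ y. ennreal (exp (- e * (norm (y::'b::euclidean_space))\<^sup>2)) \<partial>lborel) < \<infinity>"
proof -
  \<comment> \<open>Chosen so that t^2 / (2 \<sigma>^2) = e t^2: up to the factor sqrt (pi / e) the
    integrand is a normal density.\<close>
  define \<sigma> where "\<sigma> = 1 / sqrt (2 * e)"
  have \<sigma>: "\<sigma>\<^sup>2 = 1 / (2 * e)" "\<sigma> > 0" using e by (simp_all add: \<sigma>_def power_divide)
  have one: "(\<integral>\<^sup>+ t. ennreal (exp (- e * t\<^sup>2)) \<partial>lborel) < \<infinity>"
  proof -
    interpret prob_space "density lborel (normal_density 0 \<sigma>)"
      by (rule prob_space_normal_density) (rule \<sigma>(2))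
    have "(\<integral>\<^sup>+ t. ennreal (normal_density 0 \<sigma> t) \<partial>lborel) = 1"
      using emeasure_space_1 by (simp add: emeasure_density)
    moreover have "ennreal (exp (- e * t\<^sup>2)) = ennreal (sqrt (pi / e)) * ennreal (normal_density 0 \<sigma> t)" for t
      using e by (subst ennreal_mult[symmetric])
         (auto simp: normal_density_def \<sigma> real_sqrt_divide real_sqrt_mult field_simps)
    ultimately show ?thesis
      by (simp add: nn_integral_cmult)
  qed
  have "ennreal (exp (- e * (norm y)\<^sup>2)) = (\<Prod>b\<in>Basis. ennreal (exp (- e * (y \<bullet> b)\<^sup>2)))" for y :: 'b
  proof -
    have "(norm y)\<^sup>2 = (\<Sum>b\<in>Basis. (y \<bullet> b)\<^sup>2)"
      unfolding power2_norm_eq_inner by (subst euclidean_inner) (simp add: power2_eq_square)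
    then show ?thesis
      by (simp add: prod_ennreal sum_distrib_left exp_sum flip: exp_sum sum_negf)
  qed
  then have "(\<integral>\<^sup>+ y. ennreal (exp (- e * (norm (y::'b))\<^sup>2)) \<partial>lborel)
      = (\<Prod>b\<in>(Basis::'b set). \<integral>\<^sup>+ t. ennreal (exp (- e * t\<^sup>2)) \<partial>lborel)"
    using nn_integral_lborel_prod[of "\<lambda>(_::'b) t. ennreal (exp (- e * t\<^sup>2))"] by simp
  also have "\<dots> < \<infinity>"
    using one by (simp add: power_less_top_ennreal)
  finally show ?thesis .
qed

section \<open>Lebesgue measure under translations and linear maps\<close>

lemma nn_integral_lborel_plus:
  fixes f :: "'b::euclidean_space \<Rightarrow> ennreal"
  assumes [measurable]: "f \<in> borel_measurable borel"
  shows "(\<integral>\<^sup>+ y. f (y + z) \<partial>lborel) = (\<integral>\<^sup>+ y. f y \<partial>lborel)"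
proof -
  have "(\<integral>\<^sup>+ y. f y \<partial>lborel) = (\<integral>\<^sup>+ y. f y \<partial>(distr lborel borel ((+) z)))"
    by (simp only: lborel_distr_plus)
  also have "\<dots> = (\<integral>\<^sup>+ y. f (y + z) \<partial>lborel)"
    by (subst nn_integral_distr) (auto simp: add.commute)
  finally show ?thesis ..
qed

lemma nn_integral_lborel_reflect:
  fixes f :: "'b::euclidean_space \<Rightarrow> ennreal"
  assumes [measurable]: "f \<in> borel_measurable borel"
  shows "(\<integral>\<^sup>+ y. f (z - y) \<partial>lborel) = (\<integral>\<^sup>+ y. f y \<partial>lborel)"
proof -
  have "lborel = distr lborel borel (\<lambda>y. z - y)"
    using lborel_affine[of "-1" z] by (simp add: density_1)
  then have "(\<integral>\<^sup>+ y. f y \<partial>lborel) = (\<integral>\<^sup>+ y. f y \<partial>(distr lborel borel (\<lambda>y. z - y)))"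
    by simp
  also have "\<dots> = (\<integral>\<^sup>+ y. f (z - y) \<partial>lborel)"
    by (subst nn_integral_distr) auto
  finally show ?thesis ..
qed

text \<open>Evaluating \<open>\<integral>\<integral> 1\<^sub>A(T x) f(y + T x) dx dy\<close> in both orders shows that \<open>T\<close> preserves the
  Lebesgue measure as soon as it preserves one integrable function.\<close>

lemma lborel_distr_linear:
  fixes T R :: "'b::euclidean_space \<Rightarrow> 'b" and f :: "'b \<Rightarrow> ennreal"
  assumes T: "linear T" and TR: "\<And>y. T (R y) = y"
    and f [measurable]: "f \<in> borel_measurable borel" and inv: "\<And>x. f (T x) = f x"
    and fin: "(\<integral>\<^sup>+ x. f x \<partial>lborel) < \<infinity>" and pos: "(\<integral>\<^sup>+ x. f x \<partial>lborel) \<noteq> 0"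
  shows "distr lborel borel T = lborel"
proof (rule measure_eqI)
  have [measurable]: "T \<in> borel_measurable borel"
    by (intro borel_measurable_continuous_onI linear_continuous_on) (simp add: T linear_conv_bounded_linear[symmetric])
  fix A assume "A \<in> sets (distr lborel borel T)"
  then have [measurable]: "A \<in> sets borel" by simp
  define J where "J = (\<integral>\<^sup>+ x. f x \<partial>lborel)"
  define I where "I = (\<integral>\<^sup>+ x. \<integral>\<^sup>+ y. indicator A (T x) * f (y + T x) \<partial>lborel \<partial>lborel)"
  have "(\<integral>\<^sup>+ y. indicator A (T x) * f (y + T x) \<partial>lborel) = indicator A (T x) * J" for x
    unfolding J_def by (subst nn_integral_cmult) (auto simp: nn_integral_lborel_plus)
  then have "I = (\<integral>\<^sup>+ x. indicator A (T x) \<partial>lborel) * J"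
    unfolding I_def by (simp add: nn_integral_multc)
  also have "(\<integral>\<^sup>+ x. indicator A (T x) \<partial>lborel) = (\<integral>\<^sup>+ x. indicator A x \<partial>(distr lborel borel T))"
    by (subst nn_integral_distr) auto
  also have "\<dots> = emeasure (distr lborel borel T) A"
    by (subst nn_integral_indicator) auto
  finally have 1: "I = emeasure (distr lborel borel T) A * J" .
  have "I = (\<integral>\<^sup>+ y. \<integral>\<^sup>+ x. indicator A (T x) * f (y + T x) \<partial>lborel \<partial>lborel)"
    unfolding I_def by (intro lborel_pair.Fubini') measurable
  also have "\<dots> = (\<integral>\<^sup>+ y. \<integral>\<^sup>+ x. indicator A (T x - y) * f x \<partial>lborel \<partial>lborel)"
  proof (rule nn_integral_cong)
    fix y
    \<comment> \<open>Translating x by - R y removes y from the argument of f, and the invariance of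
      f under T then leaves f x.\<close>
    have "T (x + (- R y)) = T x - y" for x
      using TR[of y] by (simp add: linear_diff[OF T])
    then show "(\<integral>\<^sup>+ x. indicator A (T x) * f (y + T x) \<partial>lborel) = (\<integral>\<^sup>+ x. indicator A (T x - y) * f x \<partial>lborel)"
      using nn_integral_lborel_plus[of "\<lambda>x. indicator A (T x) * f (y + T x)" "- R y"]
      by (simp add: inv)
  qed
  also have "\<dots> = (\<integral>\<^sup>+ x. \<integral>\<^sup>+ y. indicator A (T x - y) * f x \<partial>lborel \<partial>lborel)"
    by (intro lborel_pair.Fubini') measurable
  also have "\<dots> = (\<integral>\<^sup>+ x. emeasure lborel A * f x \<partial>lborel)"
    by (intro nn_integral_cong, subst nn_integral_multc) (auto simp: nn_integral_lborel_reflect)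
  also have "\<dots> = emeasure lborel A * J"
    unfolding J_def by (simp add: nn_integral_cmult)
  finally have 2: "I = emeasure lborel A * J" .
  show "emeasure (distr lborel borel T) A = emeasure lborel A"
    using 1 2 fin pos unfolding J_def[symmetric]
    by (metis ennreal_mult_right_cong infinity_ennreal_def less_irrefl mult.commute ennreal_mult_cancel_left)
qed auto

section \<open>The Gaussian law: domination, mass and linear symmetries\<close>

lemma gaussian_density:
  fixes S :: "'a::real_complex^'d^'d"
  assumes S: "S \<in> pos_def"
  obtains C where "C > 0" "gaussian S = density lborel
    (\<lambda>y. ennreal (C * exp (- (real DIM('a) / 2) * (y \<bullet> (matrix_inv S *v y)))))"
proof
  define C where "C = (real DIM('a) / (2 * pi)) powr (real DIM('a) * real CARD('d) / 2)
    * kre (det S) powr (- real DIM('a) / 2)"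
  show "C > 0" using det_pos_def[OF S] by (simp add: C_def)
  show "gaussian S = density lborel
    (\<lambda>y. ennreal (C * exp (- (real DIM('a) / 2) * (y \<bullet> (matrix_inv S *v y)))))"
    by (simp only: gaussian_def Let_def C_def)
qed

lemma borel_measurable_matrix_vector_mult [measurable]:
  "(\<lambda>y. A *v (y::'a::real_complex^'d)) \<in> borel_measurable borel"
  by (intro borel_measurable_continuous_onI linear_continuous_on)
     (simp add: linear_matrix_vector_mult linear_conv_bounded_linear[symmetric])

text \<open>A lower bound for the quadratic form of the inverse covariance by a multiple of |y|^2
  gives an isotropic majorant, which is easy to compare with its translates in
  \<open>gaussian_shift_le\<close>.\<close>

lemma gaussian_dominated:
  fixes S :: "'a::real_complex^'d^'d"
  assumes S: "S \<in> pos_def"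
  obtains C e where "C > 0" "e > 0"
    "\<forall>f\<in>borel_measurable borel.
      (\<integral>\<^sup>+ y. f y \<partial>gaussian S) \<le> ennreal C * (\<integral>\<^sup>+ y. ennreal (exp (- e * (norm y)\<^sup>2)) * f y \<partial>lborel)"
proof -
  obtain C where C: "C > 0" "gaussian S = density lborel
    (\<lambda>y. ennreal (C * exp (- (real DIM('a) / 2) * (y \<bullet> (matrix_inv S *v y)))))"
    using gaussian_density[OF S] by blast
  obtain e where e: "e > 0" "\<And>y. e * (norm y)\<^sup>2 \<le> y \<bullet> (matrix_inv S *v y)"
    using pos_def_lower_bound[OF pos_def_matrix_inv(3)[OF S]] by blast
  define k where "k = real DIM('a) / 2"
  have k: "k > 0" by (simp add: k_def)
  have "(\<integral>\<^sup>+ y. f y \<partial>gaussian S) \<le> ennreal C * (\<integral>\<^sup>+ y. ennreal (exp (- (k * e) * (norm y)\<^sup>2)) * f y \<partial>lborel)"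
    if [measurable]: "f \<in> borel_measurable borel" for f
  proof -
    have "(\<integral>\<^sup>+ y. f y \<partial>gaussian S)
        = (\<integral>\<^sup>+ y. ennreal (C * exp (- k * (y \<bullet> (matrix_inv S *v y)))) * f y \<partial>lborel)"
      unfolding C(2) k_def by (subst nn_integral_density) auto
    also have "\<dots> \<le> (\<integral>\<^sup>+ y. ennreal C * (ennreal (exp (- (k * e) * (norm y)\<^sup>2)) * f y) \<partial>lborel)"
    proof (intro nn_integral_mono)
      fix y
      have "- k * (y \<bullet> (matrix_inv S *v y)) \<le> - (k * e) * (norm y)\<^sup>2"
        using e(2)[of y] k by (simp add: mult.assoc)
      then have "C * exp (- k * (y \<bullet> (matrix_inv S *v y))) \<le> C * exp (- (k * e) * (norm y)\<^sup>2)"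
        using C(1) by simp
      then have "ennreal (C * exp (- k * (y \<bullet> (matrix_inv S *v y)))) * f y
          \<le> ennreal (C * exp (- (k * e) * (norm y)\<^sup>2)) * f y"
        by (intro mult_right_mono ennreal_leI) auto
      then show "ennreal (C * exp (- k * (y \<bullet> (matrix_inv S *v y)))) * f y
          \<le> ennreal C * (ennreal (exp (- (k * e) * (norm y)\<^sup>2)) * f y)"
        using C(1) by (simp add: ennreal_mult' mult.assoc)
    qed
    also have "\<dots> = ennreal C * (\<integral>\<^sup>+ y. ennreal (exp (- (k * e) * (norm y)\<^sup>2)) * f y \<partial>lborel)"
      by (rule nn_integral_cmult) auto
    finally show ?thesis .
  qed
  with that[of C "k * e"] C(1) e(1) k show ?thesis by simp
qed

lemma sets_gaussian [measurable_cong]: "sets (gaussian S) = sets borel"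
  by (simp add: gaussian_def Let_def)

lemma space_gaussian [simp]: "space (gaussian S) = UNIV"
  by (simp add: gaussian_def Let_def)

lemma finite_measure_gaussian:
  fixes S :: "'a::real_complex^'d^'d"
  assumes S: "S \<in> pos_def"
  shows "finite_measure (gaussian S)" "emeasure (gaussian S) UNIV \<noteq> 0"
proof -
  obtain C e where C: "C > 0" "e > 0"
    "\<forall>f\<in>borel_measurable borel.
      (\<integral>\<^sup>+ y. f y \<partial>gaussian S) \<le> ennreal C * (\<integral>\<^sup>+ y. ennreal (exp (- e * (norm y)\<^sup>2)) * f y \<partial>lborel)"
    using gaussian_dominated[OF S] .
  have "emeasure (gaussian S) UNIV = (\<integral>\<^sup>+ y. 1 \<partial>gaussian S)" by simp
  also have "\<dots> \<le> ennreal C * (\<integral>\<^sup>+ y. ennreal (exp (- e * (norm (y::'a^'d))\<^sup>2)) \<partial>lborel)"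
    using C(3)[rule_format, of "\<lambda>_. 1"] by simp
  also have "\<dots> < \<infinity>"
    using nn_integral_exp_neg_norm_square[OF C(2), where 'b="'a^'d"] by (simp add: ennreal_mult_less_top)
  finally show "finite_measure (gaussian S)"
    by (intro finite_measureI) simp
  obtain C where C: "C > 0" "gaussian S = density lborel
    (\<lambda>y. ennreal (C * exp (- (real DIM('a) / 2) * (y \<bullet> (matrix_inv S *v y)))))"
    using gaussian_density[OF S] by blast
  show "emeasure (gaussian S) UNIV \<noteq> 0"
  proof
    assume "emeasure (gaussian S) UNIV = 0"
    then have "AE y in (lborel :: ('a^'d) measure). False"
      using C(1) unfolding C(2) by (simp add: emeasure_density nn_integral_0_iff_AE not_le)
    then have "emeasure (lborel :: ('a^'d) measure) UNIV = 0"
      by (simp add: eventually_False ae_filter_eq_bot_iff)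
    then show False by simp
  qed
qed

text \<open>T S T* = S gives T* B T = B for the inverse B of S, so T preserves the density. The
  density is also the invariant integrable function with which \<open>lborel_distr_linear\<close>
  shows that T preserves Lebesgue measure.\<close>

lemma gaussian_distr_linear:
  fixes S T R :: "'a::real_complex^'d^'d"
  assumes S: "S \<in> pos_def" and TR: "T ** R = mat 1" and TST: "T ** S ** conj_transpose T = S"
  shows "distr (gaussian S) borel ((\<lambda>y. T *v y)) = gaussian S"
proof -
  define B where "B = matrix_inv S"
  have B: "S ** B = mat 1" "B ** S = mat 1" using pos_def_matrix_inv[OF S] by (simp_all add: B_def)
  have RT: "R ** T = mat 1" using TR by (simp add: matrix_left_right_inverse)
  have RT': "conj_transpose R ** conj_transpose T = mat 1" "conj_transpose T ** conj_transpose R = mat 1"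
    using inverse_conj_transpose[OF RT] by simp_all
  have "conj_transpose R ** B ** R ** S = mat 1"
  proof -
    have "conj_transpose R ** B ** R ** (T ** S ** conj_transpose T)
        = conj_transpose R ** (B ** ((R ** T) ** S)) ** conj_transpose T"
      by (simp only: matrix_mul_assoc)
    then show ?thesis by (simp add: TST RT B RT')
  qed
  then have "conj_transpose R ** B ** R = B"
    by (metis B(1) matrix_mul_assoc matrix_mul_lid matrix_mul_rid)
  then have "conj_transpose T ** B ** T = conj_transpose T ** (conj_transpose R ** B ** R) ** T"
    by simp
  also have "\<dots> = (conj_transpose T ** conj_transpose R) ** B ** (R ** T)"
    by (simp only: matrix_mul_assoc)
  finally have TBT: "conj_transpose T ** B ** T = B"
    by (simp add: RT RT')
  have q: "(T *v y) \<bullet> (B *v (T *v y)) = y \<bullet> (B *v y)" for y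
  proof -
    have "(T *v y) \<bullet> (B *v (T *v y)) = y \<bullet> (conj_transpose T *v (B *v (T *v y)))"
      using inner_matrix_vector_mult[of y "conj_transpose T"] by simp
    also have "\<dots> = y \<bullet> ((conj_transpose T ** B ** T) *v y)"
      by (simp only: matrix_vector_mul_assoc matrix_mul_assoc)
    finally show ?thesis by (simp add: TBT)
  qed
  obtain C where C: "C > 0" "gaussian S = density lborel
    (\<lambda>y. ennreal (C * exp (- (real DIM('a) / 2) * (y \<bullet> (B *v y)))))"
    using gaussian_density[OF S] unfolding B_def by blast
  define f where "f y = ennreal (C * exp (- (real DIM('a) / 2) * (y \<bullet> (B *v y))))" for y
  have [measurable]: "f \<in> borel_measurable borel" unfolding f_def by measurable
  have G: "gaussian S = density lborel f" unfolding C(2) f_def ..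
  have fT: "f (T *v y) = f y" for y by (simp add: f_def q)
  have mass: "(\<integral>\<^sup>+ y. f y \<partial>lborel) = emeasure (gaussian S) UNIV"
    unfolding G by (simp add: emeasure_density)
  interpret finite_measure "gaussian S" by (rule finite_measure_gaussian[OF S])
  have inv: "distr lborel borel ((\<lambda>y. T *v y)) = lborel"
  proof (rule lborel_distr_linear[where R = "\<lambda>y. R *v y" and f = f])
    show "(\<integral>\<^sup>+ y. f y \<partial>lborel) < \<infinity>"
      unfolding mass using emeasure_finite by (simp add: less_top[symmetric])
    show "(\<integral>\<^sup>+ y. f y \<partial>lborel) \<noteq> 0"
      unfolding mass by (rule finite_measure_gaussian[OF S])
  qed (auto simp: linear_matrix_vector_mult matrix_vector_mul_assoc TR fT)
  show ?thesis
  proof (rule measure_eqI)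
    fix A assume "A \<in> sets (distr (gaussian S) borel ((\<lambda>y. T *v y)))"
    then have [measurable]: "A \<in> sets borel" by simp
    have "emeasure (distr (gaussian S) borel ((\<lambda>y. T *v y))) A = (\<integral>\<^sup>+ y. indicator A y \<partial>distr (gaussian S) borel ((\<lambda>y. T *v y)))"
      by simp
    also have "\<dots> = (\<integral>\<^sup>+ y. indicator A (T *v y) \<partial>gaussian S)"
      by (subst nn_integral_distr) auto
    also have "\<dots> = (\<integral>\<^sup>+ y. f (T *v y) * indicator A (T *v y) \<partial>lborel)"
      unfolding G by (subst nn_integral_density) (auto simp: fT)
    also have "\<dots> = (\<integral>\<^sup>+ y. f y * indicator A y \<partial>distr lborel borel ((\<lambda>y. T *v y)))"
      by (subst nn_integral_distr) auto
    also have "\<dots> = emeasure (gaussian S) A"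
      unfolding inv G by (simp add: emeasure_density)
    finally show "emeasure (distr (gaussian S) borel ((\<lambda>y. T *v y))) A = emeasure (gaussian S) A" .
  qed (simp add: sets_gaussian)
qed

text \<open>The one-coordinate bound is used in the inner integral and the induction hypothesis in
  the outer one, at the price of one factor K per coordinate. The restriction to I keeps the shifted
  family in the extensional product space.\<close>

lemma nn_integral_PiM_le_shift:
  fixes \<gamma> \<gamma>' :: "'b::euclidean_space measure"
  assumes sf: "sigma_finite_measure \<gamma>" "sigma_finite_measure \<gamma>'"
    and sets [measurable_cong]: "sets \<gamma> = sets borel" "sets \<gamma>' = sets borel"
    and le: "\<And>i f. f \<in> borel_measurable borel \<Longrightarrow> (\<integral>\<^sup>+ y. f y \<partial>\<gamma>) \<le> K * (\<integral>\<^sup>+ y. f (y + a i) \<partial>\<gamma>')"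
    and I: "finite I"
  shows "F \<in> borel_measurable (PiM I (\<lambda>_. borel)) \<Longrightarrow>
    (\<integral>\<^sup>+ Y. F Y \<partial>PiM I (\<lambda>_. \<gamma>)) \<le> K ^ card I * (\<integral>\<^sup>+ Y. F (\<lambda>i\<in>I. Y i + a i) \<partial>PiM I (\<lambda>_. \<gamma>'))"
  using I
proof (induction I arbitrary: F rule: finite_induct)
  case empty
  then show ?case
    by (simp add: PiM_empty nn_integral_count_space_finite)
next
  case (insert i I)
  interpret P: product_sigma_finite "\<lambda>_. \<gamma>" by (rule product_sigma_finite.intro) (rule sf)
  interpret P': product_sigma_finite "\<lambda>_. \<gamma>'" by (rule product_sigma_finite.intro) (rule sf)
  have [measurable]: "F \<in> borel_measurable (PiM (insert i I) (\<lambda>_. borel))" by fact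
  have sP: "sets (PiM J (\<lambda>_. \<gamma>)) = sets (PiM J (\<lambda>_. borel))" "sets (PiM J (\<lambda>_. \<gamma>')) = sets (PiM J (\<lambda>_. borel))" for J
    by (auto intro!: sets_PiM_cong simp: sets)
  note [measurable_cong] = sP
  interpret G': sigma_finite_measure \<gamma>' by (rule sf)
  have "(\<integral>\<^sup>+ Y. F Y \<partial>PiM (insert i I) (\<lambda>_. \<gamma>)) = (\<integral>\<^sup>+ Y. (\<integral>\<^sup>+ y. F (Y(i := y)) \<partial>\<gamma>) \<partial>PiM I (\<lambda>_. \<gamma>))"
    using insert by (subst P.product_nn_integral_insert) (auto simp: measurable_cong_sets[OF sP(1) refl])
  also have "\<dots> \<le> (\<integral>\<^sup>+ Y. K * (\<integral>\<^sup>+ y. F (Y(i := y + a i)) \<partial>\<gamma>') \<partial>PiM I (\<lambda>_. \<gamma>))"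
  proof (intro nn_integral_mono le)
    fix Y assume "Y \<in> space (PiM I (\<lambda>_. \<gamma>))"
    then have [measurable]: "Y \<in> space (PiM I (\<lambda>_. borel))"
      using sets_eq_imp_space_eq[OF sP(1)] by blast
    show "(\<lambda>y. F (Y(i := y))) \<in> borel_measurable borel" by measurable
  qed
  also have "\<dots> = K * (\<integral>\<^sup>+ Y. (\<integral>\<^sup>+ y. F (Y(i := y + a i)) \<partial>\<gamma>') \<partial>PiM I (\<lambda>_. \<gamma>))"
    by (rule nn_integral_cmult) measurable
  also have "\<dots> \<le> K * (K ^ card I * (\<integral>\<^sup>+ Y. (\<integral>\<^sup>+ y. F ((\<lambda>j\<in>I. Y j + a j)(i := y + a i)) \<partial>\<gamma>') \<partial>PiM I (\<lambda>_. \<gamma>')))"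
    by (intro mult_left_mono insert.IH) measurable
  also have "(\<integral>\<^sup>+ Y. (\<integral>\<^sup>+ y. F ((\<lambda>j\<in>I. Y j + a j)(i := y + a i)) \<partial>\<gamma>') \<partial>PiM I (\<lambda>_. \<gamma>'))
     = (\<integral>\<^sup>+ Y. (\<integral>\<^sup>+ y. F (\<lambda>j\<in>insert i I. (Y(i := y)) j + a j) \<partial>\<gamma>') \<partial>PiM I (\<lambda>_. \<gamma>'))"
    using insert(2) by (intro nn_integral_cong arg_cong[of _ _ F]) (auto simp: fun_eq_iff restrict_def)
  also have "\<dots> = (\<integral>\<^sup>+ Y. F (\<lambda>j\<in>insert i I. Y j + a j) \<partial>PiM (insert i I) (\<lambda>_. \<gamma>'))"
    using insert(1,2) by (subst P'.product_nn_integral_insert) (auto simp: measurable_cong_sets[OF sP(2) refl])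
  finally show ?case
    unfolding card_insert_disjoint[OF insert(1,2)] power_Suc mult.assoc .
qed

lemma PiM_distr_invariant:
  assumes sf: "sigma_finite_measure \<gamma>" and T: "T \<in> \<gamma> \<rightarrow>\<^sub>M \<gamma>" "distr \<gamma> \<gamma> T = \<gamma>" and I: "finite I"
  shows "distr (PiM I (\<lambda>_. \<gamma>)) (PiM I (\<lambda>_. \<gamma>)) (\<lambda>Y. \<lambda>i\<in>I. T (Y i)) = PiM I (\<lambda>_. \<gamma>)"
proof -
  interpret P: product_sigma_finite "\<lambda>_. \<gamma>" by (rule product_sigma_finite.intro) (rule sf)
  note [measurable] = T(1)
  show ?thesis
  proof (rule P.PiM_eqI[OF I])
    fix A assume A: "\<And>i. i \<in> I \<Longrightarrow> A i \<in> sets \<gamma>"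
    have "(\<lambda>Y. \<lambda>i\<in>I. T (Y i)) -` (PiE I A) \<inter> space (PiM I (\<lambda>_. \<gamma>)) = (\<Pi>\<^sub>E i\<in>I. T -` A i \<inter> space \<gamma>)"
      by (auto simp: space_PiM PiE_iff)
    moreover have "T -` A i \<inter> space \<gamma> \<in> sets \<gamma>" if "i \<in> I" for i
      using A[OF that] T(1) by measurable
    moreover have "emeasure \<gamma> (T -` A i \<inter> space \<gamma>) = emeasure \<gamma> (A i)" if "i \<in> I" for i
      using A[OF that] emeasure_distr[OF T(1), of "A i"] T(2) by simp
    ultimately show "emeasure (distr (PiM I (\<lambda>_. \<gamma>)) (PiM I (\<lambda>_. \<gamma>)) (\<lambda>Y. \<lambda>i\<in>I. T (Y i))) (PiE I A)
        = (\<Prod>i\<in>I. emeasure \<gamma> (A i))"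
      using I A by (subst emeasure_distr) (auto simp: P.emeasure_PiM intro!: sets_PiM_I_finite)
  qed simp
qed

subsection \<open>The Wishart law\<close>

lemma sets_PiM_gaussian: "sets (PiM I (\<lambda>_. gaussian S)) = sets (PiM I (\<lambda>_. borel))"
  by (intro sets_PiM_cong) (auto simp: sets_gaussian)

lemma continuous_on_det [continuous_intros]:
  "continuous_on X f \<Longrightarrow> continuous_on X (\<lambda>x. det (f x :: 'a::real_complex^'d^'d))"
  unfolding det_def by (intro continuous_intros continuous_on_component)

lemma borel_measurable_det [measurable]:
  "(det :: 'a::real_complex^'d^'d \<Rightarrow> 'a) \<in> borel_measurable borel"
  by (intro borel_measurable_continuous_onI continuous_intros)

lemma measurable_gram:
  "gram n \<in> PiM {..<n} (\<lambda>_. borel) \<rightarrow>\<^sub>M (borel :: ('a::real_complex^'d^'d) measure)"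
proof -
  have [measurable]: "(outer :: 'a^'d \<Rightarrow> 'a^'d^'d) \<in> borel_measurable borel"
    by (intro borel_measurable_continuous_onI continuous_intros)
  show ?thesis
    unfolding gram_def[abs_def] by measurable
qed

lemma measurable_columns_mat:
  assumes f: "range f \<subseteq> {..<n}"
  shows "columns_mat f \<in> PiM {..<n} (\<lambda>_. borel) \<rightarrow>\<^sub>M (borel :: ('a::real_complex^'d^'d) measure)"
proof -
  \<comment> \<open>Places y in column j, so that \<open>columns_mat\<close> is a finite sum of
    Borel functions of single samples.\<close>
  define c :: "'d \<Rightarrow> 'a^'d \<Rightarrow> 'a^'d^'d" where "c j y = (\<chi> i k. if k = j then y $ i else 0)" for j y
  have [measurable]: "c j \<in> borel_measurable borel" for j
  proof (intro borel_measurable_continuous_onI)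
    show "continuous_on UNIV (c j)"
      unfolding c_def
    proof (intro continuous_on_vec_lambda)
      show "continuous_on UNIV (\<lambda>y :: 'a^'d. if k = j then y $ i else 0)" for i k
        by (cases "k = j") (auto intro!: continuous_intros)
    qed
  qed
  have "columns_mat f Y = (\<Sum>j\<in>UNIV. c j (Y (f j)))" for Y :: "nat \<Rightarrow> 'a^'d"
    by (simp add: columns_mat_def c_def vec_eq_iff)
  then have "columns_mat f = (\<lambda>Y :: nat \<Rightarrow> 'a^'d. \<Sum>j\<in>UNIV. c j (Y (f j)))" by auto
  moreover have "(\<lambda>Y. c j (Y (f j))) \<in> PiM {..<n} (\<lambda>_. borel) \<rightarrow>\<^sub>M borel" for j
    using f by (intro measurable_compose[OF measurable_component_singleton]) auto
  ultimately show ?thesis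
    by simp
qed

text \<open>These translations of the samples realise M + t I; each of them has norm at most 1 for t
  in [0, 1], as \<open>gaussian_shift_le\<close> requires.\<close>

lemma columns_mat_shift:
  fixes Y :: "nat \<Rightarrow> 'a::real_complex^'d"
  assumes f: "inj f" "range f \<subseteq> {..<n}"
  shows "columns_mat f (\<lambda>i\<in>{..<n}. Y i + (if i \<in> range f then t *\<^sub>R axis (inv f i) 1 else 0))
    = columns_mat f Y + t *\<^sub>R mat 1"
proof -
  have "f j < n" for j using f(2) by auto
  then show ?thesis
    using f(1) by (simp add: columns_mat_def vec_eq_iff axis_def mat_def)
qed

text \<open>From |y|^2 <= 2 |y + a|^2 + 2 one gets exp (- e |y + a|^2) <= exp e exp (- (e / 2)
  |y|^2): halving the rate buys a constant uniform over all shifts with |a| <= 1. The wider Gaussian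
  \<gamma> does not depend on a.\<close>

lemma gaussian_shift_le:
  fixes S :: "'a::real_complex^'d^'d"
  assumes S: "S \<in> pos_def"
  obtains K and \<gamma> :: "('a^'d) measure" where "finite_measure \<gamma>" "sets \<gamma> = sets borel"
    "\<forall>f\<in>borel_measurable borel. \<forall>a. norm a \<le> 1 \<longrightarrow>
      (\<integral>\<^sup>+ y. f y \<partial>gaussian S) \<le> ennreal K * (\<integral>\<^sup>+ y. f (y + a) \<partial>\<gamma>)"
proof -
  obtain C e where C: "C > 0" "e > 0" "\<forall>f\<in>borel_measurable borel.
      (\<integral>\<^sup>+ y. f y \<partial>gaussian S) \<le> ennreal C * (\<integral>\<^sup>+ y. ennreal (exp (- e * (norm y)\<^sup>2)) * f y \<partial>lborel)"
    using gaussian_dominated[OF S] .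
  define \<gamma> where "\<gamma> = density lborel (\<lambda>y :: 'a^'d. ennreal (exp (- (e / 2) * (norm y)\<^sup>2)))"
  have "emeasure \<gamma> UNIV = (\<integral>\<^sup>+ y. ennreal (exp (- (e / 2) * (norm (y :: 'a^'d))\<^sup>2)) \<partial>lborel)"
    unfolding \<gamma>_def by (simp add: emeasure_density)
  also have "\<dots> < \<infinity>"
    using C(2) by (intro nn_integral_exp_neg_norm_square) simp
  finally have fin: "finite_measure \<gamma>"
    by (intro finite_measureI) (simp add: \<gamma>_def)
  have "(\<integral>\<^sup>+ y. f y \<partial>gaussian S) \<le> ennreal (C * exp e) * (\<integral>\<^sup>+ y. f (y + a) \<partial>\<gamma>)"
    if f [measurable]: "f \<in> borel_measurable borel" and a: "norm a \<le> 1" for f a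
  proof -
    have "(\<integral>\<^sup>+ y. f y \<partial>gaussian S) \<le> ennreal C * (\<integral>\<^sup>+ y. ennreal (exp (- e * (norm y)\<^sup>2)) * f y \<partial>lborel)"
      using C(3) f by blast
    also have "(\<integral>\<^sup>+ y. ennreal (exp (- e * (norm y)\<^sup>2)) * f y \<partial>lborel)
        = (\<integral>\<^sup>+ y. ennreal (exp (- e * (norm (y + a))\<^sup>2)) * f (y + a) \<partial>lborel)"
      by (subst nn_integral_lborel_plus) auto
    also have "\<dots> \<le> (\<integral>\<^sup>+ y. ennreal (exp e) * (ennreal (exp (- (e / 2) * (norm y)\<^sup>2)) * f (y + a)) \<partial>lborel)"
    proof (rule nn_integral_mono)
      fix y
      have "norm y \<le> norm (y + a) + 1"
        using norm_triangle_ineq4[of "y + a" a] a by simp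
      then have "(norm y)\<^sup>2 \<le> (norm (y + a) + 1)\<^sup>2"
        by (intro power_mono) auto
      also have "\<dots> \<le> 2 * (norm (y + a))\<^sup>2 + 2"
        using sum_squares_bound[of "norm (y + a)" 1] by (simp add: power2_sum)
      finally have "(e / 2) * (norm y)\<^sup>2 \<le> (e / 2) * (2 * (norm (y + a))\<^sup>2 + 2)"
        using C(2) by (intro mult_left_mono) auto
      then have "- e * (norm (y + a))\<^sup>2 \<le> e + (- (e / 2) * (norm y)\<^sup>2)"
        by (simp add: algebra_simps)
      then have "exp (- e * (norm (y + a))\<^sup>2) \<le> exp e * exp (- (e / 2) * (norm y)\<^sup>2)"
        by (simp flip: exp_add)
      then have "ennreal (exp (- e * (norm (y + a))\<^sup>2)) \<le> ennreal (exp e) * ennreal (exp (- (e / 2) * (norm y)\<^sup>2))"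
        by (simp add: ennreal_leI flip: ennreal_mult)
      then show "ennreal (exp (- e * (norm (y + a))\<^sup>2)) * f (y + a)
          \<le> ennreal (exp e) * (ennreal (exp (- (e / 2) * (norm y)\<^sup>2)) * f (y + a))"
        unfolding mult.assoc[symmetric] by (rule mult_right_mono) simp
    qed
    also have "\<dots> = ennreal (exp e) * (\<integral>\<^sup>+ y. f (y + a) \<partial>\<gamma>)"
      unfolding \<gamma>_def by (subst nn_integral_density) (auto simp: nn_integral_cmult)
    finally show ?thesis
      using C(1) by (simp add: mult_left_mono ennreal_mult mult.assoc)
  qed
  with that[of \<gamma> "C * exp e"] fin show ?thesis by (simp add: \<gamma>_def)
qed

text \<open>Averaging over the translations \<open>M + t I\<close> with \<open>0 \<le> t \<le> 1\<close> of the matrix \<open>M\<close> of Gaussian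
  columns reduces the claim to the one-dimensional bound for monic polynomials.\<close>

lemma nn_integral_log_cost_det_columns_mat:
  fixes S :: "'a::real_complex^'d^'d" and f :: "'d \<Rightarrow> nat"
  assumes S: "S \<in> pos_def" and f: "inj f" "range f \<subseteq> {..<n}"
  shows "(\<integral>\<^sup>+ Y. log_cost (norm (det (columns_mat f Y))) \<partial>PiM {..<n} (\<lambda>_. gaussian S)) < \<infinity>"
proof -
  obtain K and \<gamma> :: "('a^'d) measure" where \<gamma>: "finite_measure \<gamma>" "sets \<gamma> = sets borel"
    "\<forall>f\<in>borel_measurable borel. \<forall>a. norm a \<le> 1 \<longrightarrow>
      (\<integral>\<^sup>+ y. f y \<partial>gaussian S) \<le> ennreal K * (\<integral>\<^sup>+ y. f (y + a) \<partial>\<gamma>)"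
    using gaussian_shift_le[OF S] .
  obtain C where C: "C < \<infinity>"
    "\<And>M :: 'a^'d^'d.
      (\<integral>\<^sup>+ t. log_cost (norm (det (M + t *\<^sub>R mat 1))) * indicator {0..1} t \<partial>lborel) \<le> C"
    using nn_integral_log_cost_det_shift[where 'a='a and 'd='d] by blast
  interpret finite_measure \<gamma> by (rule \<gamma>)
  interpret P: product_sigma_finite "\<lambda>_. \<gamma>"
    by (rule product_sigma_finite.intro) (rule sigma_finite_measure_axioms)
  define Q where "Q = PiM {..<n} (\<lambda>_. \<gamma>)"
  define P where "P = PiM {..<n} (\<lambda>_. gaussian S)"
  interpret Q: sigma_finite_measure Q
    unfolding Q_def by (rule P.sigma_finite) simp
  interpret QL: pair_sigma_finite lborel Q ..
  have sQ [measurable_cong]: "sets Q = sets (PiM {..<n} (\<lambda>_. borel))"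
    unfolding Q_def by (intro sets_PiM_cong) (auto simp: \<gamma>)
  have mass: "emeasure Q (space Q) < \<infinity>"
  proof -
    have "emeasure Q (space Q) = (\<Prod>i\<in>{..<n}. emeasure \<gamma> (space \<gamma>))"
      unfolding Q_def space_PiM by (rule P.emeasure_PiM) auto
    moreover have "emeasure \<gamma> (space \<gamma>) < \<infinity>"
      using emeasure_finite[of "space \<gamma>"] by (simp only: less_top infinity_ennreal_def)
    ultimately show ?thesis
      by (simp add: power_less_top_ennreal)
  qed
  note [measurable] = measurable_columns_mat[OF f(2), where 'a='a]
  define F :: "(nat \<Rightarrow> 'a^'d) \<Rightarrow> ennreal" where "F Y = log_cost (norm (det (columns_mat f Y)))" for Y
  have [measurable]: "F \<in> borel_measurable (PiM {..<n} (\<lambda>_. borel))"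
    unfolding F_def[abs_def] by measurable
  define a where "a t i = (if i \<in> range f then t *\<^sub>R axis (inv f i) 1 else 0 :: 'a^'d)" for t i
  have shift: "(\<integral>\<^sup>+ Y. F Y \<partial>P)
      \<le> ennreal K ^ n * (\<integral>\<^sup>+ Y. log_cost (norm (det (columns_mat f Y + t *\<^sub>R mat 1))) \<partial>Q)"
    if t: "t \<in> {0..1}" for t
  proof -
    have "norm (a t i) \<le> 1" for i
      using t by (auto simp: a_def norm_eq_sqrt_inner[of "axis _ _"] inner_axis_axis inner_one_one)
    then have "(\<integral>\<^sup>+ Y. F Y \<partial>P) \<le> ennreal K ^ card {..<n} * (\<integral>\<^sup>+ Y. F (\<lambda>i\<in>{..<n}. Y i + a t i) \<partial>Q)"
      unfolding P_def Q_def
      by (intro nn_integral_PiM_le_shift)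
         (use \<gamma> in \<open>auto simp: sets_gaussian sigma_finite_measure_axioms
            intro: finite_measure.axioms(1)[OF finite_measure_gaussian(1)[OF S]]\<close>)
    then show ?thesis
      unfolding F_def a_def columns_mat_shift[OF f] by simp
  qed
  \<comment> \<open>The left side is constant in t, hence equal to its own average over [0, 1];
    every t may then use its own translation of the samples.\<close>
  have "(\<integral>\<^sup>+ Y. F Y \<partial>P) = (\<integral>\<^sup>+ t. (\<integral>\<^sup>+ Y. F Y \<partial>P) * indicator {0..1} (t::real) \<partial>lborel)"
    by (simp add: nn_integral_cmult)
  also have "\<dots> \<le> (\<integral>\<^sup>+ t. ennreal K ^ n *
      (\<integral>\<^sup>+ Y. log_cost (norm (det (columns_mat f Y + t *\<^sub>R mat 1))) * indicator {0..1} t \<partial>Q) \<partial>lborel)"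
  proof (rule nn_integral_mono)
    fix t :: real
    show "(\<integral>\<^sup>+ Y. F Y \<partial>P) * indicator {0..1} t \<le> ennreal K ^ n *
      (\<integral>\<^sup>+ Y. log_cost (norm (det (columns_mat f Y + t *\<^sub>R mat 1))) * indicator {0..1} t \<partial>Q)"
      using shift[of t] by (cases "t \<in> {0..1}") auto
  qed
  also have "\<dots> = ennreal K ^ n * (\<integral>\<^sup>+ t. \<integral>\<^sup>+ Y. log_cost (norm (det (columns_mat f Y + t *\<^sub>R mat 1)))
      * indicator {0..1} t \<partial>Q \<partial>lborel)"
    by (rule nn_integral_cmult) measurable
  \<comment> \<open>The interchange puts the integral over t inside, where the bound C holds for
    each fixed Y.\<close>
  also have "(\<integral>\<^sup>+ t. \<integral>\<^sup>+ Y. log_cost (norm (det (columns_mat f Y + t *\<^sub>R mat 1))) * indicator {0..1} t \<partial>Q \<partial>lborel)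
     = (\<integral>\<^sup>+ Y. \<integral>\<^sup>+ t. log_cost (norm (det (columns_mat f Y + t *\<^sub>R mat 1))) * indicator {0..1} t \<partial>lborel \<partial>Q)"
    by (rule QL.Fubini'[symmetric]) measurable
  also have "\<dots> \<le> (\<integral>\<^sup>+ Y. C \<partial>Q)"
    by (intro nn_integral_mono C)
  also have "\<dots> = C * emeasure Q (space Q)" by simp
  finally have "(\<integral>\<^sup>+ Y. F Y \<partial>P) \<le> ennreal K ^ n * (C * emeasure Q (space Q))"
    by (simp add: mult_left_mono)
  also have "\<dots> < \<infinity>"
    using C(1) mass by (simp add: ennreal_mult_less_top power_less_top_ennreal)
  finally show ?thesis
    unfolding F_def P_def .
qed

text \<open>For t >= 0, (\<delta> t)^2 <= 2 exp (\<delta> t) replaces the square of a sum by a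
  product over the samples, integrated factor by factor. With \<delta> half the Gaussian rate e, the
  integrand exp (- \<delta> |y|^2) that remains is integrable.\<close>

lemma nn_integral_square_norm_gaussian:
  fixes S :: "'a::real_complex^'d^'d" and n :: nat
  assumes S: "S \<in> pos_def"
  shows "(\<integral>\<^sup>+ Y. ennreal ((\<Sum>i<n. (norm (Y i))\<^sup>2)\<^sup>2) \<partial>PiM {..<n} (\<lambda>_. gaussian S)) < \<infinity>"
proof -
  obtain C e where C: "C > 0" "e > 0" "\<forall>f\<in>borel_measurable borel.
      (\<integral>\<^sup>+ y. f y \<partial>gaussian S) \<le> ennreal C * (\<integral>\<^sup>+ y. ennreal (exp (- e * (norm y)\<^sup>2)) * f y \<partial>lborel)"
    using gaussian_dominated[OF S] .
  define \<delta> where "\<delta> = e / 2"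
  have \<delta>: "\<delta> > 0" using C(2) by (simp add: \<delta>_def)
  interpret G: finite_measure "gaussian S" by (rule finite_measure_gaussian[OF S])
  interpret P: product_sigma_finite "\<lambda>_. gaussian S"
    by (rule product_sigma_finite.intro) (rule G.sigma_finite_measure_axioms)
  define P where "P = PiM {..<n} (\<lambda>_. gaussian S)"
  have sP [measurable_cong]: "sets P = sets (PiM {..<n} (\<lambda>_. borel))"
    unfolding P_def by (rule sets_PiM_gaussian)
  have fin: "(\<integral>\<^sup>+ y. ennreal (exp (\<delta> * (norm y)\<^sup>2)) \<partial>gaussian S) < \<infinity>"
  proof -
    have "(\<integral>\<^sup>+ y. ennreal (exp (\<delta> * (norm y)\<^sup>2)) \<partial>gaussian S)
        \<le> ennreal C * (\<integral>\<^sup>+ y. ennreal (exp (- e * (norm y)\<^sup>2)) * ennreal (exp (\<delta> * (norm y)\<^sup>2)) \<partial>(lborel :: ('a^'d) measure))"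
      by (rule C(3)[rule_format]) measurable
    also have "(\<integral>\<^sup>+ y. ennreal (exp (- e * (norm y)\<^sup>2)) * ennreal (exp (\<delta> * (norm y)\<^sup>2)) \<partial>(lborel :: ('a^'d) measure))
        = (\<integral>\<^sup>+ y. ennreal (exp (- \<delta> * (norm y)\<^sup>2)) \<partial>(lborel :: ('a^'d) measure))"
      by (intro nn_integral_cong) (simp add: \<delta>_def field_simps flip: ennreal_mult exp_add)
    finally show ?thesis
      using nn_integral_exp_neg_norm_square[OF \<delta>, where 'b="'a^'d"]
      by (auto simp: ennreal_mult_less_top elim!: le_less_trans)
  qed
  have "(\<integral>\<^sup>+ Y. ennreal ((\<Sum>i<n. (norm (Y i))\<^sup>2)\<^sup>2) \<partial>P)
      \<le> (\<integral>\<^sup>+ Y. ennreal (2 / \<delta>\<^sup>2) * (\<Prod>i<n. ennreal (exp (\<delta> * (norm (Y i))\<^sup>2))) \<partial>P)"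
  proof (rule nn_integral_mono)
    fix Y :: "nat \<Rightarrow> 'a^'d"
    define t where "t = (\<Sum>i<n. (norm (Y i))\<^sup>2)"
    have "(\<delta> * t)\<^sup>2 \<le> 2 * exp (\<delta> * t)"
    proof -
      have "\<delta> * t \<ge> 0" using \<delta> by (simp add: t_def sum_nonneg)
      then show ?thesis
        using exp_lower_Taylor_quadratic[of "\<delta> * t"] by linarith
    qed
    then have "t\<^sup>2 \<le> 2 / \<delta>\<^sup>2 * exp (\<delta> * t)"
      using \<delta> by (simp add: power_mult_distrib field_simps)
    then have "ennreal (t\<^sup>2) \<le> ennreal (2 / \<delta>\<^sup>2) * ennreal (exp (\<delta> * t))"
      by (subst ennreal_mult[symmetric]) (auto intro: ennreal_leI)
    also have "ennreal (exp (\<delta> * t)) = (\<Prod>i<n. ennreal (exp (\<delta> * (norm (Y i))\<^sup>2)))"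
      by (simp add: t_def sum_distrib_left exp_sum prod_ennreal)
    finally show "ennreal ((\<Sum>i<n. (norm (Y i))\<^sup>2)\<^sup>2)
        \<le> ennreal (2 / \<delta>\<^sup>2) * (\<Prod>i<n. ennreal (exp (\<delta> * (norm (Y i))\<^sup>2)))"
      unfolding t_def .
  qed
  also have "\<dots> = ennreal (2 / \<delta>\<^sup>2) * (\<integral>\<^sup>+ Y. (\<Prod>i<n. ennreal (exp (\<delta> * (norm (Y i))\<^sup>2))) \<partial>P)"
    by (rule nn_integral_cmult) measurable
  also have "(\<integral>\<^sup>+ Y. (\<Prod>i<n. ennreal (exp (\<delta> * (norm (Y i))\<^sup>2))) \<partial>P)
      = (\<Prod>i<n. \<integral>\<^sup>+ y. ennreal (exp (\<delta> * (norm y)\<^sup>2)) \<partial>gaussian S)"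
    unfolding P_def by (rule P.product_nn_integral_prod) auto
  also have "ennreal (2 / \<delta>\<^sup>2) * \<dots> < \<infinity>"
    using fin by (simp add: ennreal_mult_less_top power_less_top_ennreal)
  finally show ?thesis unfolding P_def .
qed

text \<open>The bounds 1 / (k + 1) on the quadratic form exhaust the cone by countably many closed
  sets; \<open>pos_def_lower_bound\<close> puts every positive definite matrix into one of
  them.\<close>

lemma pos_def_borel [measurable]: "(pos_def :: ('a::real_complex^'d^'d) set) \<in> sets borel"
proof -
  define K :: "nat \<Rightarrow> ('a^'d^'d) set" where
    "K k = {A. conj_transpose A = A \<and> (\<forall>y. (norm y)\<^sup>2 / real (Suc k) \<le> y \<bullet> (A *v y))}" for k
  have "linear (\<lambda>A :: 'a^'d^'d. y \<bullet> (A *v y))" for y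
    by (intro linearI) (auto simp: matrix_vector_mult_add_rdistrib scaleR_matrix_vector_mult inner_add_right)
  then have cont: "continuous_on UNIV (\<lambda>A :: 'a^'d^'d. y \<bullet> (A *v y))" for y
    by (intro linear_continuous_on) (simp add: linear_conv_bounded_linear)
  then have closed: "closed (K k)" for k
    unfolding K_def
    by (intro closed_Collect_conj closed_Collect_all closed_Collect_eq closed_Collect_le cont
        continuous_on_const continuous_on_conj_transpose continuous_on_id)
  have "pos_def = (\<Union>k. K k)"
  proof (intro equalityI subsetI)
    fix A :: "'a^'d^'d" assume A: "A \<in> pos_def"
    obtain e where e: "e > 0" "\<And>y. e * (norm y)\<^sup>2 \<le> y \<bullet> (A *v y)"
      using pos_def_lower_bound[OF A] by blast
    obtain k where k: "inverse (real (Suc k)) < e"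
      using reals_Archimedean[OF e(1)] by blast
    have "(norm y)\<^sup>2 / real (Suc k) \<le> y \<bullet> (A *v y)" for y
    proof -
      have "inverse (real (Suc k)) * (norm y)\<^sup>2 \<le> e * (norm y)\<^sup>2"
        using k by (intro mult_right_mono) auto
      also note e(2)[of y]
      finally show ?thesis by (simp add: divide_inverse mult.commute)
    qed
    then show "A \<in> (\<Union>k. K k)"
      using pos_def_hermitian[OF A] by (auto simp: K_def hermitian_def)
  next
    fix A :: "'a^'d^'d" assume "A \<in> (\<Union>k. K k)"
    then obtain k where k: "A \<in> K k" by blast
    have "y \<bullet> (A *v y) > 0" if "y \<noteq> 0" for y
    proof -
      have "0 < (norm y)\<^sup>2 / real (Suc k)" using that by simp
      also have "\<dots> \<le> y \<bullet> (A *v y)" using k by (simp add: K_def)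
      finally show ?thesis .
    qed
    with k show "A \<in> pos_def"
      by (simp add: pos_def_def hermitian_def K_def)
  qed
  moreover have "(\<Union>k. K k) \<in> sets borel"
    using closed by (intro sets.countable_UN) (auto intro: borel_closed)
  ultimately show ?thesis by simp
qed

section \<open>The projective Wishart law and its symmetries\<close>

lemma measurable_proj_det:
  "proj_det \<in> restrict_space borel pos_def \<rightarrow>\<^sub>M restrict_space borel (unit_det :: ('a::real_complex^'d^'d) set)"
proof (rule measurable_restrict_space2)
  show "proj_det \<in> space (restrict_space borel pos_def) \<rightarrow> (unit_det :: ('a^'d^'d) set)"
    by (auto simp: space_restrict_space proj_det_unit_det)
  have "continuous_on (pos_def :: ('a^'d^'d) set) proj_det"
    unfolding proj_det_def[abs_def]
    by (intro continuous_intros bounded_linear.continuous_on[OF bounded_linear_kre])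
       (auto dest: det_pos_def(2))
  then show "proj_det \<in> restrict_space borel pos_def \<rightarrow>\<^sub>M (borel :: ('a^'d^'d) measure)"
    by (rule borel_measurable_continuous_on_restrict)
qed

lemma sets_proj_wishart: "sets (proj_wishart S n) = sets (restrict_space borel unit_det)"
  by (simp add: proj_wishart_def)

lemma space_proj_wishart: "space (proj_wishart S n) = unit_det"
  by (simp add: proj_wishart_def space_restrict_space)

lemma nn_integral_proj_wishart:
  fixes S :: "'a::real_complex^'d^'d"
  assumes F: "F \<in> borel_measurable (restrict_space borel unit_det)"
  shows "(\<integral>\<^sup>+ y. F y \<partial>proj_wishart S n)
    = (\<integral>\<^sup>+ Y. F (proj_det (gram n Y)) * indicator pos_def (gram n Y) \<partial>PiM {..<n} (\<lambda>_. gaussian S))"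
proof -
  have W: "wishart S n = distr (PiM {..<n} (\<lambda>_. gaussian S)) borel (gram n)"
    unfolding wishart_def gram_def[abs_def] ..
  have sW: "sets (wishart S n) = sets borel"
    by (simp add: W)
  have gr: "gram n \<in> PiM {..<n} (\<lambda>_. gaussian S) \<rightarrow>\<^sub>M (borel :: ('a^'d^'d) measure)"
    using measurable_gram measurable_cong_sets[OF sets_PiM_gaussian refl] by blast
  have pd: "proj_det \<in> restrict_space (wishart S n) pos_def \<rightarrow>\<^sub>M restrict_space borel unit_det"
    using measurable_proj_det measurable_cong_sets[OF sets_restrict_space_cong[OF sW] refl] by blast
  have "(\<lambda>x. F (proj_det x)) \<in> borel_measurable (restrict_space borel pos_def)"
    using measurable_compose[OF measurable_proj_det F] .
  then have m: "(\<lambda>x. F (proj_det x) * indicator pos_def x) \<in> borel_measurable borel"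
    by (subst (asm) borel_measurable_restrict_space_iff_ennreal) auto
  have "(\<integral>\<^sup>+ y. F y \<partial>proj_wishart S n) = (\<integral>\<^sup>+ x. F (proj_det x) \<partial>restrict_space (wishart S n) pos_def)"
    unfolding proj_wishart_def using F pd by (subst nn_integral_distr) auto
  also have "\<dots> = (\<integral>\<^sup>+ x. F (proj_det x) * indicator pos_def x \<partial>wishart S n)"
    by (rule nn_integral_restrict_space) (simp add: sW)
  also have "\<dots> = (\<integral>\<^sup>+ Y. F (proj_det (gram n Y)) * indicator pos_def (gram n Y) \<partial>PiM {..<n} (\<lambda>_. gaussian S))"
    unfolding W using m gr by (subst nn_integral_distr) auto
  finally show ?thesis .
qed

lemma ex_inj_into_lessThan:
  assumes "CARD('d::finite) \<le> n"
  obtains f :: "'d::finite \<Rightarrow> nat" where "inj f" "range f \<subseteq> {..<n}"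
proof -
  obtain f :: "'d::finite \<Rightarrow> nat" where "bij_betw f UNIV {0..<CARD('d)}"
    using ex_bij_betw_finite_nat[of "UNIV :: 'd set"] by auto
  with that[of f] assms show ?thesis by (force simp: bij_betw_def)
qed

text \<open>Since \<open>log_cost\<close> is infinite at 0, the finiteness of its integral already
  makes the determinant of the selected columns nonzero almost everywhere.\<close>

lemma AE_gram_pos_def:
  fixes S :: "'a::real_complex^'d^'d"
  assumes S: "S \<in> pos_def" and n: "CARD('d) \<le> n"
  shows "AE Y in PiM {..<n} (\<lambda>_. gaussian S). gram n Y \<in> pos_def"
proof -
  obtain f :: "'d \<Rightarrow> nat" where f: "inj f" "range f \<subseteq> {..<n}"
    using ex_inj_into_lessThan[OF n] .
  have [measurable]: "columns_mat f \<in> PiM {..<n} (\<lambda>_. gaussian S) \<rightarrow>\<^sub>M (borel :: ('a^'d^'d) measure)"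
    using measurable_columns_mat[OF f(2)] measurable_cong_sets[OF sets_PiM_gaussian refl] by blast
  have "AE Y in PiM {..<n} (\<lambda>_. gaussian S). log_cost (norm (det (columns_mat f Y))) \<noteq> \<infinity>"
    using nn_integral_log_cost_det_columns_mat[OF S f] by (intro nn_integral_PInf_AE) auto
  then show ?thesis
  proof (rule AE_mp, intro AE_I2 impI)
    fix Y assume "log_cost (norm (det (columns_mat f Y))) \<noteq> \<infinity>"
    then show "gram n Y \<in> pos_def"
      by (intro gram_pos_def(1)[OF f]) (auto simp: log_cost_def)
  qed
qed

text \<open>The restriction to \<open>pos_def\<close> discards only a null set, so the total mass is
  the n-th power of the Gaussian mass.\<close>

lemma finite_measure_proj_wishart:
  fixes S :: "'a::real_complex^'d^'d"
  assumes S: "S \<in> pos_def" and n: "CARD('d) \<le> n"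
  shows "finite_measure (proj_wishart S n)" "emeasure (proj_wishart S n) unit_det \<noteq> 0"
proof -
  interpret G: finite_measure "gaussian S" by (rule finite_measure_gaussian[OF S])
  interpret P: product_sigma_finite "\<lambda>_. gaussian S"
    by (rule product_sigma_finite.intro) (rule G.sigma_finite_measure_axioms)
  define P where "P = PiM {..<n} (\<lambda>_. gaussian S)"
  have "emeasure (proj_wishart S n) unit_det = (\<integral>\<^sup>+ y. 1 \<partial>proj_wishart S n)"
    by (simp add: space_proj_wishart)
  also have "\<dots> = (\<integral>\<^sup>+ Y. 1 * indicator pos_def (gram n Y) \<partial>P)"
    unfolding P_def by (rule nn_integral_proj_wishart) simp
  also have "\<dots> = (\<integral>\<^sup>+ Y. 1 \<partial>P)"
    using AE_gram_pos_def[OF S n] unfolding P_def by (intro nn_integral_cong_AE) auto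
  also have "\<dots> = (\<Prod>i<n. emeasure (gaussian S) UNIV)"
    unfolding P_def using P.emeasure_PiM[of "{..<n}" "\<lambda>_. UNIV"]
    by (simp add: space_PiM sets_gaussian)
  finally have eq: "emeasure (proj_wishart S n) unit_det = emeasure (gaussian S) UNIV ^ n" by simp
  show "emeasure (proj_wishart S n) unit_det \<noteq> 0"
    unfolding eq using finite_measure_gaussian(2)[OF S] by simp
  have "emeasure (gaussian S) UNIV < \<infinity>"
    using G.emeasure_finite[of UNIV] by (simp only: less_top infinity_ennreal_def)
  then have "emeasure (proj_wishart S n) unit_det < \<infinity>"
    unfolding eq by (simp add: power_less_top_ennreal)
  then show "finite_measure (proj_wishart S n)"
    by (intro finite_measureI) (simp add: space_proj_wishart)
qed

text \<open>Applied to every sample, T preserves the Gaussian law and hence the product. It passes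
  through \<open>gram\<close> as a congruence, and this commutes with \<open>proj_det\<close>
  because |det T| = 1.\<close>

lemma proj_wishart_distr:
  fixes S T R :: "'a::real_complex^'d^'d"
  assumes S: "S \<in> pos_def" and TR: "T ** R = mat 1" and TST: "T ** S ** conj_transpose T = S"
    and detT: "norm (det T) = 1"
  shows "distr (proj_wishart S n) (proj_wishart S n) (\<lambda>y. T ** y ** conj_transpose T) = proj_wishart S n"
    "(\<lambda>y. T ** y ** conj_transpose T) \<in> proj_wishart S n \<rightarrow>\<^sub>M proj_wishart S n"
proof -
  define \<tau> where "\<tau> y = T ** y ** conj_transpose T" for y
  define P where "P = PiM {..<n} (\<lambda>_. gaussian S)"
  have RT: "R ** T = mat 1" using TR by (simp add: matrix_left_right_inverse)
  have "continuous_on UNIV \<tau>" unfolding \<tau>_def by (intro continuous_intros)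
  then have "\<tau> \<in> borel_measurable borel" by (rule borel_measurable_continuous_onI)
  then have "\<tau> \<in> restrict_space borel unit_det \<rightarrow>\<^sub>M restrict_space borel unit_det"
    by (intro measurable_restrict_space3)
       (auto simp: \<tau>_def intro!: unit_det_congruence[OF _ RT detT])
  then show m: "(\<lambda>y. T ** y ** conj_transpose T) \<in> proj_wishart S n \<rightarrow>\<^sub>M proj_wishart S n"
    unfolding \<tau>_def[abs_def] measurable_cong_sets[OF sets_proj_wishart sets_proj_wishart] .
  interpret G: finite_measure "gaussian S" by (rule finite_measure_gaussian[OF S])
  define \<theta> :: "(nat \<Rightarrow> 'a^'d) \<Rightarrow> nat \<Rightarrow> 'a^'d" where "\<theta> Y = (\<lambda>i\<in>{..<n}. T *v Y i)" for Y
  have T: "(\<lambda>y. T *v y) \<in> gaussian S \<rightarrow>\<^sub>M gaussian S"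
    by measurable
  have "distr (gaussian S) (gaussian S) (\<lambda>y. T *v y) = distr (gaussian S) borel (\<lambda>y. T *v y)"
    by (rule distr_cong) (auto simp: sets_gaussian)
  then have inv: "distr P P \<theta> = P"
    unfolding P_def \<theta>_def using gaussian_distr_linear[OF S TR TST] T
    by (intro PiM_distr_invariant) (auto simp: G.sigma_finite_measure_axioms)
  have [measurable]: "\<theta> \<in> P \<rightarrow>\<^sub>M P"
    unfolding \<theta>_def P_def using T by measurable
  have gram: "gram n (\<theta> Y) = \<tau> (gram n Y)" for Y
    unfolding \<tau>_def gram_congruence[symmetric] by (simp add: gram_def \<theta>_def)
  have pd: "\<tau> x \<in> pos_def \<longleftrightarrow> x \<in> pos_def" for x
    unfolding \<tau>_def by (rule pos_def_congruence_iff[OF RT])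
  have proj: "proj_det (\<tau> x) = \<tau> (proj_det x)" for x
    unfolding \<tau>_def by (rule proj_det_congruence[OF detT])
  have gr: "gram n \<in> P \<rightarrow>\<^sub>M (borel :: ('a^'d^'d) measure)"
    unfolding P_def using measurable_gram measurable_cong_sets[OF sets_PiM_gaussian refl] by blast
  show "distr (proj_wishart S n) (proj_wishart S n) (\<lambda>y. T ** y ** conj_transpose T) = proj_wishart S n"
  proof (rule measure_eqI)
    fix A assume "A \<in> sets (distr (proj_wishart S n) (proj_wishart S n) (\<lambda>y. T ** y ** conj_transpose T))"
    then have A: "A \<in> sets (proj_wishart S n)" by simp
    then have A': "A \<in> sets (restrict_space borel unit_det)" by (simp add: sets_proj_wishart)
    have iA: "(indicator A :: _ \<Rightarrow> ennreal) \<in> borel_measurable (restrict_space borel unit_det)"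
      using A' by simp
    have iA\<tau>: "(\<lambda>y. indicator A (\<tau> y) :: ennreal) \<in> borel_measurable (restrict_space borel unit_det)"
      using measurable_compose[OF m, of "indicator A :: _ \<Rightarrow> ennreal" borel] A
      iA
      unfolding measurable_cong_sets[OF sets_proj_wishart refl] \<tau>_def[abs_def] by blast
    have "(\<lambda>x. indicator A (proj_det x) :: ennreal) \<in> borel_measurable (restrict_space borel pos_def)"
      using measurable_compose[OF measurable_proj_det iA] .
    then have mA: "(\<lambda>x. indicator A (proj_det x) * indicator pos_def x :: ennreal) \<in> borel_measurable borel"
      by (subst (asm) borel_measurable_restrict_space_iff_ennreal) auto
    have "emeasure (distr (proj_wishart S n) (proj_wishart S n) (\<lambda>y. T ** y ** conj_transpose T)) A
        = (\<integral>\<^sup>+ y. indicator A y \<partial>distr (proj_wishart S n) (proj_wishart S n) \<tau>)"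
      unfolding \<tau>_def using A by simp
    also have "\<dots> = (\<integral>\<^sup>+ y. indicator A (\<tau> y) \<partial>proj_wishart S n)"
      using A m unfolding \<tau>_def by (subst nn_integral_distr) auto
    also have "\<dots> = (\<integral>\<^sup>+ Y. indicator A (\<tau> (proj_det (gram n Y))) * indicator pos_def (gram n Y) \<partial>P)"
      unfolding P_def by (rule nn_integral_proj_wishart[OF iA\<tau>])
    also have "\<dots> = (\<integral>\<^sup>+ Y. indicator A (proj_det (gram n (\<theta> Y))) * indicator pos_def (gram n (\<theta> Y)) \<partial>P)"
      by (simp add: gram proj pd indicator_def)
    also have "\<dots> = (\<integral>\<^sup>+ Y. indicator A (proj_det (gram n Y)) * indicator pos_def (gram n Y) \<partial>distr P P \<theta>)"
      using measurable_compose[OF gr mA] by (subst nn_integral_distr) auto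
    also have "\<dots> = (\<integral>\<^sup>+ y. indicator A y \<partial>proj_wishart S n)"
      unfolding inv unfolding P_def by (rule nn_integral_proj_wishart[OF iA, symmetric])
    finally show "emeasure (distr (proj_wishart S n) (proj_wishart S n) (\<lambda>y. T ** y ** conj_transpose T)) A
        = emeasure (proj_wishart S n) A"
      using A by simp
  qed simp
qed

subsection \<open>The logarithm of a projective Wishart matrix\<close>

lemma continuous_on_mat_log_congruence:
  fixes H R :: "'a::real_complex^'d^'d"
  assumes "R ** H = mat 1"
  shows "continuous_on unit_det (\<lambda>y. mat_log (H ** y ** conj_transpose H))"
  by (rule continuous_on_compose2[OF continuous_on_mat_log])
     (use pos_def_congruence[OF _ assms] in \<open>auto intro!: continuous_intros simp: unit_det_def\<close>)

lemma measurable_mat_log_congruence: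
  fixes H R :: "'a::real_complex^'d^'d"
  assumes "R ** H = mat 1"
  shows "(\<lambda>y. mat_log (H ** y ** conj_transpose H)) \<in> borel_measurable (proj_wishart S n)"
  unfolding measurable_cong_sets[OF sets_proj_wishart refl]
  by (rule borel_measurable_continuous_on_restrict[OF continuous_on_mat_log_congruence[OF assms]])

text \<open>\<open>norm_mat_log_proj_det_le\<close>, applied to the congruence of the Gram matrix by
  H, leaves the negative part of ln det and the trace. The congruence does not change the
  determinant, so d selected columns control the first; the second is a quadratic moment of the
  samples, squared.\<close>

lemma proj_wishart_mat_log_square_integrable:
  fixes S H R :: "'a::real_complex^'d^'d"
  assumes S: "S \<in> pos_def" and n: "CARD('d) \<le> n" and RH: "R ** H = mat 1" and detH: "norm (det H) = 1"
  shows "(\<integral>\<^sup>+ y. ennreal ((norm (mat_log (H ** y ** conj_transpose H)))\<^sup>2) \<partial>proj_wishart S n) < \<infinity>"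
proof -
  obtain f :: "'d \<Rightarrow> nat" where f: "inj f" "range f \<subseteq> {..<n}"
    using ex_inj_into_lessThan[OF n] .
  define P where "P = PiM {..<n} (\<lambda>_. gaussian S)"
  have sP [measurable_cong]: "sets P = sets (PiM {..<n} (\<lambda>_. borel))"
    unfolding P_def by (rule sets_PiM_gaussian)
  note [measurable] = measurable_columns_mat[OF f(2), where 'a='a]
  define d where "d = real CARD('d)"
  define t where "t Y = (\<Sum>i<n. (norm (Y i))\<^sup>2)" for Y :: "nat \<Rightarrow> 'a^'d"
  define F where "F y = ennreal ((norm (mat_log (H ** y ** conj_transpose H)))\<^sup>2)" for y
  have F: "F \<in> borel_measurable (restrict_space borel unit_det)"
    using measurable_mat_log_congruence[OF RH, of S n]
    unfolding F_def measurable_cong_sets[OF sets_proj_wishart refl] by measurable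
  have "bounded_linear (\<lambda>y. H *v y)"
    using linear_matrix_vector_mult[of H] by (simp add: linear_conv_bounded_linear)
  then obtain B where B: "B > 0" "\<And>y. norm (H *v y) \<le> norm y * B"
    using bounded_linear.pos_bounded by blast
  \<comment> \<open>With m the modulus of the determinant of the selected columns, det x >= m m, and
    \<open>log_cost_mult\<close> yields 2 (1 + 1) = 4 copies of the cost of m. B bounds the operator
    norm of H: it enters the trace squared, and the bound takes the square of the trace.\<close>
  define bd where "bd Y = ennreal (8 * d) * (4 * log_cost (norm (det (columns_mat f Y)))
      + ennreal (d\<^sup>2 * B ^ 4) * ennreal ((t Y)\<^sup>2))" for Y
  have bd: "F (proj_det (gram n Y)) \<le> bd Y" if G: "gram n Y \<in> pos_def" for Y
  proof -
    define x where "x = H ** gram n Y ** conj_transpose H"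
    define m where "m = norm (det (columns_mat f Y))"
    have x: "x \<in> pos_def"
      unfolding x_def by (rule pos_def_congruence[OF G RH])
    have detx: "det x = det (gram n Y)"
      unfolding x_def det_congruence detH by simp
    have pos: "kre (det x) > 0" by (rule det_pos_def[OF x])
    have "log_cost (kre (det x)) \<le> log_cost (m * m)"
    proof (cases "m = 0")
      case False
      then have "m\<^sup>2 \<le> kre (det (gram n Y))"
        unfolding m_def by (intro gram_pos_def(2)[OF f]) auto
      then show ?thesis
        unfolding detx by (intro log_cost_antimono) (simp add: power2_eq_square)
    qed (simp add: log_cost_def)
    also have "\<dots> \<le> 2 * (log_cost m + log_cost m)" by (rule log_cost_mult)
    also have "\<dots> = 4 * log_cost m"
      by (simp only: mult_2[symmetric] mult.assoc[symmetric]) simp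
    finally have 1: "log_cost (kre (det x)) \<le> 4 * log_cost m" .
    have tr: "kre (trace x) = (\<Sum>i<n. (norm (H *v Y i))\<^sup>2)"
      unfolding x_def gram_congruence[symmetric] kre_trace_gram ..
    have "(norm (H *v Y i))\<^sup>2 \<le> B\<^sup>2 * (norm (Y i))\<^sup>2" for i
      using power_mono[OF B(2)[of "Y i"] norm_ge_zero, of 2] by (simp add: power_mult_distrib mult.commute)
    then have "kre (trace x) \<le> B\<^sup>2 * t Y"
      unfolding tr t_def sum_distrib_left by (intro sum_mono)
    moreover have "kre (trace x) \<ge> 0" unfolding tr by (simp add: sum_nonneg)
    ultimately have "(d * kre (trace x))\<^sup>2 \<le> (d * (B\<^sup>2 * t Y))\<^sup>2"
      by (intro power_mono mult_left_mono) (auto simp: d_def)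
    also have "\<dots> = (d\<^sup>2 * B ^ 4) * (t Y)\<^sup>2"
      by (simp add: power_mult_distrib flip: power_mult)
    finally have 2: "ennreal ((d * kre (trace x))\<^sup>2) \<le> ennreal (d\<^sup>2 * B ^ 4) * ennreal ((t Y)\<^sup>2)"
      by (subst ennreal_mult[symmetric]) (auto intro: ennreal_leI)
    have "F (proj_det (gram n Y)) = ennreal ((norm (mat_log (proj_det x)))\<^sup>2)"
      unfolding F_def x_def proj_det_congruence[OF detH] ..
    also have "\<dots> \<le> ennreal (8 * d * ((max 0 (- ln (kre (det x))))\<^sup>2 + (d * kre (trace x))\<^sup>2))"
      unfolding d_def by (intro ennreal_leI norm_mat_log_proj_det_le x)
    also have "\<dots> = ennreal (8 * d) * (log_cost (kre (det x)) + ennreal ((d * kre (trace x))\<^sup>2))"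
      using pos by (simp add: log_cost_def ennreal_mult' d_def)
    also have "\<dots> \<le> bd Y"
      unfolding bd_def m_def[symmetric] by (intro mult_left_mono add_mono 1 2) auto
    finally show ?thesis .
  qed
  have "(\<integral>\<^sup>+ y. F y \<partial>proj_wishart S n)
      = (\<integral>\<^sup>+ Y. F (proj_det (gram n Y)) * indicator pos_def (gram n Y) \<partial>P)"
    unfolding P_def by (rule nn_integral_proj_wishart[OF F])
  also have "\<dots> \<le> (\<integral>\<^sup>+ Y. bd Y \<partial>P)"
    by (intro nn_integral_mono) (auto split: split_indicator intro: bd)
  also have "\<dots> = ennreal (8 * d) * (4 * (\<integral>\<^sup>+ Y. log_cost (norm (det (columns_mat f Y))) \<partial>P)
      + ennreal (d\<^sup>2 * B ^ 4) * (\<integral>\<^sup>+ Y. ennreal ((t Y)\<^sup>2) \<partial>P))"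
  proof -
    have [measurable]: "t \<in> borel_measurable P"
      unfolding t_def[abs_def] by measurable
    show ?thesis
      unfolding bd_def by (simp add: nn_integral_cmult nn_integral_add)
  qed
  also have "\<dots> < \<infinity>"
    using nn_integral_log_cost_det_columns_mat[OF S f] nn_integral_square_norm_gaussian[OF S, of n]
    unfolding P_def t_def by (simp add: ennreal_mult_less_top)
  finally show ?thesis unfolding F_def .
qed

definition perm_mat :: "('d \<Rightarrow> 'd) \<Rightarrow> 'a::real_complex^'d^'d" where
  "perm_mat \<sigma> = (\<chi> i j. if j = \<sigma> i then 1 else 0)"

lemma perm_mat_nth: "perm_mat \<sigma> $ i $ j = (if j = \<sigma> i then 1 else 0)"
  by (simp add: perm_mat_def)

lemma unitary_perm_mat:
  fixes \<sigma> :: "'d::finite \<Rightarrow> 'd"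
  assumes "inj \<sigma>"
  shows "unitary (perm_mat \<sigma> :: 'a::real_complex^'d^'d)"
proof -
  have "(perm_mat \<sigma> ** conj_transpose (perm_mat \<sigma>)) $ i $ j = (mat 1 :: 'a^'d^'d) $ i $ j" for i j
  proof -
    have "(perm_mat \<sigma> ** conj_transpose (perm_mat \<sigma>) :: 'a^'d^'d) $ i $ j = (if \<sigma> i = \<sigma> j then 1 else 0)"
      by (simp add: matrix_matrix_mult_def perm_mat_nth if_distrib[of kconj]
          if_distrib[of "\<lambda>t. t * _"] cong: if_cong)
    then show ?thesis
      using injD[OF assms, of i j] by (auto simp: mat_def)
  qed
  then have "perm_mat \<sigma> ** conj_transpose (perm_mat \<sigma>) = (mat 1 :: 'a^'d^'d)"
    by (simp add: vec_eq_iff)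
  then show ?thesis
    by (simp add: unitary_def matrix_left_right_inverse)
qed

lemma perm_mat_conj:
  "(perm_mat \<sigma> ** A ** conj_transpose (perm_mat \<sigma>)) $ i $ j = (A::'a::real_complex^'d^'d) $ \<sigma> i $ \<sigma> j"
proof -
  have 1: "(perm_mat \<sigma> ** A) $ i $ k = A $ \<sigma> i $ k" for k
    by (simp add: matrix_matrix_mult_def perm_mat_nth if_distrib[of "\<lambda>t. t * _"] cong: if_cong)
  show ?thesis
    unfolding matrix_matrix_mult_def[of "perm_mat \<sigma> ** A"]
    by (simp add: 1 perm_mat_nth if_distrib[of kconj] if_distrib[of "\<lambda>t. _ * t"] cong: if_cong)
qed

text \<open>Diagonalise the traceless matrix by \<open>V\<close>; conjugation by transposition matrices shows that the
  diagonal entries of \<open>A\<close> are equal.\<close>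

lemma unitary_invariant_inner_traceless:
  fixes A V :: "'a::real_complex^'d^'d"
  assumes inv: "\<And>U. unitary U \<Longrightarrow> U ** A ** conj_transpose U = A"
    and V: "unitary V" and l: "(\<Sum>i\<in>UNIV. l i) = 0"
  shows "(V ** diag_mat l ** conj_transpose V) \<bullet> A = 0"
proof -
  have "conj_transpose V ** A ** V = A"
    using inv[OF unitary_conj_transpose[OF V]] by simp
  then have "(V ** diag_mat l ** conj_transpose V) \<bullet> A = (\<Sum>i\<in>UNIV. l i * kre (A $ i $ i))"
    by (simp add: inner_congruence inner_diag_mat)
  moreover have "A $ i $ i = A $ j $ j" for i j
  proof -
    have "A $ i $ i = (perm_mat (Transposition.transpose i j) ** A **
        conj_transpose (perm_mat (Transposition.transpose i j))) $ i $ i"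
      by (simp only: inv unitary_perm_mat inj_transpose)
    also have "\<dots> = A $ j $ j"
      unfolding perm_mat_conj by simp
    finally show ?thesis .
  qed
  then have "(\<Sum>i\<in>UNIV. l i * kre (A $ i $ i)) = (\<Sum>i\<in>UNIV. l i * kre (A $ undefined $ undefined))"
    by (metis (no_types, lifting))
  ultimately show ?thesis
    by (simp add: l flip: sum_distrib_right)
qed

subsection \<open>The Frechet mean\<close>

theorem frechet_mean_proj_wishart:
  fixes S :: "'a::real_complex^'d^'d"
  assumes S: "S \<in> pos_def" and n: "CARD('d) \<le> n" and c: "c > 0"
  shows "frechet_mean c (proj_wishart S n) = {proj_det S}"
proof -
  define s where "s = proj_det S"
  have s: "s \<in> unit_det" unfolding s_def by (rule proj_det_unit_det[OF S])
  then have s_pd: "s \<in> pos_def" "det s = 1" by (auto simp: unit_det_def)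
  define r where "r = kre (det S) powr (- 1 / real CARD('d))"
  have r: "s = r *\<^sub>R S" "r > 0"
    using det_pos_def[OF S] by (simp_all add: s_def proj_det_def r_def)
  define H where "H = mat_inv_sqrt s"
  obtain G where G: "hermitian H" "hermitian G" "H ** G = mat 1" "G ** H = mat 1" "G ** G = s"
    using mat_inv_sqrt_pos_def[OF s_pd(1)] unfolding H_def by metis
  have herm: "conj_transpose H = H" "conj_transpose G = G" using G by (simp_all add: hermitian_def)
  have detHG: "det H * det G = 1" using G(3) by (metis det_I det_mul)
  have "det G * det G = 1" using G(5) s_pd(2) by (metis det_mul)
  then have "norm (det G) * norm (det G) = 1" by (metis norm_mult norm_one)
  then have "norm (det G) = 1"
    by (metis norm_ge_zero power2_eq_square real_sqrt_unique real_sqrt_one)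
  then have detH: "norm (det H) = 1"
    using detHG by (metis mult.right_neutral norm_mult norm_one)
  define \<mu> where "\<mu> = proj_wishart S n"
  interpret finite_measure \<mu>
    unfolding \<mu>_def by (rule finite_measure_proj_wishart[OF S n])
  have space: "space \<mu> = unit_det" by (simp add: \<mu>_def space_proj_wishart)
  define L where "L y = mat_log (H ** y ** H)" for y
  have L [measurable]: "L \<in> borel_measurable \<mu>"
    using measurable_mat_log_congruence[OF G(4), of S n] unfolding \<mu>_def L_def herm .
  have "(\<integral>\<^sup>+ y. ennreal ((norm (L y))\<^sup>2) \<partial>\<mu>) < \<infinity>"
    using proj_wishart_mat_log_square_integrable[OF S n G(4) detH] unfolding \<mu>_def L_def herm .
  then have sq: "integrable \<mu> (\<lambda>y. (norm (L y))\<^sup>2)"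
    by (intro integrableI_bounded) auto
  have int: "integrable \<mu> L"
  proof (rule Bochner_Integration.integrable_bound)
    show "integrable \<mu> (\<lambda>y. 1 + (norm (L y))\<^sup>2)" using sq by simp
    have "norm z \<le> 1 + (norm z)\<^sup>2" for z :: "'a^'d^'d"
      using sum_squares_bound[of 1 "norm z"] norm_ge_zero[of z] unfolding one_power2 by linarith
    then show "AE y in \<mu>. norm (L y) \<le> norm (1 + (norm (L y))\<^sup>2)" by simp
  qed measurable
  define \<Lambda> where "\<Lambda> = (\<integral> y. L y \<partial>\<mu>)"
  have inv: "V ** \<Lambda> ** conj_transpose V = \<Lambda>" if V: "unitary V" for V
  proof -
    \<comment> \<open>T = s^(1/2) V s^(-1/2). Congruence by it fixes s, hence also the multiple S of
      s, and L turns it into conjugation by V.\<close>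
    define T where "T = G ** V ** H"
    have T': "conj_transpose T = H ** conj_transpose V ** G"
      by (simp add: T_def conj_transpose_mult herm matrix_mul_assoc)
    have "T ** (G ** conj_transpose V ** H) = G ** (V ** (H ** G) ** conj_transpose V) ** H"
      by (simp only: T_def matrix_mul_assoc)
    then have TR: "T ** (G ** conj_transpose V ** H) = mat 1"
      by (simp add: G unitaryD[OF V])
    have "T ** s ** conj_transpose T = G ** (V ** ((H ** G) ** (G ** H)) ** conj_transpose V) ** G"
      unfolding T' unfolding T_def G(5)[symmetric] by (simp only: matrix_mul_assoc)
    then have "T ** s ** conj_transpose T = s"
      by (simp add: G unitaryD[OF V])
    then have TST: "T ** S ** conj_transpose T = S"
      using r by (simp add: matrix_mult_scaleR_left matrix_mult_scaleR_right)
    have "det T = det V * (det H * det G)"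
      by (simp add: T_def det_mul mult_ac)
    then have detT: "norm (det T) = 1"
      using norm_det_unitary[OF V] by (simp add: detHG)
    note T_inv = proj_wishart_distr[OF S TR TST detT, of n, folded \<mu>_def]
    have LT: "L (T ** y ** conj_transpose T) = V ** L y ** conj_transpose V" if y: "y \<in> unit_det" for y
    proof -
      have "H ** (T ** y ** conj_transpose T) ** H
          = (H ** G) ** V ** (H ** y ** H) ** conj_transpose V ** (G ** H)"
        unfolding T' unfolding T_def by (simp only: matrix_mul_assoc)
      then have "H ** (T ** y ** conj_transpose T) ** H = V ** (H ** y ** H) ** conj_transpose V"
        by (simp add: G)
      moreover have "H ** y ** H \<in> pos_def"
        using y pos_def_congruence[OF _ G(4), of y] by (simp add: unit_det_def herm)
      ultimately show ?thesis
        unfolding L_def by (simp add: mat_log_unitary_conj[OF _ V])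
    qed
    have bl: "bounded_linear (\<lambda>x. V ** x ** conj_transpose V)"
      using bounded_linear_compose[OF bounded_bilinear.bounded_linear_left[OF bounded_bilinear_matrix_mult]
          bounded_bilinear.bounded_linear_right[OF bounded_bilinear_matrix_mult]] .
    have "V ** \<Lambda> ** conj_transpose V = (\<integral> y. V ** L y ** conj_transpose V \<partial>\<mu>)"
      unfolding \<Lambda>_def by (rule integral_bounded_linear[OF bl int, symmetric])
    also have "\<dots> = (\<integral> y. L (T ** y ** conj_transpose T) \<partial>\<mu>)"
      by (rule Bochner_Integration.integral_cong) (auto simp: LT space)
    also have "\<dots> = (\<integral> y. L y \<partial>distr \<mu> \<mu> (\<lambda>y. T ** y ** conj_transpose T))"
      by (rule integral_distr[symmetric, OF T_inv(2) L])
    also have "\<dots> = \<Lambda>" unfolding T_inv(1) \<Lambda>_def ..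
    finally show ?thesis .
  qed
  define \<Phi> where "\<Phi> x = (\<integral>\<^sup>+ y. ennreal ((affine_dist c x y)\<^sup>2) \<partial>\<mu>)" for x
  define q where "q = (\<integral> y. (norm (L y))\<^sup>2 \<partial>\<mu>)"
  have \<Phi>s: "\<Phi> s = ennreal (c\<^sup>2 * q)"
  proof -
    have "\<Phi> s = (\<integral>\<^sup>+ y. ennreal (c\<^sup>2 * (norm (L y))\<^sup>2) \<partial>\<mu>)"
      by (simp add: \<Phi>_def affine_dist_def L_def H_def power_mult_distrib)
    also have "\<dots> = ennreal (\<integral> y. c\<^sup>2 * (norm (L y))\<^sup>2 \<partial>\<mu>)"
      using sq by (intro nn_integral_eq_integral) auto
    finally show ?thesis by (simp add: q_def)
  qed
  have q0: "q \<ge> 0" by (simp add: q_def)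
  have m0: "measure \<mu> unit_det > 0"
    using finite_measure_proj_wishart(2)[OF S n] emeasure_eq_measure[of unit_det]
    by (simp add: \<mu>_def zero_less_measure_iff)
  have less: "\<Phi> s < \<Phi> x" if x: "x \<in> unit_det" "x \<noteq> s" for x
  proof -
    define w where "w = H ** x ** H"
    define h where "h = mat_log w"
    have x_pd: "x \<in> pos_def" using x by (simp add: unit_det_def)
    have w: "w \<in> unit_det"
      using unit_det_congruence[OF x(1) G(4) detH] by (simp add: w_def herm)
    have "G ** w ** G = (G ** H) ** x ** (H ** G)"
      unfolding w_def by (simp only: matrix_mul_assoc)
    \<comment> \<open>G w G = x, so w = I would give x = G G = s.\<close>
    then have "w \<noteq> mat 1" using x(2) by (auto simp: G)
    then have h: "norm h > 0"
      using mat_log_eq_0[of w] w by (auto simp: h_def unit_det_def)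
    obtain U l where U: "unitary U" "h = U ** diag_mat l ** conj_transpose U" "(\<Sum>i\<in>UNIV. l i) = 0"
      using mat_log_unit_det[OF w] unfolding h_def by metis
    have hL: "h \<bullet> \<Lambda> = 0"
      unfolding U(2) using inv U(1,3) by (rule unitary_invariant_inner_traceless)
    have ih: "integrable \<mu> (\<lambda>y. h \<bullet> L y)"
      by (rule integrable_bounded_linear[OF bounded_linear_inner_right int])
    have expand: "(norm (h - L y))\<^sup>2 = (norm h)\<^sup>2 - 2 * (h \<bullet> L y) + (norm (L y))\<^sup>2" for y
      by (simp add: power2_norm_eq_inner inner_diff_left inner_diff_right inner_commute)
    have "(\<integral> y. c\<^sup>2 * (norm (h - L y))\<^sup>2 \<partial>\<mu>)
        = c\<^sup>2 * ((norm h)\<^sup>2 * measure \<mu> unit_det - 2 * (\<integral> y. h \<bullet> L y \<partial>\<mu>) + q)"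
      unfolding expand q_def using sq ih by (simp add: space mult.commute)
    also have "(\<integral> y. h \<bullet> L y \<partial>\<mu>) = h \<bullet> \<Lambda>"
      unfolding \<Lambda>_def by (rule integral_bounded_linear[OF bounded_linear_inner_right int])
    finally have I: "(\<integral> y. c\<^sup>2 * (norm (h - L y))\<^sup>2 \<partial>\<mu>) = c\<^sup>2 * ((norm h)\<^sup>2 * measure \<mu> unit_det + q)"
      by (simp add: hL)
    \<comment> \<open>Here square integrability pays off: q is the true finite mean of |L|^2, so
      adding a positive multiple of |h|^2 gives a strict inequality.\<close>
    have "c\<^sup>2 * q < c\<^sup>2 * ((norm h)\<^sup>2 * measure \<mu> unit_det + q)"
      using c h m0 by simp
    then have "\<Phi> s < ennreal (\<integral> y. c\<^sup>2 * (norm (h - L y))\<^sup>2 \<partial>\<mu>)"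
      unfolding \<Phi>s I using q0 by (simp add: ennreal_less_iff)
    also have "\<dots> = (\<integral>\<^sup>+ y. ennreal (c\<^sup>2 * (norm (h - L y))\<^sup>2) \<partial>\<mu>)"
    proof (rule nn_integral_eq_integral[symmetric])
      show "integrable \<mu> (\<lambda>y. c\<^sup>2 * (norm (h - L y))\<^sup>2)"
        unfolding expand using sq ih by simp
    qed simp
    also have "\<dots> \<le> \<Phi> x"
      unfolding \<Phi>_def
    proof (intro nn_integral_mono ennreal_leI)
      fix y assume "y \<in> space \<mu>"
      then have y: "y \<in> pos_def" by (simp add: space unit_det_def)
      have "H ** y ** H \<in> pos_def" "w \<in> pos_def"
        using pos_def_congruence[OF y G(4)] w by (simp_all add: herm unit_det_def)
      then have "c\<^sup>2 * (norm (h - L y))\<^sup>2 \<le> (affine_dist c w (H ** y ** H))\<^sup>2"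
        unfolding h_def L_def by (intro norm_mat_log_diff_le_affine_dist)
      also have "affine_dist c w (H ** y ** H) = affine_dist c x y"
        using affine_dist_congruence[OF x_pd y G(4), of c] by (simp add: w_def herm)
      finally show "c\<^sup>2 * (norm (h - L y))\<^sup>2 \<le> (affine_dist c x y)\<^sup>2" .
    qed
    finally show ?thesis .
  qed
  have "is_arg_min \<Phi> (\<lambda>x. x \<in> unit_det) x \<longleftrightarrow> x = s" for x
    unfolding is_arg_min_def using s less by (metis less_asym less_irrefl)
  then show ?thesis
    unfolding frechet_mean_def \<Phi>_def \<mu>_def s_def by auto
qed

theorem theorem1:
  fixes \<Sigma>\<^sub>r :: "real^'d^'d" and \<Sigma>\<^sub>c :: "complex^'d^'d" and n :: nat and c :: real
  assumes "CARD('d) \<le> n" and "c > 0"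
  shows "(\<Sigma>\<^sub>r \<in> pos_def \<longrightarrow>
            frechet_mean c (proj_wishart \<Sigma>\<^sub>r n) = {proj_det \<Sigma>\<^sub>r} \<and>
            proj_det \<Sigma>\<^sub>r = (1 / det \<Sigma>\<^sub>r powr (1 / real CARD('d))) *\<^sub>R \<Sigma>\<^sub>r) \<and>
         (\<Sigma>\<^sub>c \<in> pos_def \<longrightarrow>
            frechet_mean c (proj_wishart \<Sigma>\<^sub>c n) = {proj_det \<Sigma>\<^sub>c} \<and>
            proj_det \<Sigma>\<^sub>c = (1 / Re (det \<Sigma>\<^sub>c) powr (1 / real CARD('d))) *\<^sub>R \<Sigma>\<^sub>c)"
proof -
  have "proj_det \<Sigma>\<^sub>r = (1 / det \<Sigma>\<^sub>r powr (1 / real CARD('d))) *\<^sub>R \<Sigma>\<^sub>r"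
    by (simp add: proj_det_def kre_real powr_minus_divide)
  moreover have "proj_det \<Sigma>\<^sub>c = (1 / Re (det \<Sigma>\<^sub>c) powr (1 / real CARD('d))) *\<^sub>R \<Sigma>\<^sub>c"
    by (simp add: proj_det_def kre_complex powr_minus_divide)
  ultimately show ?thesis
    using frechet_mean_proj_wishart[of \<Sigma>\<^sub>r, OF _ assms] frechet_mean_proj_wishart[of \<Sigma>\<^sub>c, OF _ assms]
    by simp
qed

end
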